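(* Let $t\geq 1$ be an integer and let $S_t$ denote the star with $t$ edges. A rational number $r$ is realizable for $S_t$ if and only if $r\in\{0,1\}$ or $r\in[t,t+1]$.
   Context: For a graph $H$ and a family of graphs $\mathcal{F}$, $\mathrm{ex}(n,H,\mathcal{F})$ denotes the maximum number of copies of $H$ in an $n$-vertex graph containing no copy (as a subgraph) of any member of $\mathcal{F}$. A rational $r$ is realizable for $H$ if there exists a finite family of graphs $\mathcal{F}_r$ such that $\mathrm{ex}(n,H,\mathcal{F}_r)=\Theta(n^r)$, where $\Theta$ is as $n\to\infty$ with the family fixed. *)

theory Defs
  imports Complex_Main "HOL-Library.Landau_Symbols"
begin

type_synonym 'a graph = "'a set \<times> 'a set set"

abbreviation verts :: "'a graph \<Rightarrow> 'a set" where
  "verts \<equiv> fst"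

abbreviation edges :: "'a graph \<Rightarrow> 'a set set" where
  "edges \<equiv> snd"

definition simple_graph :: "'a graph \<Rightarrow> bool" where
  "simple_graph G \<longleftrightarrow> finite (verts G) \<and> (\<forall>e\<in>edges G. e \<subseteq> verts G \<and> card e = 2)"

definition subgraph :: "'a graph \<Rightarrow> 'a graph \<Rightarrow> bool" where
  "subgraph C G \<longleftrightarrow> simple_graph C \<and> verts C \<subseteq> verts G \<and> edges C \<subseteq> edges G"

definition graph_iso :: "'a graph \<Rightarrow> 'b graph \<Rightarrow> bool" where
  "graph_iso G H \<longleftrightarrow> (\<exists>f. bij_betw f (verts G) (verts H) \<and> (\<lambda>e. f ` e) ` edges G = edges H)"

text \<open>Copies are unlabelled and not necessarily induced: a copy of \<open>H\<close> in \<open>G\<close> is a subgraph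
  of \<open>G\<close> isomorphic to \<open>H\<close>.\<close>

definition copies :: "'b graph \<Rightarrow> 'a graph \<Rightarrow> 'a graph set" where
  "copies H G = {C. subgraph C G \<and> graph_iso C H}"

definition free_of :: "'b graph set \<Rightarrow> 'a graph \<Rightarrow> bool" where
  "free_of \<F> G \<longleftrightarrow> (\<forall>F\<in>\<F>. copies F G = {})"

text \<open>Every finite graph is isomorphic to one whose vertices are natural numbers, so host graphs
  and forbidden graphs are taken over \<open>nat\<close>. The supremum is over a finite set of numbers, hence a
  maximum; it is \<open>0\<close> if no graph on \<open>n\<close> vertices is \<open>\<F>\<close>-free (which happens for large \<open>n\<close> exactly
  if \<open>\<F>\<close> contains an edgeless graph).\<close>

definition ex_values :: "nat \<Rightarrow> nat graph \<Rightarrow> nat graph set \<Rightarrow> nat set" where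
  "ex_values n H \<F> =
     {card (copies H G) | G :: nat graph. simple_graph G \<and> card (verts G) = n \<and> free_of \<F> G}"

definition ex :: "nat \<Rightarrow> nat graph \<Rightarrow> nat graph set \<Rightarrow> nat" where
  "ex n H \<F> = Sup (ex_values n H \<F>)"

lemma finite_copies: "simple_graph G \<Longrightarrow> finite (copies H G)"
  and card_copies_le: "simple_graph G \<Longrightarrow> card (copies H G) \<le> 2 ^ card (verts G) * 2 ^ 2 ^ card (verts G)"
proof -
  assume G: "simple_graph G"
  let ?B = "Pow (verts G) \<times> Pow (Pow (verts G))"
  have fin: "finite (verts G)" using G by (simp add: simple_graph_def)
  have sub: "copies H G \<subseteq> ?B"
    using G by (fastforce simp: copies_def subgraph_def simple_graph_def)
  show "finite (copies H G)" using sub fin by (auto intro: finite_subset)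
  have "card (copies H G) \<le> card ?B" using sub fin by (intro card_mono) auto
  then show "card (copies H G) \<le> 2 ^ card (verts G) * 2 ^ 2 ^ card (verts G)"
    using fin by (simp add: card_cartesian_product card_Pow)
qed

lemma finite_ex_values: "finite (ex_values n H \<F>)"
proof (rule finite_subset)
  show "ex_values n H \<F> \<subseteq> {..2 ^ n * 2 ^ 2 ^ n}"
    unfolding ex_values_def using card_copies_le by blast
qed simp

lemma ex_eq_Max: "ex_values n H \<F> \<noteq> {} \<Longrightarrow> ex n H \<F> = Max (ex_values n H \<F>)"
  by (simp add: ex_def Sup_nat_def)

definition realizable :: "rat \<Rightarrow> nat graph \<Rightarrow> bool" where
  "realizable r H \<longleftrightarrow>
     (\<exists>\<F>. finite \<F> \<and> (\<forall>F\<in>\<F>. simple_graph F) \<and>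
        (\<lambda>n. real (ex n H \<F>)) \<in> \<Theta>(\<lambda>n. real n powr of_rat r))"

definition star :: "nat \<Rightarrow> nat graph" where
  "star t = ({0..t}, {{0, i} | i. i \<in> {1..t}})"

end

theory Submission
  imports Defs "HOL-Algebra.Algebraic_Closure_Type" "HOL-Library.Z2" "HOL-Library.FuncSet"
begin

text \<open>The number of copies of \<open>S\<^sub>t\<close> in a graph is of the order of \<open>\<Sum>\<^sub>v d(v)\<^sup>t\<close>. If no forbidden graph sits
  inside a star, then a spanning star gives \<open>n\<^sup>t\<close> copies; otherwise the degrees are bounded and the count
  is either linear (disjoint stars are allowed) or bounded.

  For \<open>t < r < t + 1\<close> write \<open>r = t + 1 - t a / b\<close> and take a balanced rooted tree with \<open>b\<close> edges and \<open>a\<close>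
  non-roots, as Bukh and Conlon do; the forbidden graphs are those with \<open>p\<close> embeddings of the tree that
  agree on the roots. Counting embeddings greedily shows that in a graph avoiding them at most
  \<open>O((n / s)\<^bsup>b/a\<^esup>)\<close> vertices have degree at least \<open>s\<close>, which bounds \<open>\<Sum>\<^sub>v d(v)\<^sup>t\<close> because \<open>b / a > t\<close>.

  The lower bound is a bipartite graph on two copies of \<open>F\<^sub>q\<^sup>b\<close>, \<open>q = 2\<^sup>m\<close>, given by \<open>a\<close> polynomial
  equations whose coefficients satisfy no \<open>F\<^sub>2\<close>-polynomial relation of degree at most a constant \<open>D\<close>. This
  genericity replaces the Lang-Weil bound. Among too many embeddings with the same roots one finds
  \<open>k\<close> of them, each with a coordinate that is again generic over the previous data. All these generic
  elements, coefficients included, are rational functions of bounded degree in the roots, the non-root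
  vertices of the union of the \<open>k\<close> embeddings and the coefficients not determined by the equations at its
  edges. By balancedness these generators are fewer than the generic elements once \<open>k\<close> is large, and
  counting polynomials of degree \<open>D\<close> yields a relation.\<close>

section \<open>Fields of characteristic two\<close>

text \<open>The constants are chosen in an order without circularity: the number of embeddings, the
  shape \<open>J\<close>, \<open>M\<close> of the equations, the degree \<open>D\<close> and the
  number \<open>p\<close> depend on the tree alone, and only afterwards does q grow. Genericity up
  to one fixed degree is available in every sufficiently large finite field.

  The exponent is read off the algebraic graph: q^b centres of degree at least q^(b-a) give at least
  about q^(b + t(b-a)) stars on 2 q^b vertices. The upper bound sums n^t k^(-\<theta>) over the
  ranks k of the degrees, with \<theta> = t a / b. It needs \<theta> < 1, that is r > t. At r = t
  the same sum would carry a logarithm, so the exponent t is obtained from a different family, and t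
  + 1 from the empty one.

  The equations are sums of univariate polynomials in several linear forms. Once one form takes
  distinct values at the finitely many edges considered, solving for the determined coefficients is
  univariate interpolation, whose denominators have bounded degree.\<close>

class char2_field = field +
  assumes one_plus_one: "1 + 1 = 0"
begin

lemma add_self [simp]: "x + x = 0"
proof -
  have "x + x = x * (1 + 1)" by (simp only: distrib_left mult_1_right)
  then show ?thesis by (simp only: one_plus_one mult_zero_right)
qed

lemma uminus_eq_self: "- x = x"
  using add_self[of x] by (metis local.add_eq_0_iff)

lemma diff_eq_add: "x - y = x + y"
  using uminus_eq_self[of y] by (metis local.add_uminus_conv_diff)

lemma add_eq_0_iff_eq: "x + y = 0 \<longleftrightarrow> x = y"
  by (metis diff_eq_add local.eq_iff_diff_eq_0)

end

instance bit :: char2_field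
  by standard (unfold plus_bit_def zero_bit_def, simp)

instance alg_closure :: (char2_field) char2_field
proof
  have "to_ac (1 + 1 :: 'a) = 0" by (simp only: one_plus_one to_ac_0)
  then show "(1::'a alg_closure) + 1 = 0" by (simp only: to_ac_add to_ac_1)
qed

lemma add_power_2_power:
  fixes x y :: "'k::char2_field"
  shows "(x + y) ^ (2 ^ m) = x ^ (2 ^ m) + y ^ (2 ^ m)"
proof (induction m)
  case (Suc m)
  have sq: "(u + v) ^ 2 = u ^ 2 + v ^ 2" for u v :: 'k
  proof -
    have "(u + v) ^ 2 = u ^ 2 + v ^ 2 + (u * v + u * v)"
      unfolding power2_eq_square by (simp only: distrib_left distrib_right ac_simps)
    then show ?thesis by simp
  qed
  have "(x + y) ^ (2 ^ Suc m) = ((x + y) ^ (2 ^ m)) ^ 2"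
    by (simp add: power_mult[symmetric] mult.commute)
  also have "\<dots> = x ^ (2 ^ Suc m) + y ^ (2 ^ Suc m)"
    by (simp add: Suc sq power_mult[symmetric] mult.commute)
  finally show ?case .
qed simp

text \<open>A repeated linear factor would give a common root of \<open>p\<close> and its
  derivative, so the multiset of roots from the splitting over the algebraically closed field has no
  repetitions.\<close>

lemma card_roots_separable:
  fixes p :: "'k::alg_closed_field poly"
  assumes nz: "p \<noteq> 0" and sep: "\<And>x. poly p x = 0 \<Longrightarrow> poly (pderiv p) x \<noteq> 0"
  shows "card {x. poly p x = 0} = degree p"
proof -
  obtain A where A: "size A = degree p" "p = smult (lead_coeff p) (\<Prod>x\<in>#A. [:-x, 1:])"
    using alg_closed_imp_factorization[OF nz] by metis
  have roots: "{x. poly p x = 0} = set_mset A"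
    by (subst A(2)) (use nz in \<open>auto simp: poly_prod_mset prod_mset_zero_iff\<close>)
  have "count A x = 1" if "x \<in># A" for x
  proof (rule ccontr)
    assume "count A x \<noteq> 1"
    moreover have "count A x > 0" using that by simp
    ultimately have "count A x > 1" by linarith
    then have "x \<in># A - {#x#}" by (simp add: in_diff_count)
    then obtain B where "A - {#x#} = add_mset x B" by (metis multi_member_split)
    then have "A = add_mset x (add_mset x B)" using that by (metis insert_DiffM)
    then have "p = [:-x,1:] * ([:-x,1:] * smult (lead_coeff p) (\<Prod>x\<in>#B. [:-x, 1:]))"
      by (subst A(2)) (simp only: image_mset_add_mset prod_mset.add_mset mult_smult_right)
    then obtain r where r: "p = [:-x,1:] * ([:-x,1:] * r)" by blast
    have "poly p x = 0" "poly (pderiv p) x = 0"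
      unfolding r by (simp_all only: pderiv_mult poly_add poly_mult) simp_all
    with sep show False by blast
  qed
  then have "size A = card (set_mset A)"
    by (simp add: size_multiset_overloaded_eq)
  then show ?thesis using A roots by simp
qed

text \<open>\<open>F\<close> is the set of roots of X^q + X for q = 2^m: the derivative is 1, so
  there are q roots, and the Frobenius map makes them closed under addition. All these fields lie in
  one fixed type, so q can grow without a change of type.\<close>

lemma ex_finite_subfield:
  assumes "m \<ge> 1"
  shows "\<exists>F :: 'k::{char2_field,alg_closed_field} set. finite F \<and> card F = 2 ^ m \<and> 0 \<in> F \<and> 1 \<in> F \<and>
           (\<forall>x\<in>F. \<forall>y\<in>F. x + y \<in> F \<and> x * y \<in> F)"
proof -
  define q where "q = (2::nat) ^ m"
  have q: "q \<ge> 2" using assms power_increasing[of 1 m "2::nat"] by (simp add: q_def)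
  define p where "p = (monom 1 q + monom 1 1 :: 'k poly)"
  define F where "F = {x. poly p x = 0}"
  have deg: "degree p = q"
    unfolding p_def using q by (subst degree_add_eq_left) (auto simp: degree_monom_eq)
  have F: "x \<in> F \<longleftrightarrow> x ^ q = x" for x
    by (simp add: F_def p_def poly_monom add_eq_0_iff_eq)
  have "(of_nat q :: 'k) = 0"
  proof -
    have "(2 :: 'k) = 0" by (metis one_add_one one_plus_one)
    then show ?thesis using assms by (simp add: q_def)
  qed
  then have "pderiv p = 1"
    by (simp add: p_def pderiv_add pderiv_monom one_pCons monom_0)
  moreover have "p \<noteq> 0" using deg q by auto
  ultimately have card: "card F = q" using card_roots_separable[of p] deg by (simp add: F_def)
  have "x + y \<in> F \<and> x * y \<in> F" if "x \<in> F" "y \<in> F" for x y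
    using that by (simp add: F power_mult_distrib) (simp add: q_def add_power_2_power)
  moreover have "finite F" using card q by (metis card.infinite not_numeral_le_zero)
  ultimately show ?thesis using card q by (intro exI[of _ F]) (auto simp: F q_def[symmetric])
qed

section \<open>Polynomial relations of bounded degree\<close>

text \<open>\<open>G\<close> consists of field elements in place of formal variables, and the degree
  is bounded in each generator separately; this makes the count \<open>(d + 1) ^ card G\<close>
  immediate.\<close>

definition monomials :: "nat \<Rightarrow> 'k::comm_monoid_mult set \<Rightarrow> 'k set" where
  "monomials d G = (\<lambda>\<mu>. \<Prod>g\<in>G. g ^ \<mu> g) ` (G \<rightarrow>\<^sub>E {..d})"

text \<open>A polynomial over the two-element field is the set of its monomials; coinciding values of distinct
  monomials may be dropped in pairs.\<close>

definition polyvals :: "nat \<Rightarrow> 'k::comm_semiring_1 set \<Rightarrow> 'k set" where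
  "polyvals d G = sum id ` Pow (monomials d G)"

lemma finite_monomials: "finite G \<Longrightarrow> finite (monomials d G)"
  by (simp add: monomials_def finite_PiE)

lemma card_monomials_le:
  assumes "finite G" shows "card (monomials d G) \<le> (d + 1) ^ card G"
proof -
  have "card (monomials d G) \<le> card (G \<rightarrow>\<^sub>E {..d})"
    unfolding monomials_def using assms by (intro card_image_le finite_PiE) auto
  then show ?thesis using assms by (simp add: card_PiE)
qed

lemma finite_polyvals: "finite G \<Longrightarrow> finite (polyvals d G)"
  by (simp add: polyvals_def finite_monomials)

lemma card_polyvals_le:
  assumes "finite G" shows "card (polyvals d G) \<le> 2 ^ ((d + 1) ^ card G)"
proof -
  have "card (polyvals d G) \<le> card (Pow (monomials d G))"
    unfolding polyvals_def using assms by (intro card_image_le) (simp add: finite_monomials)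
  also have "\<dots> = 2 ^ card (monomials d G)" using assms by (simp add: card_Pow finite_monomials)
  also have "\<dots> \<le> 2 ^ ((d + 1) ^ card G)" using card_monomials_le[OF assms, of d]
    by (intro power_increasing) auto
  finally show ?thesis .
qed

lemma monomials_mono: "d \<le> d' \<Longrightarrow> monomials d G \<subseteq> monomials d' G"
  unfolding monomials_def by (intro image_mono PiE_mono) auto

lemma polyvals_mono: "d \<le> d' \<Longrightarrow> polyvals d G \<subseteq> polyvals d' G"
  unfolding polyvals_def using monomials_mono by blast

lemma monomials_subset_polyvals: "monomials d G \<subseteq> polyvals d G"
proof
  fix x assume "x \<in> monomials d G"
  then have "sum id {x} \<in> polyvals d G" unfolding polyvals_def by blast
  then show "x \<in> polyvals d G" by simp
qed

lemma polyvals_0: "0 \<in> polyvals d G"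
proof -
  have "sum id {} \<in> polyvals d G" unfolding polyvals_def by blast
  then show ?thesis by simp
qed

lemma polyvals_1: "1 \<in> polyvals d G"
proof -
  have "1 \<in> monomials d G" unfolding monomials_def
    by (rule image_eqI[of _ _ "\<lambda>x\<in>G. 0"]) auto
  then show ?thesis using monomials_subset_polyvals by blast
qed

lemma polyvals_gen:
  assumes "finite G" "g \<in> G" "d \<ge> 1" shows "g \<in> polyvals d G"
proof -
  have "g = (\<Prod>x\<in>G. x ^ (if x = g then 1 else 0))"
    using assms by (simp add: if_distrib[where f = "\<lambda>k. _ ^ k"] prod.delta cong: if_cong)
  also have "\<dots> = (\<Prod>x\<in>G. x ^ (\<lambda>x\<in>G. if x = g then 1 else 0) x)"
    by (intro prod.cong) auto
  finally have eq: "g = (\<Prod>x\<in>G. x ^ (\<lambda>x\<in>G. if x = g then 1 else 0) x)" .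
  have "g \<in> monomials d G" unfolding monomials_def
    by (intro image_eqI[where f = "\<lambda>\<mu>. \<Prod>g\<in>G. g ^ \<mu> g", OF eq]) (use assms in auto)
  then show ?thesis using monomials_subset_polyvals by blast
qed

lemma sum_symm_diff:
  fixes f :: "'a \<Rightarrow> 'k::char2_field"
  assumes "finite A" "finite B"
  shows "sum f A + sum f B = sum f ((A - B) \<union> (B - A))"
proof -
  have "sum f A = sum f (A - B) + sum f (A \<inter> B)"
    using assms(1) by (subst sum.union_disjoint[symmetric]) (auto intro: sum.cong)
  moreover have "sum f B = sum f (B - A) + sum f (A \<inter> B)"
    using assms(2) by (subst sum.union_disjoint[symmetric]) (auto intro: sum.cong)
  moreover have "sum f ((A - B) \<union> (B - A)) = sum f (A - B) + sum f (B - A)"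
    using assms by (intro sum.union_disjoint) auto
  ultimately have "sum f A + sum f B =
      sum f ((A - B) \<union> (B - A)) + (sum f (A \<inter> B) + sum f (A \<inter> B))"
    by (simp only: ac_simps)
  then show ?thesis by simp
qed

lemma polyvals_add:
  fixes x y :: "'k::char2_field"
  assumes "finite G" "x \<in> polyvals d G" "y \<in> polyvals d G"
  shows "x + y \<in> polyvals d G"
proof -
  from assms obtain A B where AB: "A \<subseteq> monomials d G" "B \<subseteq> monomials d G" "x = sum id A" "y = sum id B"
    unfolding polyvals_def by blast
  then have "finite A" "finite B" using finite_monomials[OF assms(1)] finite_subset by blast+
  then have "x + y = sum id ((A - B) \<union> (B - A))" using AB sum_symm_diff by blast
  then show ?thesis unfolding polyvals_def using AB by blast
qed

lemma polyvals_sum: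
  fixes f :: "'a \<Rightarrow> 'k::char2_field"
  assumes "finite G" "\<And>i. i \<in> I \<Longrightarrow> f i \<in> polyvals d G"
  shows "sum f I \<in> polyvals d G"
  using assms(2)
proof (induction I rule: infinite_finite_induct)
  case (insert i I)
  then show ?case using polyvals_add[OF assms(1)] by simp
qed (simp_all add: polyvals_0)

lemma polyvals_mult:
  fixes x y :: "'k::char2_field"
  assumes "finite G" "x \<in> polyvals d G" "y \<in> polyvals e G"
  shows "x * y \<in> polyvals (d + e) G"
proof -
  from assms obtain A B where AB: "A \<subseteq> monomials d G" "B \<subseteq> monomials e G" "x = sum id A" "y = sum id B"
    unfolding polyvals_def by blast
  have "u * v \<in> monomials (d + e) G" if "u \<in> A" "v \<in> B" for u v
  proof -
    obtain \<mu> where m: "\<mu> \<in> G \<rightarrow>\<^sub>E {..d}" "u = (\<Prod>g\<in>G. g ^ \<mu> g)" using \<open>u \<in> A\<close> AB(1) unfolding monomials_def by auto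
    obtain \<nu> where n: "\<nu> \<in> G \<rightarrow>\<^sub>E {..e}" "v = (\<Prod>g\<in>G. g ^ \<nu> g)" using \<open>v \<in> B\<close> AB(2) unfolding monomials_def by auto
    have "u * v = (\<Prod>g\<in>G. g ^ (\<lambda>g\<in>G. \<mu> g + \<nu> g) g)"
      unfolding m n prod.distrib[symmetric] by (intro prod.cong) (auto simp: power_add)
    then show ?thesis unfolding monomials_def
      by (intro image_eqI[where f = "\<lambda>\<mu>. \<Prod>g\<in>G. g ^ \<mu> g" and x = "\<lambda>g\<in>G. \<mu> g + \<nu> g"]) (use m n in \<open>auto simp: PiE_iff intro!: add_mono\<close>)
  qed
  then have "(\<Sum>u\<in>A. \<Sum>v\<in>B. u * v) \<in> polyvals (d + e) G"
    using monomials_subset_polyvals[of "d + e" G] by (intro polyvals_sum[OF assms(1)]) blast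
  then show ?thesis by (simp add: AB sum_product)
qed

lemma polyvals_power:
  fixes x :: "'k::char2_field"
  assumes "finite G" "x \<in> polyvals d G"
  shows "x ^ k \<in> polyvals (d * k) G"
proof (induction k)
  case (Suc k)
  then show ?case using polyvals_mult[OF assms Suc] by simp
qed (simp add: polyvals_1)

lemma polyvals_prod:
  fixes f :: "'a \<Rightarrow> 'k::char2_field"
  assumes "finite G" "\<And>i. i \<in> I \<Longrightarrow> f i \<in> polyvals d G"
  shows "prod f I \<in> polyvals (d * card I) G"
  using assms(2)
proof (induction I rule: infinite_finite_induct)
  case (insert i I)
  then show ?case using polyvals_mult[OF assms(1), of "f i" d "prod f I" "d * card I"] by simp
qed (auto intro: polyvals_1)

lemma polyvals_prod':
  fixes f :: "'a \<Rightarrow> 'k::char2_field"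
  assumes "finite G" "\<And>i. i \<in> I \<Longrightarrow> f i \<in> polyvals d G" "d * card I \<le> e"
  shows "prod f I \<in> polyvals e G"
proof -
  have "prod f I \<in> polyvals (d * card I) G" using assms(1,2) by (rule polyvals_prod)
  then show ?thesis using polyvals_mono[OF assms(3)] by blast
qed

text \<open>Here \<open>A\<close> is the set of exponent vectors of a nonzero polynomial over the two-element field.\<close>

definition alg_indep :: "nat \<Rightarrow> 'i set \<Rightarrow> ('i \<Rightarrow> 'k::comm_semiring_1) \<Rightarrow> bool" where
  "alg_indep D I \<tau> \<longleftrightarrow>
     (\<forall>A. A \<subseteq> (I \<rightarrow>\<^sub>E {..D}) \<longrightarrow> A \<noteq> {} \<longrightarrow> (\<Sum>\<mu>\<in>A. \<Prod>i\<in>I. \<tau> i ^ \<mu> i) \<noteq> 0)"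

lemma alg_indep_empty: "alg_indep D {} (\<tau> :: 'i \<Rightarrow> 'k::field)"
  unfolding alg_indep_def
proof (intro allI impI)
  fix A :: "('i \<Rightarrow> nat) set"
  assume "A \<subseteq> {} \<rightarrow>\<^sub>E {..D}" "A \<noteq> {}"
  then have "A = {\<lambda>_. undefined}" by auto
  then show "(\<Sum>\<mu>\<in>A. \<Prod>i\<in>{}. \<tau> i ^ \<mu> i) \<noteq> 0" by simp
qed

lemma alg_indep_cong: "(\<And>i. i \<in> I \<Longrightarrow> \<tau> i = \<tau>' i) \<Longrightarrow> alg_indep D I \<tau> = alg_indep D I \<tau>'"
  unfolding alg_indep_def by simp

text \<open>Equal values at i and j would satisfy the nonzero relation X_i + X_j. Later this makes
  the parameters \<open>Lam j\<close> pairwise distinct.\<close>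

lemma alg_indep_inj:
  fixes \<tau> :: "'i \<Rightarrow> 'k::char2_field"
  assumes "alg_indep D I \<tau>" "finite I" "D \<ge> 1"
  shows "inj_on \<tau> I"
proof (rule inj_onI, rule ccontr)
  fix i j assume ij: "i \<in> I" "j \<in> I" "\<tau> i = \<tau> j" "i \<noteq> j"
  define u where "u l = (\<lambda>x\<in>I. if x = l then 1 else 0 :: nat)" for l
  have u: "(\<Prod>x\<in>I. \<tau> x ^ u l x) = \<tau> l" if "l \<in> I" for l
  proof -
    have "(\<Prod>x\<in>I. \<tau> x ^ u l x) = (\<Prod>x\<in>I. if x = l then \<tau> x else 1)"
      by (intro prod.cong) (auto simp: u_def)
    then show ?thesis using that assms(2) by simp
  qed
  have "u i i \<noteq> u j i" using ij by (simp add: u_def)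
  then have ne: "u i \<noteq> u j" by metis
  have "{u i, u j} \<subseteq> I \<rightarrow>\<^sub>E {..D}" using assms(3) by (auto simp: u_def)
  with assms(1) have "(\<Sum>\<mu>\<in>{u i, u j}. \<Prod>i\<in>I. \<tau> i ^ \<mu> i) \<noteq> 0"
    unfolding alg_indep_def by blast
  then show False using ne ij by (simp add: u)
qed

section \<open>Adjoining generic elements one at a time\<close>

definition extension_bound :: "nat \<Rightarrow> nat \<Rightarrow> nat" where
  "extension_bound D k = D * 2 ^ ((D + 1) ^ k)"

lemma extension_bound_mono: "k \<le> k' \<Longrightarrow> extension_bound D k \<le> extension_bound D k'"
  unfolding extension_bound_def by (intro mult_left_mono power_increasing) auto

text \<open>A relation involving the new index is a polynomial \<open>p A\<close> of degree at most
  \<open>D\<close> in the new value. One of its coefficients is a relation among the old values,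
  hence nonzero, so \<open>p A\<close> has at most \<open>D\<close> roots. \<open>B\<close> collects
  the roots of all these polynomials, and \<open>extension_bound D k\<close> is \<open>D\<close>
  times the number of sets of exponent vectors in k variables.\<close>

lemma alg_indep_extend:
  fixes \<tau> :: "'i \<Rightarrow> 'k::field"
  assumes fin: "finite I" and j: "j \<notin> I" and indep: "alg_indep D I \<tau>"
  shows "\<exists>B. finite B \<and> card B \<le> extension_bound D (Suc (card I)) \<and>
           (\<forall>y. y \<notin> B \<longrightarrow> alg_indep D (insert j I) (\<tau>(j := y)))"
proof -
  let ?E = "insert j I \<rightarrow>\<^sub>E {..D}"
  have finE: "finite ?E" using fin by (intro finite_PiE) auto
  define p where "p A = (\<Sum>\<mu>\<in>A. monom (\<Prod>i\<in>I. \<tau> i ^ \<mu> i) (\<mu> j))" for A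
  have p: "p A \<noteq> 0" "degree (p A) \<le> D" if A: "A \<subseteq> ?E" "A \<noteq> {}" for A
  proof -
    have finA: "finite A" using A finE finite_subset by blast
    have "degree (monom (\<Prod>i\<in>I. \<tau> i ^ \<mu> i) (\<mu> j)) \<le> D" if "\<mu> \<in> A" for \<mu>
    proof -
      have "\<mu> j \<le> D" using that A by blast
      then show ?thesis using degree_monom_le order.trans by blast
    qed
    then show "degree (p A) \<le> D" unfolding p_def using finA by (intro degree_sum_le) auto
    obtain \<mu>0 where m0: "\<mu>0 \<in> A" using A by blast
    define A' where "A' = {\<mu>\<in>A. \<mu> j = \<mu>0 j}"
    \<comment> \<open>Exponent vectors that agree at j are told apart by their restrictions to
      \<open>I\<close>, so distinct monomials of the relation do not merge in this
      coefficient.\<close>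
    have inj: "inj_on (\<lambda>\<mu>. restrict \<mu> I) A'"
    proof (rule inj_onI)
      fix \<mu> \<nu> assume h: "\<mu> \<in> A'" "\<nu> \<in> A'" "restrict \<mu> I = restrict \<nu> I"
      show "\<mu> = \<nu>"
      proof (rule PiE_ext)
        show "\<mu> \<in> ?E" "\<nu> \<in> ?E" using h A by (auto simp: A'_def)
        fix x assume "x \<in> insert j I"
        then show "\<mu> x = \<nu> x" using h by (auto simp: A'_def dest: fun_cong[of _ _ x])
      qed
    qed
    have "coeff (p A) (\<mu>0 j) = (\<Sum>\<mu>\<in>A. if \<mu> j = \<mu>0 j then \<Prod>i\<in>I. \<tau> i ^ \<mu> i else 0)"
      by (simp add: p_def coeff_sum)
    also have "\<dots> = (\<Sum>\<mu>\<in>A'. \<Prod>i\<in>I. \<tau> i ^ \<mu> i)"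
      unfolding A'_def using finA by (simp add: sum.inter_filter)
    also have "\<dots> = (\<Sum>\<mu>\<in>(\<lambda>\<mu>. restrict \<mu> I) ` A'. \<Prod>i\<in>I. \<tau> i ^ \<mu> i)"
      by (subst sum.reindex[OF inj]) simp
    also have "\<dots> \<noteq> 0"
    proof -
      have "(\<lambda>\<mu>. restrict \<mu> I) ` A' \<subseteq> I \<rightarrow>\<^sub>E {..D}" using A by (auto simp: A'_def PiE_iff)
      moreover have "(\<lambda>\<mu>. restrict \<mu> I) ` A' \<noteq> {}" using m0 by (auto simp: A'_def)
      ultimately show ?thesis using indep unfolding alg_indep_def by blast
    qed
    finally show "p A \<noteq> 0" by (metis coeff_0)
  qed
  define B where "B = (\<Union>A \<in> Pow ?E - {{}}. {y. poly (p A) y = 0})"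
  have "finite B" unfolding B_def using finE p by (auto intro!: poly_roots_finite)
  moreover have "card B \<le> extension_bound D (Suc (card I))"
  proof -
    have "card B \<le> (\<Sum>A \<in> Pow ?E - {{}}. card {y. poly (p A) y = 0})"
      unfolding B_def using finE by (intro card_UN_le) auto
    also have "\<dots> \<le> (\<Sum>A \<in> Pow ?E - {{}}. D)"
    proof (rule sum_mono)
      fix A assume "A \<in> Pow ?E - {{}}"
      then have "p A \<noteq> 0" "degree (p A) \<le> D" using p by auto
      then show "card {y. poly (p A) y = 0} \<le> D" using card_poly_roots_bound order.trans by blast
    qed
    also have "\<dots> = card (Pow ?E - {{}}) * D" by simp
    also have "\<dots> \<le> card (Pow ?E) * D" using finE by (intro mult_right_mono card_mono) auto
    also have "card (Pow ?E) = 2 ^ ((D + 1) ^ Suc (card I))"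
      using fin j finE by (simp add: card_Pow card_PiE)
    finally show ?thesis by (simp add: extension_bound_def mult.commute)
  qed
  moreover have "alg_indep D (insert j I) (\<tau>(j := y))" if y: "y \<notin> B" for y
    unfolding alg_indep_def
  proof (intro allI impI)
    fix A assume A: "A \<subseteq> ?E" "A \<noteq> {}"
    have "(\<Sum>\<mu>\<in>A. \<Prod>i\<in>insert j I. (\<tau>(j := y)) i ^ \<mu> i) = poly (p A) y"
      unfolding p_def poly_sum
    proof (intro sum.cong refl)
      fix \<mu>
      have "(\<Prod>i\<in>I. (\<tau>(j := y)) i ^ \<mu> i) = (\<Prod>i\<in>I. \<tau> i ^ \<mu> i)"
        using j by (intro prod.cong) auto
      then show "(\<Prod>i\<in>insert j I. (\<tau>(j := y)) i ^ \<mu> i) = poly (monom (\<Prod>i\<in>I. \<tau> i ^ \<mu> i) (\<mu> j)) y"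
        using fin j by (simp add: poly_monom mult.commute)
    qed
    then show "(\<Sum>\<mu>\<in>A. \<Prod>i\<in>insert j I. (\<tau>(j := y)) i ^ \<mu> i) \<noteq> 0"
      using y A by (auto simp: B_def)
  qed
  ultimately show ?thesis by blast
qed

lemma alg_indep_exists:
  fixes F :: "'k::field set"
  assumes "finite I" "finite F" "card F > extension_bound D (card I)"
  shows "\<exists>\<tau>. (\<forall>i. \<tau> i \<in> F) \<and> alg_indep D I \<tau>"
  using assms(1,3)
proof (induction I rule: finite_induct)
  case empty
  then obtain x where "x \<in> F" by (metis card.empty ex_in_conv not_less_zero)
  then show ?case using alg_indep_empty by (intro exI[of _ "\<lambda>_. x"]) auto
next
  case (insert j I)
  have "extension_bound D (card I) \<le> extension_bound D (card (insert j I))"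
    using insert by (intro extension_bound_mono) simp
  with insert obtain \<tau> where \<tau>: "\<forall>i. \<tau> i \<in> F" "alg_indep D I \<tau>" by fastforce
  obtain B where B: "finite B" "card B \<le> extension_bound D (Suc (card I))"
    "\<And>y. y \<notin> B \<Longrightarrow> alg_indep D (insert j I) (\<tau>(j := y))"
    using alg_indep_extend[OF insert(1,2) \<tau>(2)] by blast
  have "\<not> F \<subseteq> B" using B insert card_mono[of B F] by auto
  then obtain y where "y \<in> F" "y \<notin> B" by blast
  then have "\<forall>i. (\<tau>(j := y)) i \<in> F" "alg_indep D (insert j I) (\<tau>(j := y))" using B \<tau> by auto
  then show ?case by blast
qed

text \<open>Both sides of the pigeonhole count \<open>0\<close>-\<open>1\<close> coefficient vectors: there are \<open>2 ^ (D + 1) ^ N\<close> of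
  them on the left, but the values, cleared of the common denominator \<open>v\<close>, lie in a set of size
  at most \<open>2 ^ (N * D * d + 1) ^ card G\<close>.\<close>

lemma alg_dependent:
  fixes \<tau> :: "'i \<Rightarrow> 'k::char2_field"
  assumes finI: "finite I" and finG: "finite G" and less: "card G < card I"
    and v: "v \<noteq> 0" "v \<in> polyvals d G" and \<tau>: "\<And>i. i \<in> I \<Longrightarrow> v * \<tau> i \<in> polyvals d G"
    and N: "N = card I" and D: "D = (N * d + 1) ^ N"
  shows "\<not> alg_indep D I \<tau>"
proof
  assume indep: "alg_indep D I \<tau>"
  let ?E = "I \<rightarrow>\<^sub>E {..D}"
  define S where "S A = (\<Sum>\<mu>\<in>A. \<Prod>i\<in>I. \<tau> i ^ \<mu> i)" for A
  define e where "e = N * (D * d)"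
  have finE: "finite ?E" using finI by (intro finite_PiE) auto
  \<comment> \<open>Each of the \<open>N\<close> indices receives its own factor v^D, enough to
    clear the denominators of all powers of \<tau> i up to \<open>D\<close>.\<close>
  have mono: "v ^ (N * D) * (\<Prod>i\<in>I. \<tau> i ^ \<mu> i) \<in> polyvals e G" if "\<mu> \<in> ?E" for \<mu>
  proof -
    have "v ^ D * \<tau> i ^ \<mu> i \<in> polyvals (D * d) G" if i: "i \<in> I" for i
    proof -
      have le: "\<mu> i \<le> D" using i \<open>\<mu> \<in> ?E\<close> by auto
      have "v ^ D = v ^ \<mu> i * v ^ (D - \<mu> i)" using le by (simp flip: power_add)
      then have "v ^ D * \<tau> i ^ \<mu> i = (v * \<tau> i) ^ \<mu> i * v ^ (D - \<mu> i)"
        by (simp add: power_mult_distrib mult_ac)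
      also have "\<dots> \<in> polyvals (d * \<mu> i + d * (D - \<mu> i)) G"
        using \<tau>[OF i] v finG by (intro polyvals_mult polyvals_power)
      also have "d * \<mu> i + d * (D - \<mu> i) = D * d"
        using le by (simp add: mult.commute flip: distrib_left)
      finally show ?thesis .
    qed
    then have "(\<Prod>i\<in>I. v ^ D * \<tau> i ^ \<mu> i) \<in> polyvals e G"
      using finG by (intro polyvals_prod') (auto simp: e_def N mult_ac)
    then show ?thesis
      by (simp add: prod.distrib N power_mult[symmetric] mult.commute)
  qed
  have "(\<lambda>A. v ^ (N * D) * S A) ` Pow ?E \<subseteq> polyvals e G"
    unfolding S_def sum_distrib_left using mono finG by (intro image_subsetI polyvals_sum) auto
  moreover have "card (polyvals e G) < card (Pow ?E)"
  proof -
    have "(e + 1) ^ card G \<le> ((N * d + 1) * (D + 1)) ^ card G"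
      by (intro power_mono) (auto simp: e_def algebra_simps)
    also have "\<dots> \<le> ((N * d + 1) * (D + 1)) ^ (N - 1)"
      using less N by (intro power_increasing) auto
    also have "\<dots> = (N * d + 1) ^ (N - 1) * (D + 1) ^ (N - 1)" by (rule power_mult_distrib)
    \<comment> \<open>This is the origin of the value of \<open>D\<close>: \<open>card G\<close> is
      at most N - 1, so one factor D + 1 is left over, and it has to exceed (N d + 1)^(N -
      1).\<close>
    also have "\<dots> < (D + 1) * (D + 1) ^ (N - 1)"
    proof -
      have "(N * d + 1) ^ (N - 1) \<le> D" unfolding D by (intro power_increasing) auto
      then show ?thesis by (intro mult_strict_right_mono) auto
    qed
    also have "\<dots> = (D + 1) ^ N" using less N by (subst power_Suc[symmetric]) simp
    finally have "(2::nat) ^ ((e + 1) ^ card G) < 2 ^ ((D + 1) ^ N)" by (intro power_strict_increasing) auto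
    moreover have "card (Pow ?E) = 2 ^ ((D + 1) ^ N)"
      using finI finE by (simp add: card_Pow card_PiE N)
    ultimately show ?thesis using card_polyvals_le[OF finG, of e] by linarith
  qed
  ultimately have "\<not> inj_on (\<lambda>A. v ^ (N * D) * S A) (Pow ?E)"
    using card_inj_on_le[OF _ _ finite_polyvals[OF finG, of e], of _ "Pow ?E"] by (meson leD)
  \<comment> \<open>Two distinct polynomials share a value; in characteristic two their difference
    is the polynomial supported on the symmetric difference, a nonzero relation.\<close>
  then obtain A B where AB: "A \<subseteq> ?E" "B \<subseteq> ?E" "A \<noteq> B" "S A = S B"
    unfolding inj_on_def using v by auto
  have "finite A" "finite B" using AB finE finite_subset by blast+
  then have "S ((A - B) \<union> (B - A)) = S A + S B" unfolding S_def by (simp add: sum_symm_diff)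
  also have "\<dots> = 0" using AB by simp
  finally have "S ((A - B) \<union> (B - A)) = 0" .
  moreover have "(A - B) \<union> (B - A) \<subseteq> ?E" "(A - B) \<union> (B - A) \<noteq> {}" using AB by auto
  ultimately show False using indep unfolding alg_indep_def S_def by blast
qed

section \<open>Lagrange interpolation with cleared denominators\<close>

lemma polyvals_coeff_mult:
  fixes p q :: "'k::char2_field poly"
  assumes "finite G" "\<And>k. coeff p k \<in> polyvals d G" "\<And>k. coeff q k \<in> polyvals e G"
  shows "coeff (p * q) k \<in> polyvals (d + e) G"
proof -
  have "coeff p i * coeff q (k - i) \<in> polyvals (d + e) G" for i
    by (intro polyvals_mult assms)
  then show ?thesis unfolding coeff_mult by (intro polyvals_sum[OF assms(1)])
qed

lemma polyvals_coeff_linear_prod: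
  fixes w :: "'z \<Rightarrow> 'k::char2_field"
  assumes "finite G" "d \<ge> 1" "\<And>z. z \<in> Z \<Longrightarrow> w z \<in> polyvals d G"
  shows "coeff (\<Prod>z\<in>Z. [:- w z, 1:]) k \<in> polyvals (d * card Z) G"
  using assms(3)
proof (induction Z arbitrary: k rule: infinite_finite_induct)
  case (infinite Z)
  then show ?case by (auto simp: coeff_1 intro: polyvals_0 polyvals_1)
next
  case empty
  then show ?case by (auto simp: coeff_1 intro: polyvals_0 polyvals_1)
next
  case (insert z Z)
  have "coeff [:- w z, 1:] k \<in> polyvals d G" for k
    using insert.prems[of z] by (auto simp: coeff_pCons uminus_eq_self split: nat.split intro: polyvals_0 polyvals_1)
  then have "coeff ([:- w z, 1:] * (\<Prod>z\<in>Z. [:- w z, 1:])) k \<in> polyvals (d + d * card Z) G"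
    using insert by (intro polyvals_coeff_mult[OF assms(1)]) auto
  then show ?case using insert by simp
qed

text \<open>\<open>v\<close> is the product of the differences of nodes over all ordered pairs, a
  common multiple of the Lagrange denominators; \<open>V z\<close> is the cofactor of the
  denominator at z. So \<open>v\<close> times an interpolating polynomial has coefficients that are
  polynomials in the nodes and the values, and the degree bound just counts factors.\<close>

lemma interpolation_polyvals:
  fixes w :: "'z \<Rightarrow> 'k::char2_field"
  assumes G: "finite G" and Z: "finite Z" "inj_on w Z"
    and w: "\<And>z. z \<in> Z \<Longrightarrow> w z \<in> polyvals d G" "d \<ge> 1"
  defines "v \<equiv> \<Prod>z\<in>Z. \<Prod>u\<in>Z - {z}. w z - w u"
  shows "v \<noteq> 0" and "v \<in> polyvals (d * card Z * card Z) G"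
    and "\<And>p k. degree p < card Z \<Longrightarrow> (\<And>z. z \<in> Z \<Longrightarrow> poly p (w z) \<in> polyvals e G) \<Longrightarrow>
           v * coeff p k \<in> polyvals (e + d * card Z * card Z + d * card Z) G"
proof -
  have diff: "w z - w u \<in> polyvals d G" if "z \<in> Z" "u \<in> Z" for z u
    using w that G by (auto simp: diff_eq_add intro: polyvals_add)
  show v0: "v \<noteq> 0" using Z by (auto simp: v_def inj_on_def)
  have fac: "(\<Prod>u\<in>Z - {z}. w z - w u) \<in> polyvals (d * card Z) G" if "z \<in> Z" for z
    using diff that Z G by (intro polyvals_prod') (auto intro!: mult_left_mono card_mono)
  then show "v \<in> polyvals (d * card Z * card Z) G"
    unfolding v_def using G by (intro polyvals_prod) auto
  fix p k assume deg: "degree p < card Z" and val: "\<And>z. z \<in> Z \<Longrightarrow> poly p (w z) \<in> polyvals e G"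
  define V where "V z = (\<Prod>y\<in>Z - {z}. \<Prod>u\<in>Z - {y}. w y - w u)" for z
  have vV: "v = (\<Prod>u\<in>Z - {z}. w z - w u) * V z" if "z \<in> Z" for z
    unfolding v_def V_def using that Z by (simp add: prod.remove)
  have V: "V z \<in> polyvals (d * card Z * card Z) G" for z
    unfolding V_def
  proof (rule polyvals_prod'[OF G])
    show "d * card Z * card (Z - {z}) \<le> d * card Z * card Z"
      using Z by (intro mult_left_mono card_mono) auto
  qed (use fac in auto)
  define L where "L z = (\<Prod>u\<in>Z - {z}. [:- w u, 1:])" for z
  define r where "r = (\<Sum>z\<in>Z. smult (poly p (w z) * V z) (L z))"
  have "r = smult v p"
  proof (rule poly_eqI_degree[of "w ` Z"])
    fix x assume "x \<in> w ` Z"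
    then obtain y where y: "y \<in> Z" "x = w y" by blast
    have "poly (L z) (w y) = 0" if "z \<in> Z - {y}" for z
      unfolding L_def poly_prod using y Z that by (intro prod_zero) (auto intro!: bexI[of _ y])
    then have "poly r x = poly p (w y) * V y * poly (L y) (w y)"
      unfolding r_def poly_sum using y Z by (simp add: sum.remove[of Z y])
    also have "poly (L y) (w y) = (\<Prod>u\<in>Z - {y}. w y - w u)"
      by (simp add: L_def poly_prod)
    finally show "poly r x = poly (smult v p) x" using y vV[OF y(1)] by simp
  next
    have c: "card (w ` Z) = card Z" using Z by (simp add: card_image)
    then show "degree (smult v p) < card (w ` Z)" using deg v0 by simp
    have "degree (L z) \<le> card Z - 1" if "z \<in> Z" for z
    proof -
      have "degree (L z) \<le> (\<Sum>u\<in>Z - {z}. degree [:- w u, 1:])"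
        unfolding L_def using degree_prod_sum_le[of "Z - {z}" "\<lambda>u. [:- w u, 1:]"] Z by (simp add: o_def)
      then show ?thesis using that Z by simp
    qed
    then have "degree r \<le> card Z - 1"
      unfolding r_def using Z by (intro degree_sum_le) (auto intro: order.trans[OF degree_smult_le])
    then show "degree r < card (w ` Z)" using c deg by simp
  qed
  then have "v * coeff p k = coeff r k" by simp
  also have "\<dots> = (\<Sum>z\<in>Z. poly p (w z) * V z * coeff (L z) k)" by (simp add: r_def coeff_sum)
  also have "\<dots> \<in> polyvals (e + d * card Z * card Z + d * card Z) G"
  proof (intro polyvals_sum polyvals_mult G V val)
    fix z assume "z \<in> Z"
    have "coeff (L z) k \<in> polyvals (d * card (Z - {z})) G"
      unfolding L_def using w G by (intro polyvals_coeff_linear_prod) auto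
    moreover have "d * card (Z - {z}) \<le> d * card Z" using Z by (intro mult_left_mono card_mono) auto
    ultimately show "coeff (L z) k \<in> polyvals (d * card Z) G" using polyvals_mono by blast
  qed auto
  finally show "v * coeff p k \<in> polyvals (e + d * card Z * card Z + d * card Z) G" .
qed

section \<open>Balanced rooted trees\<close>

text \<open>Every edge joins i to the smaller label \<open>par i\<close>, so the labelling itself
  rules out cycles and later serves as the order of greedy embedding. \<open>balanced\<close> is the
  condition of Bukh and Conlon: no set of non-roots touches fewer edges per vertex than the set of
  all non-roots, whose ratio is b / a.\<close>

locale rooted_tree =
  fixes a b :: nat and par :: "nat \<Rightarrow> nat" and R :: "nat set"
  assumes par_less: "1 \<le> i \<Longrightarrow> i \<le> b \<Longrightarrow> par i < i"
    and R_subset: "R \<subseteq> {..b}"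
    and card_R: "card R + a = b + 1"
    and a_pos: "1 \<le> a"
    and a_le_b: "a \<le> b"
    and balanced: "S \<subseteq> {..b} - R \<Longrightarrow> b * card S \<le> a * card {i \<in> {1..b}. i \<in> S \<or> par i \<in> S}"
begin

lemma finite_R: "finite R"
  using R_subset finite_subset by blast

lemma card_nonroots: "card ({..b} - R) = a"
  using card_R R_subset by (simp add: card_Diff_subset finite_R)

lemma par_le: "1 \<le> i \<Longrightarrow> i \<le> b \<Longrightarrow> par i \<le> b"
  using par_less[of i] by simp

definition edge_image :: "(nat \<Rightarrow> 'v) \<Rightarrow> 'v set set" where
  "edge_image \<phi> = (\<lambda>i. {\<phi> i, \<phi> (par i)}) ` {1..b}"

definition tree_embeddings :: "'v graph \<Rightarrow> (nat \<Rightarrow> 'v) set" where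
  "tree_embeddings G = {\<phi> \<in> {..b} \<rightarrow>\<^sub>E verts G. inj_on \<phi> {..b} \<and> edge_image \<phi> \<subseteq> edges G}"

text \<open>The embeddings are labelled maps and may overlap outside the roots in any way. The
  unions of such families form what is called the p-th power of the rooted tree.\<close>

definition rich :: "nat \<Rightarrow> 'v graph \<Rightarrow> bool" where
  "rich p G \<longleftrightarrow> (\<exists>g \<Phi>. \<Phi> \<subseteq> tree_embeddings G \<and> finite \<Phi> \<and> card \<Phi> = p \<and> (\<forall>\<phi>\<in>\<Phi>. \<forall>v\<in>R. \<phi> v = g v))"

text \<open>The two ends cannot be swapped, since that would give i = \<open>par j\<close> < j =
  \<open>par i\<close> < i.\<close>

lemma edge_pair_inj:
  assumes "inj_on \<phi> {..b}" "i \<in> {1..b}" "j \<in> {1..b}" "{\<phi> i, \<phi> (par i)} = {\<phi> j, \<phi> (par j)}"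
  shows "i = j"
proof -
  have le: "par i \<le> b" "par j \<le> b" using assms par_le by auto
  from assms(4) consider "\<phi> i = \<phi> j" | "\<phi> i = \<phi> (par j)" "\<phi> (par i) = \<phi> j"
    by (auto simp: doubleton_eq_iff)
  then show ?thesis
  proof cases
    case 1 then show ?thesis using assms by (auto dest: inj_onD)
  next
    case 2
    then have "i = par j" "par i = j" using assms le by (auto dest: inj_onD)
    then show ?thesis using par_less[of i] par_less[of j] assms by auto
  qed
qed

text \<open>Adding one embedding to a union creates at least the edges touching its new vertices, so
  balancedness of the tree passes to every union of embeddings that agree on the roots.\<close>

lemma balanced_union:
  fixes \<Phi> :: "(nat \<Rightarrow> 'v) set"
  assumes "finite \<Phi>" and "\<And>\<phi>. \<phi> \<in> \<Phi> \<Longrightarrow> inj_on \<phi> {..b}"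
    and "\<And>\<phi> v. \<phi> \<in> \<Phi> \<Longrightarrow> v \<in> R \<Longrightarrow> \<phi> v = g v"
  shows "b * card (\<Union>\<phi>\<in>\<Phi>. \<phi> ` ({..b} - R)) \<le> a * card (\<Union>\<phi>\<in>\<Phi>. edge_image \<phi>)"
  using assms
proof (induction \<Phi> rule: finite_induct)
  case (insert \<phi> \<Phi>)
  define V where "V = (\<Union>\<phi>\<in>\<Phi>. \<phi> ` ({..b} - R))"
  define E where "E = (\<Union>\<phi>\<in>\<Phi>. edge_image \<phi>)"
  \<comment> \<open>\<open>S\<close> holds the tree vertices whose image is new, \<open>T\<close>
    the tree edges that meet them. Injectivity and agreement on the roots keep the images of
    \<open>S\<close> away from the roots as well, so the edges in \<open>T\<close> have new
    images.\<close>
  define S where "S = {v \<in> {..b} - R. \<phi> v \<notin> V}"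
  define T where "T = {i \<in> {1..b}. i \<in> S \<or> par i \<in> S}"
  have inj: "inj_on \<phi> {..b}" using insert by simp
  have fin: "finite V" "finite E" "finite S" "finite T"
    using insert by (auto simp: V_def E_def S_def T_def edge_image_def)
  have vV: "v \<in> V \<union> g ` R" if "e \<in> E" "v \<in> e" for e v
  proof -
    from that obtain \<psi> i where \<psi>: "\<psi> \<in> \<Phi>" "i \<in> {1..b}" "v = \<psi> i \<or> v = \<psi> (par i)"
      by (auto simp: E_def edge_image_def)
    then obtain j where j: "j \<le> b" "v = \<psi> j" using par_le[of i] by auto
    show ?thesis using j \<psi> insert.prems(2)[of \<psi> j] by (cases "j \<in> R") (auto simp: V_def)
  qed
  have new: "\<phi> v \<notin> V \<union> g ` R" if vS: "v \<in> S" for v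
  proof
    assume "\<phi> v \<in> V \<union> g ` R"
    then obtain u where u: "u \<in> R" "\<phi> v = g u" using vS by (auto simp: S_def)
    then have "\<phi> v = \<phi> u" using insert.prems(2)[of \<phi> u] by simp
    then have "v = u" using inj vS u R_subset by (auto simp: S_def dest: inj_onD)
    then show False using u vS by (simp add: S_def)
  qed
  have injT: "inj_on (\<lambda>i. {\<phi> i, \<phi> (par i)}) T"
    using edge_pair_inj[OF inj] by (auto simp: inj_on_def T_def)
  have disj: "E \<inter> (\<lambda>i. {\<phi> i, \<phi> (par i)}) ` T = {}"
    using vV new by (fastforce simp: T_def)
  have "card E + card T = card (E \<union> (\<lambda>i. {\<phi> i, \<phi> (par i)}) ` T)"
    using fin disj injT by (simp add: card_Un_disjoint card_image)
  also have "\<dots> \<le> card (\<Union>\<phi>\<in>insert \<phi> \<Phi>. edge_image \<phi>)"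
    using insert.hyps by (intro card_mono) (auto simp: E_def T_def edge_image_def)
  finally have E': "card E + card T \<le> card (\<Union>\<phi>\<in>insert \<phi> \<Phi>. edge_image \<phi>)" .
  have "(\<Union>\<phi>\<in>insert \<phi> \<Phi>. \<phi> ` ({..b} - R)) \<subseteq> V \<union> \<phi> ` S" by (auto simp: V_def S_def)
  then have "card (\<Union>\<phi>\<in>insert \<phi> \<Phi>. \<phi> ` ({..b} - R)) \<le> card (V \<union> \<phi> ` S)"
    using fin by (intro card_mono) auto
  also have "\<dots> \<le> card V + card S"
    using card_Un_le[of V "\<phi> ` S"] card_image_le[OF fin(3), of \<phi>] by linarith
  finally have "b * card (\<Union>\<phi>\<in>insert \<phi> \<Phi>. \<phi> ` ({..b} - R)) \<le> b * card V + b * card S"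
    by (metis distrib_left mult_le_mono2)
  also have "\<dots> \<le> a * card E + a * card T"
    using insert.IH insert.prems balanced[of S] unfolding V_def E_def T_def
    by (intro add_mono) (auto simp: S_def)
  also have "\<dots> \<le> a * card (\<Union>\<phi>\<in>insert \<phi> \<Phi>. edge_image \<phi>)"
    using E' by (metis distrib_left mult_le_mono2)
  finally show ?case .
qed simp

end


text \<open>The tree is a path \<open>0, \<dots>, a - 1\<close> of non-roots with \<open>b - a + 1\<close> pendant roots, spread so that the
  vertices before \<open>i\<close> own \<open>\<lfloor>i * b / a\<rfloor>\<close> edges, each path edge being owned by its later end.\<close>

lemma rooted_tree_exists:
  assumes a: "1 \<le> a" and ab: "a \<le> b"
  shows "\<exists>par. rooted_tree a b par {a..b}"
proof -
  define h where "h j = card {i \<in> {1..<a}. i * (b - a) < a * (j - a)}" for j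
  define par where "par i = (if i < a then i - 1 else h i)" for i
  define m where "m i = (i * b) mod a" for i
  define f where "f i = (i * b) div a" for i
  have h_less: "h j < a" for j
  proof -
    have "h j \<le> card {1..<a}" unfolding h_def by (intro card_mono) auto
    then show ?thesis using a by simp
  qed
  have f_mono: "f i \<le> f (Suc i)" for i unfolding f_def by (intro div_le_mono) auto
  have f_step: "f i + 1 \<le> f (Suc i)" for i
  proof -
    have "(i * b + a) div a \<le> (Suc i * b) div a" using ab by (intro div_le_mono) auto
    then show ?thesis using a by (simp add: f_def)
  qed
  have f_bound: "i \<le> f i" for i by (induction i) (use f_step in \<open>auto intro: order.trans\<close>)
  have fa: "f a = b" "f 0 = 0" "m a = 0" "m 0 = 0" using a by (auto simp: f_def m_def)
  have fm: "a * f i + m i = i * b" for i by (simp add: f_def m_def)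
  text \<open>\<open>h j\<close> is the path vertex to which the root \<open>j\<close> is attached.\<close>
  have h_ge: "i \<le> h j \<longleftrightarrow> a + f i < j + i" if i: "1 \<le> i" "i < a" and j: "a \<le> j" for i j
  proof -
    have dc: "k * (b - a) < a * (j - a)" if "k \<le> l" "l * (b - a) < a * (j - a)" for k l
      using that by (meson le_less_trans mult_le_mono1)
    have "i \<le> h j \<longleftrightarrow> i * (b - a) < a * (j - a)"
    proof
      assume "i * (b - a) < a * (j - a)"
      then have "{1..i} \<subseteq> {i \<in> {1..<a}. i * (b - a) < a * (j - a)}" using i dc[of _ i] by auto
      then have "card {1..i} \<le> h j" unfolding h_def by (intro card_mono) auto
      then show "i \<le> h j" by simp
    next
      assume ih: "i \<le> h j"
      show "i * (b - a) < a * (j - a)"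
      proof (rule ccontr)
        assume "\<not> i * (b - a) < a * (j - a)"
        then have "{i \<in> {1..<a}. i * (b - a) < a * (j - a)} \<subseteq> {1..<i}"
          using dc[of i] by (auto simp: not_le[symmetric])
        then have "h j \<le> card {1..<i}" unfolding h_def by (intro card_mono) auto
        then show False using ih i by simp
      qed
    qed
    also have "\<dots> \<longleftrightarrow> i * b + a * a < a * j + i * a"
    proof -
      have "i * (b - a) + i * a = i * b" using ab by (simp flip: distrib_left)
      moreover have "a * (j - a) + a * a = a * j" using j by (simp flip: distrib_left)
      ultimately show ?thesis by linarith
    qed
    also have "\<dots> \<longleftrightarrow> a + f i < j + i"
    proof -
      have "m i < a" using a by (simp add: m_def)
      have e: "i * b + a * a = a * (f i + a) + m i" using fm[of i] by (simp add: algebra_simps)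
      have e2: "a * j + i * a = a * (j + i)" by (simp add: algebra_simps)
      show ?thesis
      proof
        assume "i * b + a * a < a * j + i * a"
        then have "a * (f i + a) < a * (j + i)" using e e2 by linarith
        then show "a + f i < j + i" by simp
      next
        assume "a + f i < j + i"
        then have "a * (f i + a + 1) \<le> a * (j + i)" by (intro mult_le_mono2) simp
        then show "i * b + a * a < a * j + i * a" using e e2 \<open>m i < a\<close> by simp
      qed
    qed
    finally show ?thesis .
  qed
  define L where "L i = {j \<in> {a..b}. h j = i}" for i
  text \<open>The lower end of the interval of roots attached to \<open>i\<close>.\<close>
  define l where "l i = (if i = 0 then a else a + f i + 1 - i)" for i
  have l_eq: "l i + i = a + f i + (if i = 0 then 0 else 1)" for i
    using f_bound[of i] by (simp add: l_def fa)
  have L_eq: "L i = {l i..<l (Suc i)}" if i: "i < a" for i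
  proof -
    have ge: "i \<le> h j \<longleftrightarrow> l i \<le> j" if "a \<le> j" "i < a" for i j
      using h_ge[of i j] that l_eq[of i] by (cases "i = 0") (auto simp: l_def)
    have la: "a \<le> l i" using l_eq[of i] f_bound[of i] by (auto simp: l_def)
    have lb: "l a = b + 1" using a by (simp add: l_def fa)
    have "j \<in> L i \<longleftrightarrow> l i \<le> j \<and> j < l (Suc i)" for j
    proof (cases "a \<le> j \<and> j \<le> b")
      case True
      show ?thesis
      proof (cases "Suc i = a")
        case True': True
        have "h j = i \<longleftrightarrow> i \<le> h j" using h_less[of j] True' by auto
        then show ?thesis using True True' ge[of j i] i lb by (simp add: L_def)
      next
        case False
        then have "h j = i \<longleftrightarrow> i \<le> h j \<and> \<not> Suc i \<le> h j" by auto
        then show ?thesis using True False ge[of j i] ge[of j "Suc i"] i by (auto simp: L_def)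
      qed
    next
      case False
      have "l (Suc i) \<le> b + 1"
      proof -
        have "l i \<le> l (Suc i)" for i using l_eq[of i] l_eq[of "Suc i"] f_step[of i] by (auto split: if_splits)
        then have "mono l" by (simp add: mono_iff_le_Suc)
        then show ?thesis using i lb by (metis Suc_leI monoD)
      qed
      then show ?thesis using False la by (auto simp: L_def)
    qed
    then show ?thesis by (intro Set.set_eqI) (simp only: atLeastLessThan_iff)
  qed
  \<comment> \<open>Vertex 0 has no earlier neighbour on the path and so owns no path edge, hence
    the exceptional case here and in \<open>l\<close>.\<close>
  have card_L: "card (L i) + (if i = 0 then 0 else 1) = f (Suc i) - f i" if "i < a" for i
  proof -
    have "card (L i) = l (Suc i) - l i" using L_eq[OF that] by simp
    moreover have "l (Suc i) + Suc i = a + f (Suc i) + 1" using l_eq[of "Suc i"] by simp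
    ultimately show ?thesis using l_eq[of i] f_step[of i] by (cases "i = 0") simp_all
  qed
  have "rooted_tree a b par {a..b}"
  proof
    fix i assume "1 \<le> i" "i \<le> b"
    then show "par i < i" using h_less[of i] by (auto simp: par_def)
  next
    fix S assume "S \<subseteq> {..b} - {a..b}"
    then have S: "S \<subseteq> {..<a}" by force
    then have finS: "finite S" using finite_subset by blast
    \<comment> \<open>\<open>N\<close> holds the last vertices of those runs of \<open>S\<close>
      that stop before a - 1. The path edge leaving such a run is owned by a vertex outside
      \<open>S\<close> but still touches \<open>S\<close>.\<close>
    define N where "N = {i \<in> S. Suc i \<notin> S \<and> Suc i < a}"
    have "a * card {i \<in> {1..b}. i \<in> S \<or> par i \<in> S} \<ge> a * (\<Sum>i\<in>S. f (Suc i) - f i) + a * card N"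
    proof -
      have "(\<Sum>i\<in>S. f (Suc i) - f i) = (\<Sum>i\<in>S. card (L i) + (if i = 0 then 0 else 1))"
      proof (rule sum.cong)
        fix i assume "i \<in> S"
        then have "i < a" using S by auto
        then show "f (Suc i) - f i = card (L i) + (if i = 0 then 0 else 1)" using card_L by simp
      qed simp
      also have "\<dots> = (\<Sum>i\<in>S. card (L i)) + card (S - {0})"
      proof -
        have "(\<Sum>i\<in>S. if i = 0 then 0 else 1::nat) = (\<Sum>i\<in>S - {0}. 1)"
          using finS by (intro sum.mono_neutral_cong_right) auto
        then show ?thesis by (simp add: sum.distrib)
      qed
      also have "(\<Sum>i\<in>S. card (L i)) = card (\<Union>i\<in>S. L i)"
        using finS by (intro card_UN_disjoint[symmetric]) (auto simp: L_def)
      finally have 1: "(\<Sum>i\<in>S. f (Suc i) - f i) = card (\<Union>i\<in>S. L i) + card (S - {0})" .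
      have 2: "card N = card (Suc ` N)" by (simp add: card_image)
      have "card (\<Union>i\<in>S. L i) + card (S - {0}) + card (Suc ` N)
          = card ((\<Union>i\<in>S. L i) \<union> ((S - {0}) \<union> Suc ` N))"
      proof -
        have "finite (\<Union>i\<in>S. L i)" "finite (S - {0})" "finite (Suc ` N)"
          using finS by (auto simp: L_def N_def)
        moreover have "(S - {0}) \<inter> Suc ` N = {}" by (auto simp: N_def)
        moreover have "(\<Union>i\<in>S. L i) \<inter> ((S - {0}) \<union> Suc ` N) = {}"
          using S by (auto simp: L_def N_def)
        ultimately show ?thesis by (simp add: card_Un_disjoint)
      qed
      also have "\<dots> \<le> card {i \<in> {1..b}. i \<in> S \<or> par i \<in> S}"
      proof (rule card_mono)
        have "j \<in> {1..b} \<and> par j \<in> S" if "i \<in> S" "j \<in> L i" for i j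
          using that a by (simp add: L_def par_def)
        moreover have "i \<in> {1..b} \<and> i \<in> S" if "i \<in> S - {0}" for i
          using that S ab by auto
        moreover have "Suc i \<in> {1..b} \<and> par (Suc i) \<in> S" if "i \<in> N" for i
          using that ab by (simp add: N_def par_def)
        ultimately show "(\<Union>i\<in>S. L i) \<union> ((S - {0}) \<union> Suc ` N) \<subseteq> {i \<in> {1..b}. i \<in> S \<or> par i \<in> S}"
          by blast
      qed simp
      finally have "a * (card (\<Union>i\<in>S. L i) + card (S - {0}) + card (Suc ` N))
          \<le> a * card {i \<in> {1..b}. i \<in> S \<or> par i \<in> S}" by (rule mult_le_mono2)
      then show ?thesis unfolding 1 2 by (simp only: distrib_left)
    qed
    moreover have "b * card S \<le> a * (\<Sum>i\<in>S. f (Suc i) - f i) + a * card N"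
    proof -
      have step: "a * (f (Suc i) - f i) + m (Suc i) = b + m i" for i
        using fm[of i] fm[of "Suc i"] f_mono[of i] by (simp add: diff_mult_distrib2)
      \<comment> \<open>The remainders \<open>m\<close> are the rounding errors of the floors. Along
        a run of consecutive vertices they telescope, and the error at the far end, being below a,
        is paid for by the extra edge in \<open>N\<close>; a run ending at a - 1 has error
        \<open>m a = 0\<close>.\<close>
      have "(\<Sum>i\<in>S. m (Suc i)) \<le> (\<Sum>i\<in>S. m i) + a * card N"
      proof -
        have "(\<Sum>i\<in>S. m (Suc i)) = (\<Sum>k\<in>Suc ` S. m k)" by (simp add: sum.reindex)
        also have "\<dots> = (\<Sum>k\<in>Suc ` S \<inter> S. m k) + (\<Sum>k\<in>Suc ` S - S. m k)"
          using finS by (subst sum.union_disjoint[symmetric]) (auto intro: sum.cong)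
        also have "(\<Sum>k\<in>Suc ` S \<inter> S. m k) \<le> (\<Sum>i\<in>S. m i)" using finS by (intro sum_mono2) auto
        also have "(\<Sum>k\<in>Suc ` S - S. m k) = (\<Sum>k\<in>Suc ` N. m k)"
        proof (rule sum.mono_neutral_right)
          show "\<forall>k\<in>Suc ` S - S - Suc ` N. m k = 0"
          proof
            fix k assume k: "k \<in> Suc ` S - S - Suc ` N"
            then obtain i where "k = Suc i" "i \<in> S" by auto
            then have "k = a" using k S by (force simp: N_def)
            then show "m k = 0" using fa by simp
          qed
        qed (use finS in \<open>auto simp: N_def\<close>)
        also have "\<dots> \<le> (\<Sum>k\<in>Suc ` N. a)" using a by (intro sum_mono) (auto simp: m_def intro: less_imp_le)
        also have "\<dots> = a * card N" by (simp add: card_image)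
        finally show ?thesis by simp
      qed
      moreover have "a * (\<Sum>i\<in>S. f (Suc i) - f i) + (\<Sum>i\<in>S. m (Suc i)) = b * card S + (\<Sum>i\<in>S. m i)"
        unfolding sum_distrib_left sum.distrib[symmetric] step by (simp add: sum.distrib)
      ultimately show ?thesis by linarith
    qed
    ultimately show "b * card S \<le> a * card {i \<in> {1..b}. i \<in> S \<or> par i \<in> S}" by linarith
  qed (use a ab in auto)
  then show ?thesis by blast
qed

section \<open>Copies of stars\<close>

text \<open>An injective map between possibly different vertex types composes, unlike a copy given
  as a subgraph; this yields \<open>contains_trans\<close>.\<close>

definition contains :: "'a graph \<Rightarrow> 'b graph \<Rightarrow> bool" where
  "contains F G \<longleftrightarrow> (\<exists>f. inj_on f (verts F) \<and> f ` verts F \<subseteq> verts G \<and> (\<forall>e\<in>edges F. f ` e \<in> edges G))"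

lemma simple_graph_edge:
  assumes "simple_graph G" "e \<in> edges G"
  shows "e \<subseteq> verts G" "card e = 2"
  using assms unfolding simple_graph_def by simp_all

lemma finite_verts: "simple_graph G \<Longrightarrow> finite (verts G)"
  by (simp add: simple_graph_def)

lemma copies_nonempty_iff:
  assumes F: "simple_graph F"
  shows "copies F G \<noteq> {} \<longleftrightarrow> contains F G"
proof
  assume "copies F G \<noteq> {}"
  then obtain C f where C: "subgraph C G" "bij_betw f (verts C) (verts F)" "(\<lambda>e. f ` e) ` edges C = edges F"
    by (auto simp: copies_def graph_iso_def)
  let ?g = "inv_into (verts C) f"
  have g: "bij_betw ?g (verts F) (verts C)" using C(2) by (rule bij_betw_inv_into)
  have "?g ` e \<in> edges G" if e: "e \<in> edges F" for e
  proof -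
    obtain e' where e': "e' \<in> edges C" "e = f ` e'" using e C(3) by blast
    have "e' \<subseteq> verts C" using C(1) e' simple_graph_edge unfolding subgraph_def by blast
    moreover have "inj_on f (verts C)" using C(2) by (simp add: bij_betw_def)
    ultimately have "?g ` e = e'" unfolding e' by (intro inv_into_image_cancel)
    then show ?thesis using e' C(1) by (auto simp: subgraph_def)
  qed
  then show "contains F G" unfolding contains_def
    using g C(1) by (intro exI[of _ ?g]) (auto simp: bij_betw_def subgraph_def)
next
  assume "contains F G"
  then obtain f where f: "inj_on f (verts F)" "f ` verts F \<subseteq> verts G" "\<And>e. e \<in> edges F \<Longrightarrow> f ` e \<in> edges G"
    by (auto simp: contains_def)
  define C where "C = (f ` verts F, (\<lambda>e. f ` e) ` edges F)"
  have sub: "e \<subseteq> verts F" if "e \<in> edges F" for e using F that by (simp add: simple_graph_edge)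
  have "simple_graph C"
    unfolding simple_graph_def C_def using F sub
    by (auto simp: simple_graph_def card_image[OF inj_on_subset[OF f(1)]])
  then have "subgraph C G" using f by (auto simp: subgraph_def C_def)
  moreover have "graph_iso C F" unfolding graph_iso_def
  proof (intro exI conjI)
    let ?g = "inv_into (verts F) f"
    show "bij_betw ?g (verts C) (verts F)"
      unfolding C_def fst_conv by (rule bij_betw_inv_into) (simp add: bij_betw_def f)
    have "?g ` f ` e = e" if "e \<in> edges F" for e using f(1) sub[OF that] by (rule inv_into_image_cancel)
    then show "(\<lambda>e. ?g ` e) ` edges C = edges F" by (force simp: C_def image_image)
  qed
  ultimately show "copies F G \<noteq> {}" unfolding copies_def by blast
qed

lemma free_of_iff:
  assumes "\<And>F. F \<in> \<F> \<Longrightarrow> simple_graph F"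
  shows "free_of \<F> G \<longleftrightarrow> (\<forall>F\<in>\<F>. \<not> contains F G)"
  unfolding free_of_def using copies_nonempty_iff[OF assms, of _ G] by blast

lemma contains_trans:
  assumes "simple_graph F" "contains F G" "contains G H"
  shows "contains F H"
proof -
  obtain f where f: "inj_on f (verts F)" "f ` verts F \<subseteq> verts G" "\<And>e. e \<in> edges F \<Longrightarrow> f ` e \<in> edges G"
    using assms by (auto simp: contains_def)
  obtain g where g: "inj_on g (verts G)" "g ` verts G \<subseteq> verts H" "\<And>e. e \<in> edges G \<Longrightarrow> g ` e \<in> edges H"
    using assms by (auto simp: contains_def)
  show ?thesis unfolding contains_def
  proof (intro exI conjI ballI)
    show "inj_on (g \<circ> f) (verts F)" using f g by (metis comp_inj_on inj_on_subset)
    show "(g \<circ> f) ` verts F \<subseteq> verts H" using f g by auto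
    show "(g \<circ> f) ` e \<in> edges H" if "e \<in> edges F" for e
      using g(3)[OF f(3)[OF that]] by (simp add: image_image)
  qed
qed

section \<open>Neighbourhoods, and copies of stars as centres with leaf sets\<close>

definition nbrs :: "'a graph \<Rightarrow> 'a \<Rightarrow> 'a set" where
  "nbrs G v = {u. {v, u} \<in> edges G}"

lemma nbrs_subset: "simple_graph G \<Longrightarrow> nbrs G v \<subseteq> verts G"
  using simple_graph_edge(1)[of G] unfolding nbrs_def by auto

lemma nbrs_irrefl: "simple_graph G \<Longrightarrow> v \<notin> nbrs G v"
  using simple_graph_edge(2)[of G "{v, v}"] unfolding nbrs_def by auto

lemma finite_nbrs: "simple_graph G \<Longrightarrow> finite (nbrs G v)"
  by (rule finite_subset[OF nbrs_subset finite_verts])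

lemma nbrs_sym: "u \<in> nbrs G v \<longleftrightarrow> v \<in> nbrs G u"
  by (simp add: nbrs_def insert_commute)

abbreviation deg :: "'a graph \<Rightarrow> 'a \<Rightarrow> nat" where
  "deg G v \<equiv> card (nbrs G v)"

lemma deg_le: "simple_graph G \<Longrightarrow> deg G v \<le> card (verts G)"
  by (simp add: card_mono finite_verts nbrs_subset)

definition star_at :: "'a \<Rightarrow> 'a set \<Rightarrow> 'a graph" where
  "star_at v S = (insert v S, (\<lambda>s. {v, s}) ` S)"

lemma simple_graph_star_at: "finite S \<Longrightarrow> v \<notin> S \<Longrightarrow> simple_graph (star_at v S)"
  by (auto simp: simple_graph_def star_at_def card_insert_if)

lemma star_at_eq_star: "star_at 0 {1..t} = star t"
  by (auto simp: star_at_def star_def)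

lemma simple_graph_star: "simple_graph (star t)"
  unfolding star_at_eq_star[symmetric] by (rule simple_graph_star_at) auto

lemma graph_iso_star_at:
  assumes "finite S" "v \<notin> S"
  shows "graph_iso (star_at v S) (star (card S))"
proof -
  obtain h where h: "bij_betw h S {1..card S}" using assms(1) by (metis ex_bij_betw_nat_finite_1 bij_betw_inv_into)
  define f where "f x = (if x = v then 0 else h x)" for x
  have fS: "f s = h s" if "s \<in> S" for s using that assms by (auto simp: f_def)
  have "bij_betw f S {1..card S}" using h by (rule bij_betw_cong[THEN iffD1, rotated]) (simp add: fS)
  then have "bij_betw f (insert v S) (insert 0 {1..card S})"
    using bij_betw_combine[of f "{v}" "{0}" S "{1..card S}"] by (simp add: f_def bij_betw_def)
  moreover have "(\<lambda>e. f ` e) ` (\<lambda>s. {v, s}) ` S = (\<lambda>s. {0, s}) ` {1..card S}"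
  proof -
    have "(\<lambda>e. f ` e) ` (\<lambda>s. {v, s}) ` S = (\<lambda>s. {0, s}) ` h ` S"
      unfolding image_image by (rule image_cong) (simp_all add: fS, simp add: f_def)
    then show ?thesis using h by (simp add: bij_betw_def)
  qed
  ultimately show ?thesis
    unfolding graph_iso_def star_at_eq_star[symmetric] star_at_def fst_conv snd_conv by blast
qed

lemma copies_star_iff:
  assumes G: "simple_graph G" and t: "t \<ge> 1"
  shows "C \<in> copies (star t) G \<longleftrightarrow> (\<exists>v\<in>verts G. \<exists>S\<subseteq>nbrs G v. card S = t \<and> C = star_at v S)"
proof
  assume "C \<in> copies (star t) G"
  then obtain f where C: "subgraph C G" and f: "bij_betw f (verts C) (verts (star t))"
    and e: "(\<lambda>e. f ` e) ` edges C = edges (star t)"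
    by (auto simp: copies_def graph_iso_def)
  let ?g = "inv_into (verts C) f"
  define v where "v = ?g 0"
  define S where "S = ?g ` {1..t}"
  have vs: "verts (star t) = insert 0 {1..t}" and es: "edges (star t) = (\<lambda>s. {0, s}) ` {1..t}"
    by (auto simp: star_at_eq_star[symmetric] star_at_def)
  have g: "bij_betw ?g (verts (star t)) (verts C)" using f by (rule bij_betw_inv_into)
  have subC: "e' \<subseteq> verts C" if "e' \<in> edges C" for e'
    using C that by (auto simp: subgraph_def simple_graph_def)
  have "verts C = insert v S" using g unfolding vs by (auto simp: bij_betw_def v_def S_def)
  moreover have "edges C = (\<lambda>s. {v, s}) ` S"
  proof -
    have "?g ` f ` e' = e'" if "e' \<in> edges C" for e'
      using f subC[OF that] by (metis bij_betw_def inv_into_image_cancel)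
    then have "edges C = (\<lambda>e. ?g ` e) ` (\<lambda>e. f ` e) ` edges C" by (simp add: image_image)
    then show ?thesis unfolding e es by (simp add: image_image v_def S_def)
  qed
  ultimately have Ceq: "C = star_at v S" by (simp add: star_at_def prod_eq_iff)
  have "inj_on ?g {1..t}" using g unfolding vs bij_betw_def by (auto intro: inj_on_subset)
  then have "card S = t" by (simp add: S_def card_image)
  moreover have "S \<subseteq> nbrs G v" "v \<in> verts G"
    using C by (auto simp: Ceq star_at_def subgraph_def nbrs_def)
  ultimately show "\<exists>v\<in>verts G. \<exists>S\<subseteq>nbrs G v. card S = t \<and> C = star_at v S" using Ceq by blast
next
  assume "\<exists>v\<in>verts G. \<exists>S\<subseteq>nbrs G v. card S = t \<and> C = star_at v S"
  then obtain v S where h: "v \<in> verts G" "S \<subseteq> nbrs G v" "card S = t" "C = star_at v S" by blast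
  have fin: "finite S" using h t by (metis card.infinite not_one_le_zero)
  have vS: "v \<notin> S" using h nbrs_irrefl[OF G] by blast
  have "subgraph C G" using h fin vS simple_graph_star_at[OF fin vS] nbrs_subset[OF G]
    by (auto simp: subgraph_def star_at_def nbrs_def)
  then show "C \<in> copies (star t) G" using graph_iso_star_at[OF fin vS] h by (simp add: copies_def)
qed

text \<open>Every copy is some \<open>star_at v S\<close>; for t = 1 an edge arises from both of its
  ends, so the sum is only an upper bound.\<close>

lemma card_copies_star_le:
  assumes G: "simple_graph G" and t: "t \<ge> 1"
  shows "card (copies (star t) G) \<le> (\<Sum>v\<in>verts G. deg G v choose t)"
proof -
  let ?P = "SIGMA v : verts G. {S. S \<subseteq> nbrs G v \<and> card S = t}"
  have "copies (star t) G \<subseteq> (\<lambda>(v, S). star_at v S) ` ?P"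
    using copies_star_iff[OF G t] by (force simp: image_iff)
  moreover have fin: "finite ?P" using finite_verts[OF G] finite_nbrs[OF G] by (intro finite_SigmaI) auto
  ultimately have "card (copies (star t) G) \<le> card ?P"
    by (meson card_image_le card_mono finite_imageI order.trans)
  also have "\<dots> = (\<Sum>v\<in>verts G. card {S. S \<subseteq> nbrs G v \<and> card S = t})"
    using finite_verts[OF G] finite_nbrs[OF G] by (intro card_SigmaI) auto
  finally show ?thesis by (simp add: n_subsets finite_nbrs[OF G])
qed

text \<open>A star centred in the independent set \<open>A\<close> meets \<open>A\<close> in its
  centre only, so centre and leaves can be read off from the copy even when t = 1.\<close>

lemma card_copies_star_ge:
  assumes G: "simple_graph G" and t: "t \<ge> 1"
    and A: "A \<subseteq> verts G" "\<And>v. v \<in> A \<Longrightarrow> nbrs G v \<inter> A = {}"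
  shows "(\<Sum>v\<in>A. deg G v choose t) \<le> card (copies (star t) G)"
proof -
  let ?P = "SIGMA v : A. {S. S \<subseteq> nbrs G v \<and> card S = t}"
  have finA: "finite A" using A finite_verts[OF G] finite_subset by blast
  have "inj_on (\<lambda>(v, S). star_at v S) ?P"
  proof (rule inj_onI, clarsimp)
    fix v S u T assume h: "v \<in> A" "u \<in> A" "S \<subseteq> nbrs G v" "T \<subseteq> nbrs G u" "star_at v S = star_at u T"
    then have eq: "insert v S = insert u T" by (simp add: star_at_def)
    then have "insert v S \<inter> A = insert u T \<inter> A" by simp
    then have "v = u" using h A by blast
    moreover have "v \<notin> S" "u \<notin> T" using h nbrs_irrefl[OF G] by blast+
    ultimately show "v = u \<and> S = T" using eq by (metis insert_ident)
  qed
  moreover have "(\<lambda>(v, S). star_at v S) ` ?P \<subseteq> copies (star t) G"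
  proof (rule image_subsetI)
    fix p assume "p \<in> ?P"
    then obtain v S where "p = (v, S)" "v \<in> A" "S \<subseteq> nbrs G v" "card S = t" by auto
    then show "(case p of (v, S) \<Rightarrow> star_at v S) \<in> copies (star t) G"
      using copies_star_iff[OF G t, of "star_at v S"] A(1) by auto
  qed
  ultimately have "card ?P \<le> card (copies (star t) G)"
    using finite_copies[OF G] by (meson card_inj_on_le)
  moreover have "card ?P = (\<Sum>v\<in>A. card {S. S \<subseteq> nbrs G v \<and> card S = t})"
    using finA finite_nbrs[OF G] by (intro card_SigmaI) auto
  ultimately show ?thesis by (simp add: n_subsets finite_nbrs[OF G])
qed

lemma ex_ge:
  fixes G :: "nat graph"
  assumes "simple_graph G" "card (verts G) = n" "free_of \<F> G"
  shows "card (copies H G) \<le> ex n H \<F>"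
  unfolding ex_def
proof (intro cSup_upper bdd_above_finite finite_ex_values)
  show "card (copies H G) \<in> ex_values n H \<F>" unfolding ex_values_def using assms by blast
qed

text \<open>If no graph on n vertices is free, the supremum of the empty set of naturals is 0 and
  the bound still holds.\<close>

lemma ex_le:
  assumes "\<And>G :: nat graph. simple_graph G \<Longrightarrow> card (verts G) = n \<Longrightarrow> free_of \<F> G \<Longrightarrow> card (copies H G) \<le> B"
  shows "ex n H \<F> \<le> B"
proof (cases "ex_values n H \<F> = {}")
  case False
  then show ?thesis unfolding ex_def using assms by (intro cSup_least) (auto simp: ex_values_def)
qed (simp add: ex_def Sup_nat_def)

lemma realizableI:
  assumes "finite \<F>" "\<And>F. F \<in> \<F> \<Longrightarrow> simple_graph F"
    and "c > 0" "\<And>n. n \<ge> n0 \<Longrightarrow> c * real n powr of_rat r \<le> real (ex n H \<F>)"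
    and "\<And>n. n \<ge> n0 \<Longrightarrow> real (ex n H \<F>) \<le> C * real n powr of_rat r"
  shows "realizable r H"
proof -
  have "(\<lambda>n. real (ex n H \<F>)) \<in> O(\<lambda>n. real n powr of_rat r)"
    using assms(5) by (intro bigoI[of _ C] eventually_sequentiallyI[of n0]) auto
  moreover have "(\<lambda>n. real (ex n H \<F>)) \<in> \<Omega>(\<lambda>n. real n powr of_rat r)"
    using assms(3,4) by (intro landau_omega.bigI[of c] eventually_sequentiallyI[of n0]) auto
  ultimately show ?thesis unfolding realizable_def using assms(1,2) by (auto simp: bigtheta_def)
qed

lemma realizableE:
  assumes "realizable r H"
  obtains \<F> c C n0 where "finite \<F>" "\<And>F. F \<in> \<F> \<Longrightarrow> simple_graph F" "c > 0" "C > 0"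
    "\<And>n. n \<ge> n0 \<Longrightarrow> c * real n powr of_rat r \<le> real (ex n H \<F>)"
    "\<And>n. n \<ge> n0 \<Longrightarrow> real (ex n H \<F>) \<le> C * real n powr of_rat r"
proof -
  obtain \<F> where F: "finite \<F>" "\<And>F. F \<in> \<F> \<Longrightarrow> simple_graph F"
    "(\<lambda>n. real (ex n H \<F>)) \<in> \<Theta>(\<lambda>n. real n powr of_rat r)"
    using assms by (auto simp: realizable_def)
  obtain C where C: "C > 0" "eventually (\<lambda>n. norm (real (ex n H \<F>)) \<le> C * norm (real n powr of_rat r)) at_top"
    using landau_o.bigE[OF bigthetaD1[OF F(3)]] by blast
  obtain c where c: "c > 0" "eventually (\<lambda>n. norm (real (ex n H \<F>)) \<ge> c * norm (real n powr of_rat r)) at_top"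
    using landau_omega.bigE[OF bigthetaD2[OF F(3)]] by blast
  obtain n0 where "\<And>n. n \<ge> n0 \<Longrightarrow> c * norm (real n powr of_rat r) \<le> norm (real (ex n H \<F>)) \<and>
      norm (real (ex n H \<F>)) \<le> C * norm (real n powr of_rat r)"
    using eventually_conj[OF C(2) c(2)] unfolding eventually_sequentially by blast
  then show ?thesis using F C c by (intro that[of \<F> c C n0]) auto
qed

section \<open>The algebraic graph\<close>

text \<open>\<open>New l\<close> indexes the generic coordinates found in the course of the proof; the graph does not use it.\<close>

datatype param = Lam nat | Coef nat nat nat | New nat

text \<open>The first \<open>a\<close> coordinates of \<open>y\<close> do not enter, so each equation of \<open>adj\<close> can be solved for its
  left-hand side.\<close>

definition lin_form :: "nat \<Rightarrow> nat \<Rightarrow> 'k::field \<Rightarrow> (nat \<Rightarrow> 'k) \<Rightarrow> (nat \<Rightarrow> 'k) \<Rightarrow> 'k" where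
  "lin_form a b l x y = (\<Sum>r<b. l ^ r * x r) + (\<Sum>r=a..<b. l ^ (b + r) * y r)"

text \<open>Each of the \<open>J\<close> forms carries a univariate polynomial of degree below
  \<open>M\<close>. \<open>J\<close> will be large enough that some form separates the edges of a
  bounded subgraph, and \<open>M\<close> at least the number of these edges, so that for each i
  interpolation in that form recovers one coefficient per edge.\<close>

definition height :: "nat \<Rightarrow> nat \<Rightarrow> nat \<Rightarrow> nat \<Rightarrow> (param \<Rightarrow> 'k::field) \<Rightarrow> nat \<Rightarrow> (nat \<Rightarrow> 'k) \<Rightarrow> (nat \<Rightarrow> 'k) \<Rightarrow> 'k" where
  "height a b J M c i x y = (\<Sum>j<J. \<Sum>k<M. c (Coef i j k) * lin_form a b (c (Lam j)) x y ^ k)"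

definition points :: "nat \<Rightarrow> 'k set \<Rightarrow> (nat \<Rightarrow> 'k) set" where
  "points b F = {..<b} \<rightarrow>\<^sub>E F"

definition adj :: "nat \<Rightarrow> nat \<Rightarrow> nat \<Rightarrow> nat \<Rightarrow> (param \<Rightarrow> 'k::field) \<Rightarrow> (nat \<Rightarrow> 'k) \<Rightarrow> (nat \<Rightarrow> 'k) \<Rightarrow> bool" where
  "adj a b J M c x y \<longleftrightarrow> (\<forall>i<a. y i = height a b J M c i x y)"

definition alg_graph ::
    "nat \<Rightarrow> nat \<Rightarrow> nat \<Rightarrow> nat \<Rightarrow> (param \<Rightarrow> 'k::field) \<Rightarrow> 'k set \<Rightarrow> (bool \<times> (nat \<Rightarrow> 'k)) graph" where
  "alg_graph a b J M c F =
     (UNIV \<times> points b F, {{(False, x), (True, y)} | x y. x \<in> points b F \<and> y \<in> points b F \<and> adj a b J M c x y})"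

lemma finite_points: "finite F \<Longrightarrow> finite (points b F)"
  by (simp add: points_def finite_PiE)

lemma card_points: "card (points b F) = card F ^ b"
  by (simp add: points_def card_PiE)

lemma simple_alg_graph: "finite F \<Longrightarrow> simple_graph (alg_graph a b J M c F)"
  by (auto simp: simple_graph_def alg_graph_def finite_points)

lemma card_verts_alg_graph: "card (verts (alg_graph a b J M c F)) = 2 * card F ^ b"
  by (simp add: alg_graph_def card_cartesian_product card_points)

lemma nbrs_alg_graph:
  "x \<in> points b F \<Longrightarrow>
     nbrs (alg_graph a b J M c F) (False, x) = Pair True ` {y \<in> points b F. adj a b J M c x y}"
  by (auto simp: nbrs_def alg_graph_def doubleton_eq_iff)

lemma height_cong:
  "(\<And>r. a \<le> r \<Longrightarrow> r < b \<Longrightarrow> y r = y' r) \<Longrightarrow> height a b J M c i x y = height a b J M c i x y'"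
  unfolding height_def lin_form_def by (intro sum.cong refl arg_cong2[where f = "(*)"] arg_cong2[where f = "(^)"] arg_cong2[where f = "(+)"]) auto

text \<open>The coordinates a, ..., b - 1 of a neighbour are free; the equations then give the first
  a coordinates, which stay in \<open>F\<close> because it is closed under addition and
  multiplication.\<close>

lemma deg_alg_graph_ge:
  assumes F: "finite F" "0 \<in> F" "1 \<in> F" "\<And>u v. u \<in> F \<Longrightarrow> v \<in> F \<Longrightarrow> u + v \<in> F \<and> u * v \<in> F"
    and c: "\<And>p. c p \<in> F" and x: "x \<in> points b F" and ab: "a \<le> b"
  shows "card F ^ (b - a) \<le> deg (alg_graph a b J M c F) (False, x)"
proof -
  have sumF: "sum f T \<in> F" if "\<And>t. t \<in> T \<Longrightarrow> f t \<in> F" for f :: "'b \<Rightarrow> 'a" and T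
    using that by (induction T rule: infinite_finite_induct) (auto simp: F)
  have powF: "u ^ k \<in> F" if "u \<in> F" for u k
    using that by (induction k) (auto simp: F)
  define ext where "ext y = (\<lambda>i\<in>{..<b}. if i < a then height a b J M c i x y else y i)" for y
  have "ext y \<in> {y \<in> points b F. adj a b J M c x y}" if y: "y \<in> {a..<b} \<rightarrow>\<^sub>E F" for y
  proof -
    have "x r \<in> F" if "r < b" for r using x that by (auto simp: points_def)
    moreover have "y r \<in> F" if "a \<le> r" "r < b" for r using y that by auto
    ultimately have lF: "lin_form a b (c p) x y \<in> F" for p
      unfolding lin_form_def using F c powF by (intro F(4)[THEN conjunct1] sumF) auto
    then have "height a b J M c i x y \<in> F" for i
      unfolding height_def using F(4) c powF by (intro sumF) blast
    then have "ext y \<in> points b F" using y by (auto simp: points_def ext_def)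
    moreover have "height a b J M c i x (ext y) = height a b J M c i x y" for i
      by (rule height_cong) (simp add: ext_def)
    then have "adj a b J M c x (ext y)" using ab by (simp add: adj_def ext_def)
    ultimately show ?thesis by simp
  qed
  then have "ext ` ({a..<b} \<rightarrow>\<^sub>E F) \<subseteq> {y \<in> points b F. adj a b J M c x y}" by blast
  moreover have "inj_on ext ({a..<b} \<rightarrow>\<^sub>E F)"
  proof (rule inj_onI)
    fix y z assume yz: "y \<in> {a..<b} \<rightarrow>\<^sub>E F" "z \<in> {a..<b} \<rightarrow>\<^sub>E F" "ext y = ext z"
    show "y = z"
    proof (rule PiE_ext[OF yz(1,2)])
      fix r assume "r \<in> {a..<b}"
      then show "y r = z r" using fun_cong[OF yz(3), of r] by (simp add: ext_def)
    qed
  qed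
  ultimately have "card ({a..<b} \<rightarrow>\<^sub>E F) \<le> card {y \<in> points b F. adj a b J M c x y}"
    using finite_points[OF F(1), of b] by (intro card_inj_on_le) auto
  then show ?thesis by (simp add: nbrs_alg_graph[OF x] card_image inj_on_def card_PiE)
qed

text \<open>For two edges, the difference of the forms is a polynomial in the parameter whose
  coefficients are the coordinate differences. It is nonzero: if all these coordinates agreed, the
  equations would force the omitted first a coordinates of y to agree too. So each pair of edges
  excludes at most 2 b of the distinct parameters \<open>Lam j\<close>.\<close>

lemma separating_form:
  fixes c :: "param \<Rightarrow> 'k::char2_field"
  assumes Z: "finite Z" "Z \<subseteq> points b F \<times> points b F" "\<And>x y. (x, y) \<in> Z \<Longrightarrow> adj a b J M c x y"
    and inj: "inj_on (\<lambda>j. c (Lam j)) {..<J}" and J: "2 * b * (card Z * card Z) < J"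
  shows "\<exists>j<J. inj_on (\<lambda>(x, y). lin_form a b (c (Lam j)) x y) Z"
proof -
  define P where "P z w = (\<Sum>r<b. monom (fst z r - fst w r) r) + (\<Sum>r=a..<b. monom (snd z r - snd w r) (b + r))"
    for z w :: "(nat \<Rightarrow> 'k) \<times> (nat \<Rightarrow> 'k)"
  have val: "poly (P z w) l = lin_form a b l (fst z) (snd z) - lin_form a b l (fst w) (snd w)" for z w l
    by (simp add: P_def lin_form_def poly_sum poly_monom algebra_simps sum_subtractf)
  have degP: "degree (P z w) \<le> 2 * b" for z w
  proof -
    have "degree (monom u k) \<le> 2 * b" if "k \<le> 2 * b" for u :: 'k and k
      using degree_monom_le[of u k] that by (rule order.trans)
    then show ?thesis unfolding P_def by (intro degree_add_le degree_sum_le) auto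
  qed
  have nz: "P z w \<noteq> 0" if zw: "z \<in> Z" "w \<in> Z" "z \<noteq> w" for z w
  proof
    assume "P z w = 0"
    then have cf: "coeff (P z w) k = 0" for k by simp
    have fst_eq: "fst z r = fst w r" if r: "r < b" for r
    proof -
      have "coeff (P z w) r = (\<Sum>i<b. if i = r then fst z i - fst w i else 0) + (\<Sum>i=a..<b. 0)"
        unfolding P_def coeff_add coeff_sum coeff_monom using r
        by (intro arg_cong2[where f = "(+)"] sum.cong refl) simp_all
      also have "\<dots> = fst z r - fst w r" using r by simp
      finally show ?thesis using cf[of r] by simp
    qed
    have snd_eq: "snd z r = snd w r" if r: "a \<le> r" "r < b" for r
    proof -
      have "coeff (P z w) (b + r) = (\<Sum>i<b. 0) + (\<Sum>i=a..<b. if i = r then snd z i - snd w i else 0)"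
        unfolding P_def coeff_add coeff_sum coeff_monom using r
        by (intro arg_cong2[where f = "(+)"] sum.cong refl) simp_all
      also have "\<dots> = snd z r - snd w r" using r by simp
      finally show ?thesis using cf[of "b + r"] by simp
    qed
    have pts: "fst z \<in> points b F" "fst w \<in> points b F" "snd z \<in> points b F" "snd w \<in> points b F"
      using zw Z by auto
    then have f: "fst z = fst w" unfolding points_def
      by (intro PiE_ext[of "fst z" "{..<b}" "\<lambda>_. F" "fst w"]) (simp_all add: fst_eq)
    have "snd z r = snd w r" if "r < a" for r
    proof -
      have "snd z r = height a b J M c r (fst z) (snd z)"
        using Z(3)[of "fst z" "snd z"] zw that by (simp add: adj_def)
      also have "\<dots> = height a b J M c r (fst w) (snd w)" unfolding f by (intro height_cong snd_eq)
      also have "\<dots> = snd w r" using Z(3)[of "fst w" "snd w"] zw that by (simp add: adj_def)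
      finally show ?thesis .
    qed
    then have "snd z = snd w" using pts snd_eq unfolding points_def by (metis PiE_ext lessThan_iff not_le)
    then show False using f zw by (simp add: prod_eq_iff)
  qed
  define bad where "bad z w = {j. j < J \<and> poly (P z w) (c (Lam j)) = 0}" for z w
  have card_bad: "card (bad z w) \<le> 2 * b" if "z \<in> Z" "w \<in> Z" "z \<noteq> w" for z w
  proof -
    have "card (bad z w) = card ((\<lambda>j. c (Lam j)) ` bad z w)"
      using inj by (intro card_image[symmetric]) (auto simp: bad_def intro: inj_on_subset)
    also have "\<dots> \<le> card {u. poly (P z w) u = 0}"
      using nz[OF that] by (intro card_mono poly_roots_finite) (auto simp: bad_def)
    also have "\<dots> \<le> 2 * b" using card_poly_roots_bound[OF nz[OF that]] degP[of z w] by simp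
    finally show ?thesis .
  qed
  let ?D = "{(z, w) \<in> Z \<times> Z. z \<noteq> w}"
  have finD: "finite ?D" using Z(1) by (auto intro: finite_subset[of _ "Z \<times> Z"])
  have "card (\<Union>(z, w)\<in>?D. bad z w) \<le> (\<Sum>p\<in>?D. card (case p of (z, w) \<Rightarrow> bad z w))"
    by (rule card_UN_le[OF finD])
  also have "\<dots> \<le> (\<Sum>p\<in>?D. 2 * b)" by (intro sum_mono) (auto intro: card_bad)
  also have "\<dots> = 2 * b * card ?D" by simp
  also have "\<dots> \<le> 2 * b * (card Z * card Z)"
  proof (rule mult_left_mono)
    have "card ?D \<le> card (Z \<times> Z)" using Z(1) by (intro card_mono) auto
    then show "card ?D \<le> card Z * card Z" by (simp only: card_cartesian_product)
  qed simp
  also have "\<dots> < card {..<J}" using J by simp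
  finally have "\<not> {..<J} \<subseteq> (\<Union>(z, w)\<in>?D. bad z w)"
  proof -
    assume lt: "card (\<Union>(z, w)\<in>?D. bad z w) < card {..<J}"
    have "finite (\<Union>(z, w)\<in>?D. bad z w)" using finD by (auto simp: bad_def)
    then show ?thesis using lt card_mono leD by blast
  qed
  then obtain j where j: "j < J" "\<And>z w. z \<in> Z \<Longrightarrow> w \<in> Z \<Longrightarrow> z \<noteq> w \<Longrightarrow> poly (P z w) (c (Lam j)) \<noteq> 0"
    by (auto simp: bad_def)
  have "inj_on (\<lambda>(x, y). lin_form a b (c (Lam j)) x y) Z"
  proof (rule inj_onI, rule ccontr)
    fix z w assume "z \<in> Z" "w \<in> Z" "z \<noteq> w"
      "(case z of (x, y) \<Rightarrow> lin_form a b (c (Lam j)) x y) = (case w of (x, y) \<Rightarrow> lin_form a b (c (Lam j)) x y)"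
    then show False using j(2)[of z w] by (simp add: val case_prod_unfold)
  qed
  then show ?thesis using j by blast
qed

text \<open>The equations at the edges \<open>Z\<close> determine the coefficients \<open>Coef i j k\<close> with \<open>k < card Z\<close> for one
  fixed form \<open>j\<close>, by interpolation.\<close>

lemma pivot_polyvals:
  fixes c :: "param \<Rightarrow> 'k::char2_field"
  assumes Z: "finite Z" "Z \<noteq> {}" "card Z \<le> M" "\<And>x y. (x, y) \<in> Z \<Longrightarrow> adj a b J M c x y"
    and j: "j < J" "inj_on (\<lambda>(x, y). lin_form a b (c (Lam j)) x y) Z"
    and G: "finite G" "\<And>j. j < J \<Longrightarrow> c (Lam j) \<in> G"
      "\<And>i j' k. i < a \<Longrightarrow> j' < J \<Longrightarrow> k < M \<Longrightarrow> j' \<noteq> j \<or> card Z \<le> k \<Longrightarrow> c (Coef i j' k) \<in> G"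
      "\<And>x y r. (x, y) \<in> Z \<Longrightarrow> r < b \<Longrightarrow> x r \<in> G \<and> y r \<in> G"
    and ab: "1 \<le> a" "a \<le> b"
    and d: "d = 1 + 2 * b * M + 2 * b * M * M + 2 * b * M"
  shows "\<exists>v. v \<noteq> 0 \<and> v \<in> polyvals d G \<and> (\<forall>g\<in>G. v * g \<in> polyvals d G) \<and>
           (\<forall>i<a. \<forall>k<card Z. v * c (Coef i j k) \<in> polyvals d G)"
proof -
  define e where "e = card Z"
  have e: "1 \<le> e" "e \<le> M" using Z by (auto simp: e_def Suc_le_eq card_gt_0_iff)
  have gen: "g \<in> polyvals 1 G" if "g \<in> G" for g using that G by (intro polyvals_gen) auto
  have lf: "lin_form a b (c (Lam j')) x y \<in> polyvals (2 * b) G" if "(x, y) \<in> Z" "j' < J" for x y j'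
  proof -
    have l: "c (Lam j') ^ n * u \<in> polyvals (2 * b) G" if "n + 1 \<le> 2 * b" "u \<in> G" for n u
    proof -
      have "c (Lam j') ^ n * u \<in> polyvals (1 * n + 1) G"
        using G(1) gen G(2)[OF \<open>j' < J\<close>] that by (intro polyvals_mult polyvals_power) auto
      then show ?thesis using polyvals_mono[of "n + 1" "2 * b" G] that by auto
    qed
    show ?thesis unfolding lin_form_def
      using that G(4) by (intro polyvals_add G(1) polyvals_sum l) auto
  qed
  define w where "w = (\<lambda>(x, y). lin_form a b (c (Lam j)) x y)"
  define v where "v = (\<Prod>z\<in>Z. \<Prod>u\<in>Z - {z}. w z - w u)"
  have w: "w z \<in> polyvals (2 * b) G" if "z \<in> Z" for z
    using that lf[OF _ j(1)] by (cases z) (simp add: w_def)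
  have injw: "inj_on w Z" using j(2) by (simp add: w_def)
  have b1: "1 \<le> 2 * b" using ab by simp
  note interp = interpolation_polyvals[OF G(1) Z(1) injw w b1, folded v_def]
  have bound: "2 * b * e * e \<le> 2 * b * M * M" "2 * b * e \<le> 2 * b * M"
    using e by (auto intro!: mult_mono)
  have v: "v \<in> polyvals (2 * b * e * e) G" using interp(2) by (simp add: e_def)
  have "v * c (Coef i j k) \<in> polyvals d G" if i: "i < a" and k: "k < e" for i k
  proof -
    \<comment> \<open>The unknown coefficients at the form j, as one polynomial of degree below e.
      The equation at an edge expresses its value at that node as y i minus terms made of
      generators; each such term has degree at most 1 + 2 b M, one for the coefficient and 2 b for
      each power of the form.\<close>
    define p where "p = (\<Sum>k<e. monom (c (Coef i j k)) k)"
    have "degree (monom (c (Coef i j k)) k) \<le> e - 1" if "k < e" for k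
      using that degree_monom_le[of "c (Coef i j k)" k] by linarith
    then have "degree p \<le> e - 1" unfolding p_def by (intro degree_sum_le) auto
    then have degp: "degree p < card Z" using e by (simp add: e_def)
    have "poly p (w z) \<in> polyvals (1 + 2 * b * M) G" if z: "z \<in> Z" for z
    proof -
      obtain x y where xy: "z = (x, y)" by (cases z)
      let ?t = "\<lambda>j k. c (Coef i j k) * lin_form a b (c (Lam j)) x y ^ k"
      have tG: "?t j' k \<in> polyvals (1 + 2 * b * M) G" if "j' < J" "k < M" "j' \<noteq> j \<or> e \<le> k" for j' k
      proof -
        have "?t j' k \<in> polyvals (1 + 2 * b * k) G"
          using that z i xy G(1) by (intro polyvals_mult polyvals_power lf gen G(3)) (auto simp: e_def)
        moreover have "2 * b * k \<le> 2 * b * M" using that by (intro mult_left_mono) auto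
        ultimately show ?thesis using polyvals_mono[of "1 + 2 * b * k" "1 + 2 * b * M" G] by auto
      qed
      have "y i = (\<Sum>j<J. \<Sum>k<M. ?t j k)" using Z(4)[of x y] z xy i by (simp add: adj_def height_def)
      also have "\<dots> = (\<Sum>k<M. ?t j k) + (\<Sum>j'\<in>{..<J} - {j}. \<Sum>k<M. ?t j' k)"
        using j(1) by (subst sum.remove[of _ j]) auto
      also have "(\<Sum>k<M. ?t j k) = (\<Sum>k<e. ?t j k) + (\<Sum>k=e..<M. ?t j k)"
        using e by (subst sum.union_disjoint[symmetric]) (auto intro!: sum.cong)
      also have "(\<Sum>k<e. ?t j k) = poly p (w z)"
        by (simp add: p_def poly_sum poly_monom w_def xy)
      finally have "poly p (w z) = y i - ((\<Sum>k=e..<M. ?t j k) + (\<Sum>j'\<in>{..<J} - {j}. \<Sum>k<M. ?t j' k))"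
        by (simp add: algebra_simps)
      also have "\<dots> \<in> polyvals (1 + 2 * b * M) G"
      proof -
        have "y i \<in> polyvals (1 + 2 * b * M) G"
          using gen[of "y i"] G(4)[of x y i] z xy i ab polyvals_mono[of 1 "1 + 2 * b * M" G] by auto
        then show ?thesis unfolding diff_eq_add
          using j(1) by (intro polyvals_add G(1) polyvals_sum tG) auto
      qed
      finally show ?thesis .
    qed
    from interp(3)[OF _ degp this, where k = k]
    have "v * coeff p k \<in> polyvals (1 + 2 * b * M + 2 * b * e * e + 2 * b * e) G" by (simp add: e_def)
    moreover have "coeff p k = c (Coef i j k)" using k by (simp add: p_def coeff_sum)
    moreover have "1 + 2 * b * M + 2 * b * e * e + 2 * b * e \<le> d" unfolding d using bound by linarith
    ultimately show ?thesis using polyvals_mono by fastforce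
  qed
  moreover have "v \<in> polyvals d G"
    using v polyvals_mono[of "2 * b * e * e" d G] bound by (auto simp: d)
  moreover have "v * g \<in> polyvals d G" if "g \<in> G" for g
    using polyvals_mult[OF G(1) v gen[OF that]] polyvals_mono[of "2 * b * e * e + 1" d G] bound by (auto simp: d)
  ultimately show ?thesis using interp(1) unfolding e_def by blast
qed

section \<open>Genericity excludes many embeddings with common roots\<close>

definition pencil_params :: "nat \<Rightarrow> nat \<Rightarrow> nat \<Rightarrow> param set" where
  "pencil_params a J M = Lam ` {..<J} \<union> (\<lambda>(i, j, k). Coef i j k) ` ({..<a} \<times> {..<J} \<times> {..<M})"

lemma finite_pencil_params: "finite (pencil_params a J M)"
  by (simp add: pencil_params_def)

lemma card_pencil_params: "card (pencil_params a J M) = J + a * J * M"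
proof -
  have "card (pencil_params a J M) = card (Lam ` {..<J}) + card ((\<lambda>(i, j, k). Coef i j k) ` ({..<a} \<times> {..<J} \<times> {..<M}))"
    unfolding pencil_params_def by (intro card_Un_disjoint) auto
  moreover have "card (Lam ` {..<J}) = J" by (subst card_image) (auto simp: inj_on_def)
  moreover have "card ((\<lambda>(i, j, k). Coef i j k) ` ({..<a} \<times> {..<J} \<times> {..<M})) = a * J * M"
    by (subst card_image) (auto simp: inj_on_def card_cartesian_product)
  ultimately show ?thesis by simp
qed

lemma New_notin_pencil_params: "New l \<notin> pencil_params a J M"
  by (auto simp: pencil_params_def)

definition adjoin :: "(param \<Rightarrow> 'k) \<Rightarrow> (nat \<Rightarrow> 'k) \<Rightarrow> param \<Rightarrow> 'k" where
  "adjoin c \<xi> p = (case p of New l \<Rightarrow> \<xi> l | _ \<Rightarrow> c p)"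

lemma adjoin_update: "(adjoin c \<xi>)(New l := y) = adjoin c (\<xi>(l := y))"
  by (auto simp: adjoin_def fun_eq_iff split: param.splits)

lemma adjoin_pencil_params: "p \<in> pencil_params a J M \<Longrightarrow> adjoin c \<xi> p = c p"
  by (auto simp: adjoin_def pencil_params_def)

context rooted_tree
begin

lemma tree_embeddings_points:
  assumes "\<phi> \<in> tree_embeddings (alg_graph a b J M c F)" "v \<le> b"
  shows "snd (\<phi> v) \<in> points b F"
proof -
  have "\<phi> v \<in> verts (alg_graph a b J M c F)" using assms by (auto simp: tree_embeddings_def)
  then show ?thesis by (auto simp: alg_graph_def)
qed

text \<open>Embeddings with the same roots are told apart by the coordinates of their \<open>a\<close> non-roots, so
  many of them cannot all have their coordinates in a small set.\<close>

lemma exists_new_coordinate: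
  assumes sub: "\<Phi> \<subseteq> tree_embeddings (alg_graph a b J M c F)"
    and g: "\<And>\<phi> v. \<phi> \<in> \<Phi> \<Longrightarrow> v \<in> R \<Longrightarrow> \<phi> v = g v"
    and B: "finite B" and less: "(2 * card B ^ b) ^ a < card \<Phi>"
  shows "\<exists>\<phi>\<in>\<Phi>. \<exists>v\<in>{..b} - R. \<exists>r<b. snd (\<phi> v) r \<notin> B"
proof (rule ccontr)
  assume "\<not> ?thesis"
  then have inB: "snd (\<phi> v) r \<in> B" if "\<phi> \<in> \<Phi>" "v \<in> {..b} - R" "r < b" for \<phi> v r
    using that by blast
  let ?T = "({..b} - R) \<rightarrow>\<^sub>E (UNIV \<times> ({..<b} \<rightarrow>\<^sub>E B)) :: (nat \<Rightarrow> bool \<times> (nat \<Rightarrow> 'a)) set"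
  have "inj_on (\<lambda>\<phi>. restrict \<phi> ({..b} - R)) \<Phi>"
  proof (rule inj_onI)
    fix \<phi> \<psi> assume h: "\<phi> \<in> \<Phi>" "\<psi> \<in> \<Phi>" "restrict \<phi> ({..b} - R) = restrict \<psi> ({..b} - R)"
    have "\<phi> \<in> {..b} \<rightarrow>\<^sub>E verts (alg_graph a b J M c F)" "\<psi> \<in> {..b} \<rightarrow>\<^sub>E verts (alg_graph a b J M c F)"
      using h sub by (auto simp: tree_embeddings_def)
    then show "\<phi> = \<psi>"
    proof (rule PiE_ext)
      fix v assume v: "v \<in> {..b}"
      show "\<phi> v = \<psi> v"
      proof (cases "v \<in> R")
        case True
        then show ?thesis using g[OF h(1) True] g[OF h(2) True] by simp
      next
        case False
        then show ?thesis using fun_cong[OF h(3), of v] v by simp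
      qed
    qed
  qed
  moreover have "(\<lambda>\<phi>. restrict \<phi> ({..b} - R)) ` \<Phi> \<subseteq> ?T"
  proof (rule image_subsetI)
    fix \<phi> assume \<phi>: "\<phi> \<in> \<Phi>"
    have "snd (\<phi> v) \<in> {..<b} \<rightarrow>\<^sub>E B" if v: "v \<in> {..b} - R" for v
    proof -
      have "snd (\<phi> v) \<in> points b F" using tree_embeddings_points sub \<phi> v by blast
      then show ?thesis using inB[OF \<phi> v] by (auto simp: points_def PiE_iff)
    qed
    then show "restrict \<phi> ({..b} - R) \<in> ?T" by (auto simp: mem_Times_iff)
  qed
  moreover have "finite ?T" using B by (intro finite_PiE finite_cartesian_product) auto
  ultimately have "card \<Phi> \<le> card ?T" by (rule card_inj_on_le)
  also have "card ?T = (2 * card B ^ b) ^ a"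
    by (simp add: card_PiE card_nonroots card_cartesian_product)
  finally show False using less by simp
qed

text \<open>\<open>s\<close> is the number of embeddings picked, \<open>M\<close> bounds the edges
  of their union, \<open>J\<close> is what \<open>separating_form\<close> asks for, \<open>d\<close>
  the degree from \<open>pivot_polyvals\<close>, \<open>N\<close> the number of generic elements,
  \<open>D\<close> the degree for \<open>alg_dependent\<close>, and \<open>B\<close> bounds the
  exceptional set at every extension. With V the non-root vertices and E the edges of the union,
  there are at most J + b |R| + b |V| + (a J M - a |E|) generators. Since b |V| <= a |E|, this is at
  most J + a J M + b |R|, and the summand 1 in \<open>s\<close> puts it below
  \<open>N\<close>.\<close>

lemma alg_graph_not_rich:
  fixes F :: "'k::char2_field set"
  defines "s \<equiv> b * card R + 1"
  defines "M \<equiv> s * b"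
  defines "J \<equiv> 2 * b * (M * M) + 1"
  defines "d \<equiv> 1 + 2 * b * M + 2 * b * M * M + 2 * b * M"
  defines "N \<equiv> J + a * J * M + s"
  defines "D \<equiv> (N * d + 1) ^ N"
  defines "B \<equiv> extension_bound D N"
  assumes F: "finite F" "B < card F"
  shows "\<exists>c. (\<forall>p. c p \<in> F) \<and> \<not> rich ((2 * B ^ b) ^ a + 1) (alg_graph a b J M c F)"
proof -
  let ?I = "pencil_params a J M"
  have cardI: "card ?I = J + a * J * M" by (rule card_pencil_params)
  have "extension_bound D (card ?I) \<le> B" unfolding B_def N_def cardI by (intro extension_bound_mono) simp
  then obtain c where c: "\<And>p. c p \<in> F" "alg_indep D ?I c"
    using alg_indep_exists[OF finite_pencil_params F(1), of D a J M] F(2) by (metis order.strict_trans1)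
  have "\<not> rich ((2 * B ^ b) ^ a + 1) (alg_graph a b J M c F)"
  proof
    let ?G = "alg_graph a b J M c F"
    assume "rich ((2 * B ^ b) ^ a + 1) ?G"
    then obtain g \<Phi> where \<Phi>: "\<Phi> \<subseteq> tree_embeddings ?G" "finite \<Phi>" "card \<Phi> = (2 * B ^ b) ^ a + 1"
      and g: "\<And>\<phi> v. \<phi> \<in> \<Phi> \<Longrightarrow> v \<in> R \<Longrightarrow> \<phi> v = g v"
      unfolding rich_def by blast
    \<comment> \<open>The embeddings \<phi> i may repeat; only the coordinates \<xi> i, jointly with
      the parameters of the graph, have to satisfy no relation.\<close>
    have "\<exists>\<phi> \<xi>. (\<forall>i<l. \<phi> i \<in> \<Phi> \<and> (\<exists>v\<in>{..b} - R. \<exists>r<b. \<xi> i = snd (\<phi> i v) r)) \<and>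
            alg_indep D (?I \<union> New ` {..<l}) (adjoin c \<xi>)" if "l \<le> s" for l
      using that
    proof (induction l)
      case 0
      have "alg_indep D ?I (adjoin c (\<lambda>_. 0))"
        using c(2) by (subst alg_indep_cong[of _ _ c]) (auto simp: adjoin_pencil_params)
      then show ?case by auto
    next
      case (Suc l)
      then obtain \<phi> \<xi> where IH: "\<And>i. i < l \<Longrightarrow> \<phi> i \<in> \<Phi> \<and> (\<exists>v\<in>{..b} - R. \<exists>r<b. \<xi> i = snd (\<phi> i v) r)"
        "alg_indep D (?I \<union> New ` {..<l}) (adjoin c \<xi>)" by auto
      have fin: "finite (?I \<union> New ` {..<l})" by (simp add: finite_pencil_params)
      have notin: "New l \<notin> ?I \<union> New ` {..<l}" using New_notin_pencil_params by auto
      obtain B' where B': "finite B'" "card B' \<le> extension_bound D (Suc (card (?I \<union> New ` {..<l})))"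
        "\<And>y. y \<notin> B' \<Longrightarrow> alg_indep D (insert (New l) (?I \<union> New ` {..<l})) ((adjoin c \<xi>)(New l := y))"
        using alg_indep_extend[OF fin notin IH(2)] by blast
      have "card (?I \<union> New ` {..<l}) \<le> card ?I + card (New ` {..<l})" by (rule card_Un_le)
      also have "card (New ` {..<l}) \<le> l" using card_image_le[of "{..<l}" New] by simp
      finally have "Suc (card (?I \<union> New ` {..<l})) \<le> N" using Suc.prems by (simp add: N_def cardI)
      then have "card B' \<le> B" using B'(2) extension_bound_mono B_def order.trans by blast
      then have "(2 * card B' ^ b) ^ a < card \<Phi>" unfolding \<Phi>(3)
        by (simp add: less_Suc_eq_le power_mono)
      then obtain \<psi> v r where new: "\<psi> \<in> \<Phi>" "v \<in> {..b} - R" "r < b" "snd (\<psi> v) r \<notin> B'"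
        using exists_new_coordinate[OF \<Phi>(1), of g B'] g B'(1) by blast
      define \<phi>' \<xi>' where "\<phi>' = \<phi>(l := \<psi>)" and "\<xi>' = \<xi>(l := snd (\<psi> v) r)"
      have "alg_indep D (?I \<union> New ` {..<Suc l}) (adjoin c \<xi>')"
        using B'(3)[OF new(4)] by (simp add: adjoin_update \<xi>'_def lessThan_Suc)
      moreover have "\<phi>' i \<in> \<Phi> \<and> (\<exists>v\<in>{..b} - R. \<exists>r<b. \<xi>' i = snd (\<phi>' i v) r)" if "i < Suc l" for i
      proof (cases "i = l")
        case True
        then show ?thesis using new by (auto simp: \<phi>'_def \<xi>'_def)
      next
        case False
        then show ?thesis using IH(1)[of i] that by (simp add: \<phi>'_def \<xi>'_def)
      qed
      ultimately show ?case by blast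
    qed
    then obtain \<phi> \<xi> where \<phi>: "\<And>i. i < s \<Longrightarrow> \<phi> i \<in> \<Phi>"
      and \<xi>: "\<And>i. i < s \<Longrightarrow> \<exists>v\<in>{..b} - R. \<exists>r<b. \<xi> i = snd (\<phi> i v) r"
      and indep: "alg_indep D (?I \<union> New ` {..<s}) (adjoin c \<xi>)" by blast
    define \<Psi> where "\<Psi> = \<phi> ` {..<s}"
    define V where "V = (\<Union>\<psi>\<in>\<Psi>. \<psi> ` ({..b} - R))"
    define E where "E = (\<Union>\<psi>\<in>\<Psi>. edge_image \<psi>)"
    \<comment> \<open>The side labels orient the edges, so \<open>Z\<close> lists each edge of
      \<open>E\<close> exactly once as a pair of points.\<close>
    define Z where "Z = {(x, y). {(False, x), (True, y)} \<in> E}"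
    have \<Psi>: "finite \<Psi>" "\<Psi> \<subseteq> \<Phi>" "card \<Psi> \<le> s"
      using \<phi> card_image_le[of "{..<s}" \<phi>] by (auto simp: \<Psi>_def)
    have emb: "inj_on \<psi> {..b}" "edge_image \<psi> \<subseteq> edges ?G" if "\<psi> \<in> \<Psi>" for \<psi>
      using that \<Psi>(2) \<Phi>(1) by (auto simp: tree_embeddings_def)
    have root: "\<psi> v = g v" if "\<psi> \<in> \<Psi>" "v \<in> R" for \<psi> v using that \<Psi>(2) g by blast
    have VE: "b * card V \<le> a * card E"
      unfolding V_def E_def
      by (rule balanced_union[where g = g]) (use \<Psi>(1) emb(1) root in auto)
    have finE: "finite E" "finite V" using \<Psi>(1) by (auto simp: E_def V_def edge_image_def)
    have EG: "E \<subseteq> edges ?G" using emb by (auto simp: E_def)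
    have bij: "bij_betw (\<lambda>(x, y). {(False, x), (True, y)}) Z E"
    proof (rule bij_betw_imageI)
      show "inj_on (\<lambda>(x, y). {(False, x), (True, y)}) Z" by (auto simp: inj_on_def doubleton_eq_iff)
      show "(\<lambda>(x, y). {(False, x), (True, y)}) ` Z = E"
      proof
        show "E \<subseteq> (\<lambda>(x, y). {(False, x), (True, y)}) ` Z"
        proof
          fix f assume f: "f \<in> E"
          then obtain x y where "f = {(False, x), (True, y)}" using EG by (auto simp: alg_graph_def)
          then show "f \<in> (\<lambda>(x, y). {(False, x), (True, y)}) ` Z" using f by (force simp: Z_def)
        qed
      qed (auto simp: Z_def)
    qed
    have cardZ: "card Z = card E" and finZ: "finite Z"
      using bij finE(1) by (auto dest: bij_betw_same_card bij_betw_finite)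
    have "card E \<le> (\<Sum>\<psi>\<in>\<Psi>. card (edge_image \<psi>))" unfolding E_def by (rule card_UN_le[OF \<Psi>(1)])
    also have "\<dots> \<le> (\<Sum>\<psi>\<in>\<Psi>. b)"
      using card_image_le[of "{1..b}"] by (intro sum_mono) (simp add: edge_image_def)
    also have "\<dots> \<le> M" using \<Psi>(3) by (simp add: M_def)
    finally have ZM: "card Z \<le> M" by (simp add: cardZ)
    have "\<phi> 0 \<in> \<Psi>" by (simp add: \<Psi>_def s_def)
    then have "{\<phi> 0 1, \<phi> 0 (par 1)} \<in> E"
      using a_pos a_le_b by (auto simp: E_def edge_image_def intro!: bexI[of _ "\<phi> 0"])
    then have Zne: "Z \<noteq> {}" using bij by (auto simp: bij_betw_def)
    have ZG: "x \<in> points b F \<and> y \<in> points b F \<and> adj a b J M c x y" if "(x, y) \<in> Z" for x y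
    proof -
      have "{(False, x), (True, y)} \<in> edges ?G" using that EG by (auto simp: Z_def)
      then show ?thesis by (auto simp: alg_graph_def doubleton_eq_iff)
    qed
    then have Zsub: "Z \<subseteq> points b F \<times> points b F" and Zadj: "\<And>x y. (x, y) \<in> Z \<Longrightarrow> adj a b J M c x y" by auto
    have "inj_on c ?I" using alg_indep_inj[OF c(2) finite_pencil_params] by (simp add: D_def)
    then have injc: "inj_on (\<lambda>j. c (Lam j)) {..<J}"
      by (auto simp: inj_on_def pencil_params_def)
    have "2 * b * (card Z * card Z) \<le> 2 * b * (M * M)" using ZM by (intro mult_le_mono) auto
    then have "2 * b * (card Z * card Z) < J" unfolding J_def by linarith
    then obtain j where j: "j < J" "inj_on (\<lambda>(x, y). lin_form a b (c (Lam j)) x y) Z"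
      using separating_form[OF finZ Zsub Zadj injc] by blast
    \<comment> \<open>The indices of the coefficients that interpolation in the form j determines.
      Leaving them out of \<open>G\<close> saves a generators for every edge.\<close>
    define P where "P = {(i, j, k) |i k. i < a \<and> k < card Z}"
    define G where "G = (\<lambda>j. c (Lam j)) ` {..<J}
        \<union> (\<lambda>(v, r). snd (g v) r) ` (R \<times> {..<b}) \<union> (\<lambda>(u, r). snd u r) ` (V \<times> {..<b})
        \<union> (\<lambda>(i, j, k). c (Coef i j k)) ` ({..<a} \<times> {..<J} \<times> {..<M} - P)"
    have finG: "finite G" unfolding G_def using finite_R finE by auto
    have P: "P \<subseteq> {..<a} \<times> {..<J} \<times> {..<M}" "card P = a * card Z"
    proof -
      show "P \<subseteq> {..<a} \<times> {..<J} \<times> {..<M}" using j ZM by (auto simp: P_def)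
      have "P = (\<lambda>(i, k). (i, j, k)) ` ({..<a} \<times> {..<card Z})" by (auto simp: P_def)
      then show "card P = a * card Z" by (simp add: card_image inj_on_def card_cartesian_product)
    qed
    have "card G \<le> J + card R * b + card V * b + (a * J * M - a * card Z)"
    proof -
      have "card ({..<a} \<times> {..<J} \<times> {..<M} - P) = a * J * M - a * card Z"
        using P finite_subset[OF P(1)] by (simp add: card_Diff_subset card_cartesian_product mult.assoc)
      moreover have "card ((\<lambda>j. c (Lam j)) ` {..<J}) \<le> J" using card_image_le[of "{..<J}"] by simp
      moreover have "card ((\<lambda>(v, r). snd (g v) r) ` (R \<times> {..<b})) \<le> card R * b"
        using card_image_le[of "R \<times> {..<b}" "\<lambda>(v, r). snd (g v) r"] finite_R by (simp add: card_cartesian_product)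
      moreover have "card ((\<lambda>(u, r). snd u r) ` (V \<times> {..<b})) \<le> card V * b"
        using card_image_le[of "V \<times> {..<b}" "\<lambda>(u, r). snd u r"] finE by (simp add: card_cartesian_product)
      moreover have "card ((\<lambda>(i, j, k). c (Coef i j k)) ` ({..<a} \<times> {..<J} \<times> {..<M} - P))
          \<le> card ({..<a} \<times> {..<J} \<times> {..<M} - P)"
        by (intro card_image_le) auto
      ultimately show ?thesis unfolding G_def
        by (intro card_Un_le[THEN order.trans] add_mono) auto
    qed
    moreover have "a * card Z \<le> a * J * M"
      using card_mono[OF _ P(1)] P(2) by (simp add: card_cartesian_product mult.assoc)
    moreover have "card V * b \<le> a * card Z" using VE cardZ by (simp add: mult.commute)
    ultimately have cardG: "card G < N" by (simp add: N_def s_def mult.commute)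
    have coordG: "snd (\<psi> v) r \<in> G" if "\<psi> \<in> \<Psi>" "v \<le> b" "r < b" for \<psi> v r
    proof (cases "v \<in> R")
      case True
      then have "snd (\<psi> v) r = (\<lambda>(v, r). snd (g v) r) (v, r)" using root that by simp
      then show ?thesis unfolding G_def using True that by blast
    next
      case False
      then have "\<psi> v \<in> V" using that by (auto simp: V_def)
      then have "(\<lambda>(u, r). snd u r) (\<psi> v, r) \<in> G" unfolding G_def using that by blast
      then show ?thesis by simp
    qed
    have ZcoordG: "x r \<in> G \<and> y r \<in> G" if xy: "(x, y) \<in> Z" and r: "r < b" for x y r
    proof -
      from xy obtain \<psi> i where \<psi>: "\<psi> \<in> \<Psi>" "i \<in> {1..b}" "{(False, x), (True, y)} = {\<psi> i, \<psi> (par i)}"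
        by (auto simp: Z_def E_def edge_image_def)
      then have "(False, x) \<in> {\<psi> i, \<psi> (par i)}" "(True, y) \<in> {\<psi> i, \<psi> (par i)}" by blast+
      moreover have "snd (\<psi> i) r \<in> G" "snd (\<psi> (par i)) r \<in> G"
        using \<psi> r coordG par_le by auto
      ultimately show ?thesis by (metis insertE singletonD snd_conv)
    qed
    have LamG: "c (Lam j) \<in> G" if "j < J" for j using that unfolding G_def by blast
    have CoefG: "c (Coef i j' k) \<in> G" if "i < a" "j' < J" "k < M" "j' \<noteq> j \<or> card Z \<le> k" for i j' k
    proof -
      have "(i, j', k) \<in> {..<a} \<times> {..<J} \<times> {..<M} - P" using that by (auto simp: P_def)
      then have "(\<lambda>(i, j, k). c (Coef i j k)) (i, j', k) \<in> G" unfolding G_def by blast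
      then show ?thesis by simp
    qed
    obtain v where v: "v \<noteq> 0" "v \<in> polyvals d G" "\<And>g. g \<in> G \<Longrightarrow> v * g \<in> polyvals d G"
      "\<And>i k. i < a \<Longrightarrow> k < card Z \<Longrightarrow> v * c (Coef i j k) \<in> polyvals d G"
    proof -
      have "\<exists>v. v \<noteq> 0 \<and> v \<in> polyvals d G \<and> (\<forall>g\<in>G. v * g \<in> polyvals d G) \<and>
           (\<forall>i<a. \<forall>k<card Z. v * c (Coef i j k) \<in> polyvals d G)"
        by (rule pivot_polyvals[where c = c and j = j and b = b and J = J and M = M])
          (use finZ Zne ZM Zadj j finG LamG CoefG ZcoordG a_pos a_le_b d_def in simp_all)
      then show ?thesis using that by blast
    qed
    have fin: "finite (?I \<union> New ` {..<s})" by (simp add: finite_pencil_params)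
    have cardN: "card (?I \<union> New ` {..<s}) = N"
    proof -
      have "card (?I \<union> New ` {..<s}) = card ?I + card (New ` {..<s})"
        using New_notin_pencil_params by (intro card_Un_disjoint) (auto simp: finite_pencil_params)
      also have "card (New ` {..<s}) = s" by (subst card_image) (auto simp: inj_on_def)
      finally show ?thesis by (simp add: cardI N_def)
    qed
    have "v * adjoin c \<xi> p \<in> polyvals d G" if p: "p \<in> ?I \<union> New ` {..<s}" for p
    proof -
      from p consider i where "p = Lam i" "i < J" | i j' k where "p = Coef i j' k" "i < a" "j' < J" "k < M"
        | i where "p = New i" "i < s"
        by (auto simp: pencil_params_def)
      then show ?thesis
      proof cases
        case 1
        then show ?thesis using v(3) LamG by (simp add: adjoin_def)
      next
        case (2 i j' k)
        then show ?thesis using v(3)[OF CoefG[of i j' k]] v(4)[of i k]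
          by (cases "j' = j \<and> k < card Z") (auto simp: adjoin_def)
      next
        case (3 i)
        obtain u r where ur: "u \<in> {..b} - R" "r < b" "\<xi> i = snd (\<phi> i u) r" using \<xi>[OF 3(2)] by blast
        have "\<xi> i \<in> G" unfolding ur(3) using ur 3 by (intro coordG) (auto simp: \<Psi>_def)
        then show ?thesis using v(3) 3 by (simp add: adjoin_def)
      qed
    qed
    then have "\<not> alg_indep D (?I \<union> New ` {..<s}) (adjoin c \<xi>)"
      using cardG v by (intro alg_dependent[OF fin finG, of v d _ N]) (simp_all add: cardN D_def)
    then show False using indep by blast
  qed
  then show ?thesis using c(1) by blast
qed

end

section \<open>Graphs without many embeddings of the tree\<close>

text \<open>An element of least value has rank \<open>card V\<close>, so its value is at most h
  (card V). Removing it can only lower the ranks of the others, which is harmless because h is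
  antitone.\<close>

lemma sum_rank_le:
  fixes f :: "'v \<Rightarrow> real" and h :: "nat \<Rightarrow> real"
  assumes "finite V" and "\<And>j k. 1 \<le> j \<Longrightarrow> j \<le> k \<Longrightarrow> h k \<le> h j"
    and "\<And>x. x \<in> V \<Longrightarrow> f x \<le> h (card {y \<in> V. f x \<le> f y})"
  shows "sum f V \<le> (\<Sum>k=1..card V. h k)"
  using assms(1,3)
proof (induction "card V" arbitrary: V)
  case 0
  then show ?case by simp
next
  case (Suc n)
  then have ne: "V \<noteq> {}" by auto
  then have "Min (f ` V) \<in> f ` V" using Suc.prems by (intro Min_in) auto
  then obtain x where x: "x \<in> V" "f x = Min (f ` V)" by auto
  then have min: "f x \<le> f y" if "y \<in> V" for y using that Suc.prems by simp
  have "f x \<le> h (card {y \<in> V. f x \<le> f y})" using Suc.prems x by blast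
  also have "{y \<in> V. f x \<le> f y} = V" using min by blast
  finally have fx: "f x \<le> h (Suc n)" using Suc(2) by simp
  have card: "n = card (V - {x})" using Suc x by simp
  have "sum f (V - {x}) \<le> (\<Sum>k=1..card (V - {x}). h k)"
  proof (rule Suc(1)[OF card])
    fix z assume z: "z \<in> V - {x}"
    have fin: "finite {y \<in> V. f z \<le> f y}" "finite {y \<in> V - {x}. f z \<le> f y}" using Suc.prems by auto
    have "1 \<le> card {y \<in> V - {x}. f z \<le> f y}"
      using z fin by (auto simp: Suc_le_eq card_gt_0_iff)
    moreover have "card {y \<in> V - {x}. f z \<le> f y} \<le> card {y \<in> V. f z \<le> f y}"
      using fin by (intro card_mono) auto
    ultimately have "h (card {y \<in> V. f z \<le> f y}) \<le> h (card {y \<in> V - {x}. f z \<le> f y})" by (rule assms(2))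
    then show "f z \<le> h (card {y \<in> V - {x}. f z \<le> f y})" using Suc.prems(2)[of z] z by auto
  qed (use Suc.prems in auto)
  then have "sum f (V - {x}) \<le> (\<Sum>k=1..n. h k)" using card by simp
  moreover have "(\<Sum>k=1..card V. h k) = (\<Sum>k=1..n. h k) + h (Suc n)" unfolding Suc(2)[symmetric] by simp
  moreover have "sum f V = f x + sum f (V - {x})" using Suc.prems x by (intro sum.remove) auto
  ultimately show ?case using fx by linarith
qed

text \<open>By the mean value theorem each term is at most an increment of x powr (1 - \<theta>) /
  (1 - \<theta>), the antiderivative of x powr (- \<theta>).\<close>

lemma sum_powr_le:
  fixes \<theta> :: real
  assumes "0 \<le> \<theta>" "\<theta> < 1"
  shows "(\<Sum>k=1..n. real k powr (- \<theta>)) \<le> real n powr (1 - \<theta>) / (1 - \<theta>)"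
proof (induction n)
  case (Suc n)
  have "(1 - \<theta>) * real (Suc n) powr (- \<theta>) \<le> real (Suc n) powr (1 - \<theta>) - real n powr (1 - \<theta>)"
  proof (cases "n = 0")
    case True
    then show ?thesis using assms by simp
  next
    case False
    have "\<exists>z. real n < z \<and> z < real (Suc n) \<and>
        real (Suc n) powr (1 - \<theta>) - real n powr (1 - \<theta>) = (real (Suc n) - real n) * ((1 - \<theta>) * z powr (1 - \<theta> - 1))"
    proof (rule MVT2)
      fix x assume "real n \<le> x" "x \<le> real (Suc n)"
      then show "((\<lambda>x. x powr (1 - \<theta>)) has_real_derivative (1 - \<theta>) * x powr (1 - \<theta> - 1)) (at x)"
        using False by (intro has_real_derivative_powr) simp
    qed simp
    then obtain z where z: "real n < z" "z < real (Suc n)"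
      "real (Suc n) powr (1 - \<theta>) - real n powr (1 - \<theta>) = (1 - \<theta>) * z powr (- \<theta>)" by auto
    have "real (Suc n) powr (- \<theta>) \<le> z powr (- \<theta>)"
      using z assms False by (intro powr_mono2') auto
    then show ?thesis unfolding z(3) using assms by (intro mult_left_mono) auto
  qed
  then have "real (Suc n) powr (- \<theta>) \<le> (real (Suc n) powr (1 - \<theta>) - real n powr (1 - \<theta>)) / (1 - \<theta>)"
    using assms by (simp add: pos_le_divide_eq mult.commute)
  then show ?case using Suc by (simp add: diff_divide_distrib)
qed simp

section \<open>Transfer of embeddings and the finite forbidden family\<close>

context rooted_tree
begin

lemma b_pos: "1 \<le> b"
  using a_pos a_le_b by simp

lemma edge_image_comp:
  assumes "\<phi> \<in> {..b} \<rightarrow> S"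
  shows "edge_image (restrict (h \<circ> \<phi>) {..b}) = (\<lambda>e. h ` e) ` edge_image \<phi>"
  unfolding edge_image_def image_image using par_le by (intro image_cong) auto

lemma rich_contains:
  assumes "contains F G" "rich p F"
  shows "rich p G"
proof -
  obtain h where h: "inj_on h (verts F)" "h ` verts F \<subseteq> verts G" "\<And>e. e \<in> edges F \<Longrightarrow> h ` e \<in> edges G"
    using assms(1) by (auto simp: contains_def)
  obtain g \<Phi> where \<Phi>: "\<Phi> \<subseteq> tree_embeddings F" "finite \<Phi>" "card \<Phi> = p" "\<And>\<phi> v. \<phi> \<in> \<Phi> \<Longrightarrow> v \<in> R \<Longrightarrow> \<phi> v = g v"
    using assms(2) unfolding rich_def by blast
  let ?h = "\<lambda>\<phi>. restrict (h \<circ> \<phi>) {..b}"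
  have emb: "\<phi> \<in> {..b} \<rightarrow>\<^sub>E verts F" "inj_on \<phi> {..b}" "edge_image \<phi> \<subseteq> edges F" if "\<phi> \<in> \<Phi>" for \<phi>
    using that \<Phi>(1) by (auto simp: tree_embeddings_def)
  have "inj_on ?h \<Phi>"
  proof (rule inj_onI)
    fix \<phi> \<psi> assume eq: "\<phi> \<in> \<Phi>" "\<psi> \<in> \<Phi>" "?h \<phi> = ?h \<psi>"
    show "\<phi> = \<psi>"
    proof (rule PiE_ext[OF emb(1)[OF eq(1)] emb(1)[OF eq(2)]])
      fix v assume v: "v \<in> {..b}"
      then have "h (\<phi> v) = h (\<psi> v)" using fun_cong[OF eq(3), of v] by simp
      then show "\<phi> v = \<psi> v" using h(1) emb(1)[OF eq(1)] emb(1)[OF eq(2)] v by (auto dest: inj_onD)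
    qed
  qed
  moreover have "?h \<phi> \<in> tree_embeddings G" if \<phi>: "\<phi> \<in> \<Phi>" for \<phi>
  proof -
    have im: "\<phi> ` {..b} \<subseteq> verts F" using emb(1)[OF \<phi>] by auto
    then have "inj_on (h \<circ> \<phi>) {..b}" using emb(2)[OF \<phi>] h(1) by (metis comp_inj_on inj_on_subset)
    then have "inj_on (?h \<phi>) {..b}" by (simp add: inj_on_def)
    moreover have "edge_image (?h \<phi>) \<subseteq> edges G"
      using edge_image_comp[of \<phi> "verts F" h] emb[OF \<phi>] h(3) by fastforce
    moreover have "h (\<phi> v) \<in> verts G" if "v \<le> b" for v using im h(2) that by blast
    then have "?h \<phi> \<in> {..b} \<rightarrow>\<^sub>E verts G" by auto
    ultimately show ?thesis by (simp add: tree_embeddings_def)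
  qed
  moreover have "?h \<phi> v = (h \<circ> g) v" if "\<phi> \<in> \<Phi>" "v \<in> R" for \<phi> v
    using \<Phi>(4)[OF that] that R_subset by auto
  ultimately show ?thesis unfolding rich_def using \<Phi>(2,3)
    by (intro exI[of _ "h \<circ> g"] exI[of _ "?h ` \<Phi>"]) (auto simp: card_image)
qed

text \<open>As b is positive, every tree vertex lies on an edge, so no embedding uses an isolated
  vertex of the host. This disposes of the padding in the lower bound.\<close>

lemma rich_restrict:
  assumes "rich p G" "\<Union>(edges G) \<subseteq> W"
  shows "rich p (W, edges G)"
proof -
  have "\<phi> v \<in> W" if \<phi>: "\<phi> \<in> tree_embeddings G" and v: "v \<le> b" for \<phi> v
  proof -
    have E: "{\<phi> i, \<phi> (par i)} \<subseteq> W" if "1 \<le> i" "i \<le> b" for i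
    proof -
      have "{\<phi> i, \<phi> (par i)} \<in> edges G" using \<phi> that by (auto simp: tree_embeddings_def edge_image_def)
      then show ?thesis using assms(2) by blast
    qed
    show ?thesis
    proof (cases "v = 0")
      case True
      then show ?thesis using E[of 1] par_less[of 1] b_pos by simp
    next
      case False
      then show ?thesis using E[of v] v by simp
    qed
  qed
  then have "tree_embeddings G \<subseteq> tree_embeddings (W, edges G)"
    by (auto simp: tree_embeddings_def PiE_iff)
  then have "\<Phi> \<subseteq> tree_embeddings (W, edges G)" if "\<Phi> \<subseteq> tree_embeddings G" for \<Phi> using that by (rule order.trans[rotated])
  then show ?thesis using assms(1) unfolding rich_def by metis
qed

text \<open>A union of p embeddings has at most p (b + 1) vertices, so restricting the labels to
  that many naturals makes the family finite without losing an isomorphism type of such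
  unions.\<close>

definition forbidden :: "nat \<Rightarrow> nat graph set" where
  "forbidden p = {F. simple_graph F \<and> verts F \<subseteq> {..<p * (b + 1)} \<and> rich p F}"

lemma finite_forbidden: "finite (forbidden p)"
proof (rule finite_subset)
  show "forbidden p \<subseteq> Pow {..<p * (b + 1)} \<times> Pow (Pow {..<p * (b + 1)})"
    by (auto simp: forbidden_def simple_graph_def) (meson lessThan_iff subsetD)
qed auto

text \<open>In a rich graph, the subgraph induced on the images of p embeddings with common roots,
  relabelled by an initial segment of the naturals, is a forbidden graph contained in it.\<close>

lemma free_of_forbidden:
  fixes G :: "'v graph"
  assumes G: "simple_graph G"
  shows "free_of (forbidden p) G \<longleftrightarrow> \<not> rich p G"
proof -
  have "free_of (forbidden p) G \<longleftrightarrow> (\<forall>F\<in>forbidden p. \<not> contains F G)"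
    by (intro free_of_iff) (simp add: forbidden_def)
  also have "\<dots> \<longleftrightarrow> \<not> rich p G"
  proof
    assume "\<not> rich p G"
    then show "\<forall>F\<in>forbidden p. \<not> contains F G" using rich_contains unfolding forbidden_def by blast
  next
    assume free: "\<forall>F\<in>forbidden p. \<not> contains F G"
    show "\<not> rich p G"
    proof
      assume "rich p G"
      then obtain g \<Phi> where \<Phi>: "\<Phi> \<subseteq> tree_embeddings G" "finite \<Phi>" "card \<Phi> = p" "\<And>\<phi> v. \<phi> \<in> \<Phi> \<Longrightarrow> v \<in> R \<Longrightarrow> \<phi> v = g v"
        unfolding rich_def by blast
      define W where "W = (\<Union>\<phi>\<in>\<Phi>. \<phi> ` {..b})"
      define H where "H = (W, {e \<in> edges G. e \<subseteq> W})"
      have finW: "finite W" using \<Phi>(2) by (simp add: W_def)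
      have "card W \<le> (\<Sum>\<phi>\<in>\<Phi>. card (\<phi> ` {..b}))" unfolding W_def by (rule card_UN_le[OF \<Phi>(2)])
      also have "\<dots> \<le> (\<Sum>\<phi>\<in>\<Phi>. b + 1)" using card_image_le[of "{..b}"] by (intro sum_mono) simp
      finally have cardW: "card W \<le> p * (b + 1)" using \<Phi>(3) by simp
      have "\<phi> \<in> tree_embeddings H" if \<phi>: "\<phi> \<in> \<Phi>" for \<phi>
      proof -
        have "\<phi> ` {..b} \<subseteq> W" using \<phi> by (auto simp: W_def)
        moreover have "edge_image \<phi> \<subseteq> Pow (\<phi> ` {..b})" using par_le by (auto simp: edge_image_def)
        ultimately have "edge_image \<phi> \<subseteq> Pow W" by blast
        moreover have "\<phi> \<in> tree_embeddings G" using \<Phi>(1) \<phi> by blast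
        ultimately show ?thesis using \<open>\<phi> ` {..b} \<subseteq> W\<close> by (auto simp: tree_embeddings_def H_def PiE_iff)
      qed
      then have "\<Phi> \<subseteq> tree_embeddings H" by blast
      then have "rich p H" unfolding rich_def using \<Phi>(2,3,4) by blast
      obtain h where h: "bij_betw h W {0..<card W}" using finW ex_bij_betw_finite_nat by blast
      define F where "F = ({0..<card W}, (\<lambda>e. h ` e) ` edges H)"
      have inj: "inj_on h W" and im: "h ` W = {0..<card W}" using h by (auto simp: bij_betw_def)
      have "contains H F" unfolding contains_def H_def F_def using inj im by (intro exI[of _ h]) auto
      then have "rich p F" using \<open>rich p H\<close> by (rule rich_contains)
      moreover have "simple_graph F"
        unfolding simple_graph_def
      proof (intro conjI ballI)
        fix e assume "e \<in> edges F"
        then obtain e' where e': "e' \<in> edges G" "e' \<subseteq> W" "e = h ` e'" by (auto simp: F_def H_def)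
        show "e \<subseteq> verts F" using e' im by (auto simp: F_def)
        show "card e = 2" using e' simple_graph_edge(2)[OF G e'(1)] card_image[OF inj_on_subset[OF inj e'(2)]] by simp
      qed (simp add: F_def)
      moreover have "verts F \<subseteq> {..<p * (b + 1)}" using cardW by (auto simp: F_def)
      ultimately have "F \<in> forbidden p" by (simp add: forbidden_def)
      moreover have "contains F G" unfolding contains_def
      proof (intro exI conjI ballI)
        let ?k = "inv_into W h"
        show "inj_on ?k (verts F)" unfolding F_def fst_conv im[symmetric] by (rule inj_on_inv_into) simp
        have "W \<subseteq> verts G" using \<Phi>(1) by (auto simp: W_def tree_embeddings_def)
        then show "?k ` verts F \<subseteq> verts G" unfolding F_def fst_conv im[symmetric] by (auto simp: inv_into_f_f[OF inj])
        fix e assume "e \<in> edges F"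
        then obtain e' where e': "e' \<in> edges G" "e' \<subseteq> W" "e = h ` e'" by (auto simp: F_def H_def)
        then show "?k ` e \<in> edges G" using inv_into_image_cancel[OF inj e'(2)] by simp
      qed
      ultimately show False using free by blast
    qed
  qed
  finally show ?thesis .
qed

lemma side_exists: "\<exists>side :: nat \<Rightarrow> bool. \<not> side 0 \<and> (\<forall>i. 1 \<le> i \<longrightarrow> i \<le> b \<longrightarrow> side i = (\<not> side (par i)))"
proof -
  have "\<exists>side :: nat \<Rightarrow> bool. \<not> side 0 \<and> (\<forall>i. 1 \<le> i \<longrightarrow> i \<le> k \<longrightarrow> side i = (\<not> side (par i)))" if "k \<le> b" for k
    using that
  proof (induction k)
    case (Suc k)
    then obtain side :: "nat \<Rightarrow> bool" where s: "\<not> side 0" "\<And>i. 1 \<le> i \<Longrightarrow> i \<le> k \<Longrightarrow> side i = (\<not> side (par i))"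
      by auto
    let ?s = "side(Suc k := \<not> side (par (Suc k)))"
    have ps: "?s (par i) = side (par i)" if "1 \<le> i" "i \<le> Suc k" for i
      using par_less[of i] that Suc.prems by auto
    have "?s i = (\<not> ?s (par i))" if "1 \<le> i" "i \<le> Suc k" for i
      unfolding ps[OF that] using s(2)[of i] that by (cases "i = Suc k") auto
    then show ?case using s(1) by (intro exI[of _ ?s]) auto
  qed (auto intro: exI[of _ "\<lambda>_. False"])
  then show ?thesis by blast
qed

text \<open>Vertices are placed in the order of their labels, so the parent is already there. The
  summand b in \<open>nb\<close> is a reserve: at most b vertices are occupied before each
  extension, which leaves at least d choices.\<close>

lemma greedy_embeddings:
  fixes G :: "'v graph" and W :: "bool \<Rightarrow> 'v set" and d :: "bool \<Rightarrow> nat"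
  assumes side: "\<not> side 0" "\<And>i. 1 \<le> i \<Longrightarrow> i \<le> b \<Longrightarrow> side i = (\<not> side (par i))"
    and fin: "\<And>s. finite (W s)"
    and nb: "\<And>s x. x \<in> W s \<Longrightarrow> d (\<not> s) + b \<le> card (nbrs G x \<inter> W (\<not> s))"
    and k: "k \<le> b"
  shows "card (W False) * (\<Prod>i=1..k. d (side i)) \<le>
    card {\<phi> \<in> {..k} \<rightarrow>\<^sub>E (W False \<union> W True). inj_on \<phi> {..k} \<and> (\<forall>i\<le>k. \<phi> i \<in> W (side i)) \<and>
            (\<forall>i\<in>{1..k}. {\<phi> i, \<phi> (par i)} \<in> edges G)}"
    (is "_ \<le> card (?P k)")
  using k
proof (induction k)
  case 0
  have "(\<lambda>x. \<lambda>i\<in>{..0::nat}. x) ` W False \<subseteq> ?P 0" using side(1) by (auto simp: inj_on_def split: if_splits)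
  moreover have "inj_on (\<lambda>x. \<lambda>i\<in>{..0::nat}. x) (W False)" by (auto simp: inj_on_def dest: fun_cong[of _ _ 0])
  moreover have "finite (?P 0)" using fin by (intro finite_subset[OF _ finite_PiE[of "{..0}" "\<lambda>_. W False \<union> W True"]]) auto
  ultimately show ?case using card_inj_on_le by fastforce
next
  case (Suc k)
  let ?n = "Suc k"
  have finP: "finite (?P j)" for j
    using fin by (intro finite_subset[OF _ finite_PiE[of "{..j}" "\<lambda>_. W False \<union> W True"]]) auto
  define Q where "Q \<phi> = nbrs G (\<phi> (par ?n)) \<inter> W (side ?n) - \<phi> ` {..k}" for \<phi>
  have par: "par ?n \<le> k" using par_less[of ?n] Suc.prems by simp
  have cardQ: "d (side ?n) \<le> card (Q \<phi>)" if "\<phi> \<in> ?P k" for \<phi>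
  proof -
    have "\<phi> (par ?n) \<in> W (side (par ?n))" using that par by simp
    then have "d (side ?n) + b \<le> card (nbrs G (\<phi> (par ?n)) \<inter> W (side ?n))"
      using nb side(2)[of ?n] Suc.prems by fastforce
    moreover have "card (\<phi> ` {..k}) \<le> b" using card_image_le[of "{..k}" \<phi>] Suc.prems by simp
    ultimately show ?thesis
      unfolding Q_def using diff_card_le_card_Diff[of "\<phi> ` {..k}" "nbrs G (\<phi> (par ?n)) \<inter> W (side ?n)"] by simp
  qed
  have "card (W False) * (\<Prod>i=1..?n. d (side i)) = (card (W False) * (\<Prod>i=1..k. d (side i))) * d (side ?n)"
    by simp
  also have "\<dots> \<le> card (?P k) * d (side ?n)" using Suc by (intro mult_right_mono) auto
  also have "\<dots> = (\<Sum>\<phi>\<in>?P k. d (side ?n))" by simp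
  also have "\<dots> \<le> (\<Sum>\<phi>\<in>?P k. card (Q \<phi>))" using cardQ by (intro sum_mono)
  also have "\<dots> = card (Sigma (?P k) Q)"
    using finP fin by (intro card_SigmaI[symmetric]) (auto simp: Q_def)
  also have "\<dots> \<le> card (?P ?n)"
  proof (rule card_inj_on_le[of "\<lambda>(\<phi>, y). \<phi>(?n := y)"])
    show "inj_on (\<lambda>(\<phi>, y). \<phi>(?n := y)) (Sigma (?P k) Q)"
    proof (rule inj_onI)
      fix p q assume pq: "p \<in> Sigma (?P k) Q" "q \<in> Sigma (?P k) Q"
        "(\<lambda>(\<phi>, y). \<phi>(?n := y)) p = (\<lambda>(\<phi>, y). \<phi>(?n := y)) q"
      obtain \<phi> y \<psi> z where e: "p = (\<phi>, y)" "q = (\<psi>, z)" by (cases p, cases q)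
      have eq: "\<phi>(?n := y) = \<psi>(?n := z)" using pq e by simp
      have "\<phi> \<in> {..k} \<rightarrow>\<^sub>E (W False \<union> W True)" "\<psi> \<in> {..k} \<rightarrow>\<^sub>E (W False \<union> W True)"
        using pq e by auto
      then have "\<phi> = \<psi>"
      proof (rule PiE_ext)
        fix i assume "i \<in> {..k}"
        then show "\<phi> i = \<psi> i" using fun_cong[OF eq, of i] by auto
      qed
      then show "p = q" using e fun_cong[OF eq, of ?n] by simp
    qed
    show "(\<lambda>(\<phi>, y). \<phi>(?n := y)) ` Sigma (?P k) Q \<subseteq> ?P ?n"
    proof (rule image_subsetI)
      fix p assume "p \<in> Sigma (?P k) Q"
      then obtain \<phi> y where p: "p = (\<phi>, y)" and \<phi>: "\<phi> \<in> ?P k" and y: "y \<in> Q \<phi>" by auto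
      let ?\<psi> = "\<phi>(?n := y)"
      have yW: "y \<in> W (side ?n)" "y \<notin> \<phi> ` {..k}" "{\<phi> (par ?n), y} \<in> edges G"
        using y by (auto simp: Q_def nbrs_def)
      have yW': "y \<in> W False \<union> W True" using yW(1) by (cases "side ?n") auto
      have pj: "par j \<le> k" if "j \<in> {1..?n}" for j using par_less[of j] that Suc.prems by auto
      have "?\<psi> \<in> {..?n} \<rightarrow>\<^sub>E (W False \<union> W True)"
        using \<phi> yW' by (auto simp: PiE_iff extensional_def)
      moreover have "inj_on ?\<psi> {..?n}"
      proof -
        have "inj_on \<phi> {..k}" using \<phi> by simp
        then have "inj_on ?\<psi> {..k}" by (rule inj_on_cong[THEN iffD1, rotated]) auto
        moreover have "y \<notin> ?\<psi> ` {..k}" using yW(2) by (auto simp: image_iff)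
        ultimately show ?thesis by (simp add: atMost_Suc)
      qed
      moreover have "\<forall>i\<le>?n. ?\<psi> i \<in> W (side i)" using \<phi> yW(1) by (auto simp: le_Suc_eq)
      moreover have "\<forall>i\<in>{1..?n}. {?\<psi> i, ?\<psi> (par i)} \<in> edges G"
      proof
        fix i assume i: "i \<in> {1..?n}"
        have "?\<psi> (par i) = \<phi> (par i)" using pj[OF i] by simp
        show "{?\<psi> i, ?\<psi> (par i)} \<in> edges G"
        proof (cases "i = ?n")
          case True
          then show ?thesis using yW(3) \<open>?\<psi> (par i) = \<phi> (par i)\<close> by (simp add: insert_commute)
        next
          case False
          then have "i \<in> {1..k}" using i by auto
          then have "{\<phi> i, \<phi> (par i)} \<in> edges G" using \<phi> by blast
          then show ?thesis using False \<open>?\<psi> (par i) = \<phi> (par i)\<close> by simp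
        qed
      qed
      ultimately show "(case p of (\<phi>, y) \<Rightarrow> \<phi>(?n := y)) \<in> ?P ?n"
        unfolding p prod.case mem_Collect_eq by (intro conjI)
    qed
  qed (rule finP)
  finally show ?case .
qed

text \<open>Pigeonhole on the restrictions of the embeddings to the roots: each root has only the
  vertices of its own side available.\<close>

lemma rich_if_many_embeddings:
  fixes G :: "'v graph" and W :: "bool \<Rightarrow> 'v set" and d :: "bool \<Rightarrow> nat"
  assumes side: "\<not> side 0" "\<And>i. 1 \<le> i \<Longrightarrow> i \<le> b \<Longrightarrow> side i = (\<not> side (par i))"
    and fin: "\<And>s. finite (W s)" and WG: "\<And>s. W s \<subseteq> verts G"
    and nb: "\<And>s x. x \<in> W s \<Longrightarrow> d (\<not> s) + b \<le> card (nbrs G x \<inter> W (\<not> s))"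
    and pos: "0 < card (W False) * (\<Prod>i=1..b. d (side i))"
    and many: "p * (\<Prod>v\<in>R. card (W (side v))) \<le> card (W False) * (\<Prod>i=1..b. d (side i))"
  shows "rich p G"
proof -
  define P where "P = {\<phi> \<in> {..b} \<rightarrow>\<^sub>E (W False \<union> W True). inj_on \<phi> {..b} \<and> (\<forall>i\<le>b. \<phi> i \<in> W (side i)) \<and>
            (\<forall>i\<in>{1..b}. {\<phi> i, \<phi> (par i)} \<in> edges G)}"
  have P: "card (W False) * (\<Prod>i=1..b. d (side i)) \<le> card P"
    unfolding P_def by (rule greedy_embeddings) (use side fin nb in auto)
  then have "card P > 0" using pos by linarith
  then have finP: "finite P" and neP: "P \<noteq> {}" using card_gt_0_iff by blast+
  define T where "T = PiE R (\<lambda>v. W (side v))"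
  have finT: "finite T" unfolding T_def using finite_R fin by (intro finite_PiE) auto
  have cardT: "card T = (\<Prod>v\<in>R. card (W (side v)))" unfolding T_def by (rule card_PiE[OF finite_R])
  define rt where "rt \<phi> = restrict \<phi> R" for \<phi> :: "nat \<Rightarrow> 'v"
  have rt: "rt \<phi> \<in> T" if "\<phi> \<in> P" for \<phi> using that R_subset by (auto simp: rt_def T_def P_def)
  have "\<exists>\<tau>\<in>T. p \<le> card {\<phi> \<in> P. rt \<phi> = \<tau>}"
  proof (rule ccontr)
    assume "\<not> ?thesis"
    then have lt: "card {\<phi> \<in> P. rt \<phi> = \<tau>} < p" if "\<tau> \<in> T" for \<tau> using that by force
    have neT: "T \<noteq> {}" using rt neP by blast
    have "card P = (\<Sum>\<tau>\<in>T. card {\<phi> \<in> P. rt \<phi> = \<tau>})"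
    proof -
      have "P = (\<Union>\<tau>\<in>T. {\<phi> \<in> P. rt \<phi> = \<tau>})" using rt by blast
      moreover have "card (\<Union>\<tau>\<in>T. {\<phi> \<in> P. rt \<phi> = \<tau>}) = (\<Sum>\<tau>\<in>T. card {\<phi> \<in> P. rt \<phi> = \<tau>})"
        using finP finT by (intro card_UN_disjoint) auto
      ultimately show ?thesis by simp
    qed
    also have "\<dots> < (\<Sum>\<tau>\<in>T. p)" by (rule sum_strict_mono[OF finT neT lt])
    also have "\<dots> = p * (\<Prod>v\<in>R. card (W (side v)))" by (simp add: cardT)
    finally show False using many P by linarith
  qed
  then obtain \<tau> where \<tau>: "p \<le> card {\<phi> \<in> P. rt \<phi> = \<tau>}" by blast
  obtain \<Phi> where \<Phi>: "\<Phi> \<subseteq> {\<phi> \<in> P. rt \<phi> = \<tau>}" "card \<Phi> = p" "finite \<Phi>"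
    using obtain_subset_with_card_n[OF \<tau>] by blast
  have "P \<subseteq> tree_embeddings G"
    using WG[of False] WG[of True] by (auto simp: P_def tree_embeddings_def edge_image_def PiE_iff)
  then have "\<Phi> \<subseteq> tree_embeddings G" using \<Phi>(1) by blast
  moreover have "\<phi> v = \<tau> v" if "\<phi> \<in> \<Phi>" "v \<in> R" for \<phi> v
  proof -
    have "rt \<phi> = \<tau>" using \<Phi>(1) that by blast
    then have "rt \<phi> v = \<tau> v" by simp
    then show ?thesis using that by (simp add: rt_def)
  qed
  ultimately show ?thesis unfolding rich_def using \<Phi>(2,3) by blast
qed

end

text \<open>Maximising \<open>4 * n * e(A', B') - n * s * |A'| - |A| * s * |B'|\<close> leaves a pair in which no vertex has
  too few neighbours on the other side.\<close>

lemma min_degree_pair: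
  fixes E :: "('u \<times> 'v) set"
  assumes A: "finite A" and V: "finite V" "card V = n"
    and deg: "\<And>x. x \<in> A \<Longrightarrow> card {y \<in> V. (x, y) \<in> E} = s"
  shows "\<exists>A'\<subseteq>A. \<exists>B'\<subseteq>V. card A * s * n \<le> 2 * n * s * card A' \<and>
           (\<forall>x\<in>A'. n * s \<le> 4 * n * card {y \<in> B'. (x, y) \<in> E}) \<and>
           (\<forall>y\<in>B'. card A * s \<le> 4 * n * card {x \<in> A'. (x, y) \<in> E})"
proof -
  define m where "m = card A"
  define e where "e A' B' = (\<Sum>x\<in>A'. card {y \<in> B'. (x, y) \<in> E})" for A' B'
  define w where "w p = 4 * int n * int (e (fst p) (snd p)) - int (n * s * card (fst p)) - int (m * s * card (snd p))"
    for p :: "'u set \<times> 'v set"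
  let ?S = "Pow A \<times> Pow V"
  have finS: "finite ?S" using A V by simp
  have "Max (w ` ?S) \<in> w ` ?S" using finS by (intro Max_in) auto
  then obtain p where p: "p \<in> ?S" "Max (w ` ?S) = w p" by blast
  obtain A' B' where AB: "p = (A', B')" by (cases p)
  have A': "A' \<subseteq> A" "finite A'" and B': "B' \<subseteq> V" "finite B'"
    using p AB A V finite_subset by auto
  have max: "w q \<le> w (A', B')" if "q \<in> ?S" for q
  proof -
    have "w q \<le> Max (w ` ?S)" using finS that by (intro Max_ge) auto
    then show ?thesis using p(2) AB by simp
  qed
  have e2: "e A' B' = (\<Sum>y\<in>B'. card {x \<in> A'. (x, y) \<in> E})" if "finite A'" "finite B'" for A' B'
  proof -
    have "e A' B' = card (SIGMA x:A'. {y \<in> B'. (x, y) \<in> E})"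
      unfolding e_def using that by (intro card_SigmaI[symmetric]) auto
    also have "\<dots> = card (SIGMA y:B'. {x \<in> A'. (x, y) \<in> E})"
      by (rule bij_betw_same_card[of prod.swap]) (auto intro!: bij_betw_imageI simp: inj_on_def image_iff)
    also have "\<dots> = (\<Sum>y\<in>B'. card {x \<in> A'. (x, y) \<in> E})"
      using that by (intro card_SigmaI) auto
    finally show ?thesis .
  qed
  \<comment> \<open>The full pair has weight 4 n m s - n s m - m s n = 2 n m s. As each vertex of
    \<open>A'\<close> has at most s partners, this lower bound for the maximum forces
    \<open>A'\<close> to contain at least half of \<open>A\<close>.\<close>
  have "e A V = m * s" by (simp add: e_def deg m_def)
  then have "w (A, V) = 2 * int n * int m * int s" by (simp add: w_def V m_def[symmetric] algebra_simps)
  then have top: "2 * int n * int m * int s \<le> w (A', B')" using max[of "(A, V)"] by simp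
  have "e A' B' \<le> (\<Sum>x\<in>A'. s)" unfolding e_def
  proof (rule sum_mono)
    fix x assume "x \<in> A'"
    moreover have "card {y \<in> B'. (x, y) \<in> E} \<le> card {y \<in> V. (x, y) \<in> E}"
      using B' V by (intro card_mono) auto
    ultimately show "card {y \<in> B'. (x, y) \<in> E} \<le> s" using deg A' by auto
  qed
  then have "e A' B' \<le> s * card A'" by (simp add: mult.commute)
  then have "int (e A' B') \<le> int (s * card A')" by (simp only: of_nat_le_iff)
  then have "4 * int n * int (e A' B') \<le> 4 * int n * int (s * card A')"
    by (rule mult_left_mono) simp
  moreover have "w (A', B') \<le> 4 * int n * int (e A' B')"
    unfolding w_def fst_conv snd_conv
    using of_nat_0_le_iff[of "n * s * card A'", where 'a = int] of_nat_0_le_iff[of "m * s * card B'", where 'a = int]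
    by linarith
  ultimately have "2 * int n * int m * int s \<le> 4 * int n * int (s * card A')" using top by linarith
  then have "int (m * s * n) \<le> int (2 * n * s * card A')" by (simp add: algebra_simps)
  then have c1: "m * s * n \<le> 2 * n * s * card A'" by (simp only: of_nat_le_iff)
  have c2: "n * s \<le> 4 * n * card {y \<in> B'. (x, y) \<in> E}" if x: "x \<in> A'" for x
  proof -
    have "w (A' - {x}, B') \<le> w (A', B')" using A' B' by (intro max) auto
    moreover have "e A' B' = card {y \<in> B'. (x, y) \<in> E} + e (A' - {x}) B'"
      unfolding e_def by (rule sum.remove[OF A'(2) x])
    moreover have "card A' = card (A' - {x}) + 1" using A' x by (metis Suc_eq_plus1 card.remove)
    ultimately have "int (n * s) \<le> int (4 * n * card {y \<in> B'. (x, y) \<in> E})"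
      by (simp add: w_def algebra_simps)
    then show ?thesis by (simp only: of_nat_le_iff)
  qed
  have c3: "m * s \<le> 4 * n * card {x \<in> A'. (x, y) \<in> E}" if y: "y \<in> B'" for y
  proof -
    have "w (A', B' - {y}) \<le> w (A', B')" using A' B' by (intro max) auto
    moreover have "e A' B' = card {x \<in> A'. (x, y) \<in> E} + e A' (B' - {y})"
      unfolding e2[OF A'(2) B'(2)] e2[OF A'(2) finite_Diff[OF B'(2)]] by (rule sum.remove[OF B'(2) y])
    moreover have "card B' = card (B' - {y}) + 1" using B' y by (metis Suc_eq_plus1 card.remove)
    ultimately have "int (m * s) \<le> int (4 * n * card {x \<in> A'. (x, y) \<in> E})"
      by (simp add: w_def algebra_simps)
    then show ?thesis by (simp only: of_nat_le_iff)
  qed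
  show ?thesis using A' B' c1 c2 c3 unfolding m_def by blast
qed

section \<open>The tail of the degree sequence and power sums of degrees\<close>

context rooted_tree
begin

text \<open>Each of the b greedy choices loses a factor 16: 4 for passing to the pair, 2 for the
  reserve of b vertices, 2 for rounding down. A further 2 pays for keeping only half of the vertices
  of large degree, and 16 b makes the degrees large enough for these losses to suffice.\<close>

definition tail_const :: "nat \<Rightarrow> real" where
  "tail_const p = 2 * 16 ^ b * real p + 16 * real b"

text \<open>With u = (s / n)^(b / a), so that u^a = (s / n)^b, the number of greedy embeddings
  divided by the number of root placements is, up to constants, at least (m u)^i (n u)^j, where i
  and j count the non-roots on the two sides and i + j = a. If the claim failed, m u and n u would
  both exceed \<open>tail_const p\<close>, and some placement of the roots would carry p
  embeddings.\<close>

lemma degree_tail: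
  fixes G :: "'v graph"
  assumes G: "simple_graph G" and p: "\<not> rich p G" "1 \<le> p" and s: "1 \<le> s"
  defines "n \<equiv> card (verts G)" and "m \<equiv> card {v \<in> verts G. s \<le> deg G v}"
  shows "real m * (real s / real n) powr (real b / real a) \<le> tail_const p"
proof (rule ccontr)
  define u where "u = (real s / real n) powr (real b / real a)"
  define A where "A = {v \<in> verts G. s \<le> deg G v}"
  let ?C = "tail_const p"
  assume "\<not> ?thesis"
  then have mu: "?C < real m * u" by (simp add: u_def)
  have C: "2 * 16 ^ b * real p \<le> ?C" "16 * real b \<le> ?C" "1 \<le> ?C"
    using p b_pos by (auto simp: tail_const_def intro: order.trans[of 1 "16 * real b"])
  have m: "0 < m"
  proof (rule ccontr)
    assume "\<not> 0 < m"
    then show False using mu C by simp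
  qed
  have finA: "finite A" using finite_verts[OF G] by (simp add: A_def)
  have mA: "m = card A" by (simp add: m_def A_def)
  then obtain x0 where "x0 \<in> A" using m finA by (metis card_gt_0_iff ex_in_conv)
  then have sn: "s \<le> n" using deg_le[OF G, of x0] by (simp add: A_def n_def)
  have mn: "m \<le> n" unfolding m_def n_def using finite_verts[OF G] by (intro card_mono) auto
  have n: "0 < n" using sn s by simp
  have ratio: "0 < real s / real n" "real s / real n \<le> 1" using s sn n by auto
  have u: "0 < u" using s n by (simp add: u_def)
  have ua: "u ^ a = (real s / real n) ^ b"
  proof -
    have "u ^ a = u powr real a" using u by (simp add: powr_realpow)
    also have "\<dots> = (real s / real n) powr real b" using a_pos by (simp add: u_def powr_powr)
    also have "\<dots> = (real s / real n) ^ b" using ratio(1) by (rule powr_realpow)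
    finally show ?thesis .
  qed
  have u_le: "u \<le> real s / real n"
  proof -
    have "u \<le> (real s / real n) powr 1"
      unfolding u_def using ratio a_pos a_le_b by (intro powr_mono') auto
    then show ?thesis using ratio by simp
  qed
  have nu: "?C < real n * u" using mu mn u by (smt (verit) mult_right_mono of_nat_le_iff)
  have s_big: "?C < real s"
  proof -
    have "real n * u \<le> real n * (real s / real n)" using u_le by (intro mult_left_mono) auto
    then show ?thesis using nu n by simp
  qed
  have ms_big: "?C * real n < real m * real s"
  proof -
    have "real m * u \<le> real m * (real s / real n)" using u_le by (intro mult_left_mono) auto
    then have "?C < real m * real s / real n" using mu by simp
    then show ?thesis using n by (simp add: pos_less_divide_eq)
  qed
  have "\<exists>Nb. Nb \<subseteq> nbrs G x \<and> card Nb = s" if "x \<in> A" for x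
    using that obtain_subset_with_card_n[of s "nbrs G x"] unfolding A_def by blast
  then obtain Nb where Nb: "\<And>x. x \<in> A \<Longrightarrow> Nb x \<subseteq> nbrs G x \<and> card (Nb x) = s" by metis
  define E where "E = {(x, y). x \<in> A \<and> y \<in> Nb x}"
  have degE: "card {y \<in> verts G. (x, y) \<in> E} = s" if x: "x \<in> A" for x
  proof -
    have "{y \<in> verts G. (x, y) \<in> E} = Nb x" using x Nb[OF x] nbrs_subset[OF G, of x] by (auto simp: E_def)
    then show ?thesis using Nb[OF x] by simp
  qed
  obtain A' B' where AB: "A' \<subseteq> A" "B' \<subseteq> verts G" "card A * s * n \<le> 2 * n * s * card A'"
    "\<And>x. x \<in> A' \<Longrightarrow> n * s \<le> 4 * n * card {y \<in> B'. (x, y) \<in> E}"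
    "\<And>y. y \<in> B' \<Longrightarrow> card A * s \<le> 4 * n * card {x \<in> A'. (x, y) \<in> E}"
    using min_degree_pair[OF finA finite_verts[OF G] n_def[THEN meta_eq_to_obj_eq, symmetric] degE] by blast
  have finAB: "finite A'" "finite B'" using AB finA finite_verts[OF G] finite_subset by blast+
  have A'm: "m \<le> 2 * card A'"
  proof -
    have "n * s * m \<le> n * s * (2 * card A')" using AB(3) by (simp add: mA mult_ac)
    then show ?thesis using n s by simp
  qed
  obtain side :: "nat \<Rightarrow> bool" where side: "\<not> side 0"
    "\<And>i. 1 \<le> i \<Longrightarrow> i \<le> b \<Longrightarrow> side i = (\<not> side (par i))"
    using side_exists by blast
  \<comment> \<open>Vertex 0 goes into \<open>A'\<close>. The minimum degrees in the pair are s / 4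
    and m s / (4 n); \<open>d\<close> takes half of each, rounded down, and the other half covers
    the reserve b.\<close>
  define W where "W t = (if t then B' else A')" for t
  define d where "d t = (if t then s div 8 else (m * s) div (8 * n))" for t
  have dT: "real s / 16 \<le> real (d True)" "d True + b \<le> k" if "n * s \<le> 4 * n * k" for k
  proof -
    have "s < 8 * (s div 8) + 8" by presburger
    then have "real s < real (8 * (s div 8) + 8)" by (simp only: of_nat_less_iff)
    then have eq: "real (s div 8) \<ge> real s / 8 - 1" by simp
    then show "real s / 16 \<le> real (d True)" using s_big C(2) b_pos by (simp add: d_def)
    have "s \<le> 4 * k" using that n by simp
    moreover have "8 * (s div 8) \<le> s" by simp
    moreover have "16 * b \<le> s" using s_big C(2) by linarith
    ultimately show "d True + b \<le> k" by (simp add: d_def)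
  qed
  have dF: "real m * real s / (16 * real n) \<le> real (d False)" "d False + b \<le> k" if "m * s \<le> 4 * n * k" for k
  proof -
    have big: "16 * b * n \<le> m * s"
    proof -
      have "16 * real b * real n \<le> ?C * real n" using C by (intro mult_right_mono) auto
      then have "real (16 * b * n) \<le> real (m * s)" using ms_big by simp
      then show ?thesis by (simp only: of_nat_le_iff)
    qed
    define D where "D = (m * s) div (8 * n)"
    have dD: "d False = D" by (simp add: d_def D_def)
    have D1: "8 * n * D \<le> m * s" by (simp add: D_def)
    have D2: "m * s < 8 * n * D + 8 * n" using n by (simp add: D_def) (metis dividend_less_times_div mult_pos_pos zero_less_numeral add.commute mult_Suc_right)
    have "n * 16 \<le> 16 * b * n" using b_pos by simp
    then have "m * s \<le> 16 * n * D" using D2 big by linarith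
    then have "real (m * s) \<le> real (16 * n * D)" by (simp only: of_nat_le_iff)
    then show "real m * real s / (16 * real n) \<le> real (d False)"
      using n by (simp add: dD field_simps)
    have "8 * n * (D + b) \<le> 8 * n * k"
      using D1 that big by (simp add: algebra_simps)
    then show "d False + b \<le> k" using n by (simp add: dD)
  qed
  have nb: "d (\<not> t) + b \<le> card (nbrs G x \<inter> W (\<not> t))" if x: "x \<in> W t" for t x
  proof (cases t)
    case True
    then have xB: "x \<in> B'" using x by (simp add: W_def)
    have "{z \<in> A'. (z, x) \<in> E} \<subseteq> nbrs G x \<inter> A'"
    proof
      fix z assume "z \<in> {z \<in> A'. (z, x) \<in> E}"
      then have z: "z \<in> A'" "z \<in> A" "x \<in> Nb z" by (auto simp: E_def)
      then have "x \<in> nbrs G z" using Nb by blast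
      then show "z \<in> nbrs G x \<inter> A'" using z nbrs_sym[of x G z] by blast
    qed
    then have "card {z \<in> A'. (z, x) \<in> E} \<le> card (nbrs G x \<inter> A')" using finAB by (intro card_mono) auto
    then show ?thesis using dF(2)[of "card {z \<in> A'. (z, x) \<in> E}"] AB(5)[OF xB] True by (simp add: W_def mA)
  next
    case False
    then have xA: "x \<in> A'" using x by (simp add: W_def)
    have "{z \<in> B'. (x, z) \<in> E} \<subseteq> nbrs G x \<inter> B'"
      using Nb[of x] AB(1) xA unfolding E_def by blast
    then have "card {z \<in> B'. (x, z) \<in> E} \<le> card (nbrs G x \<inter> B')" using finAB by (intro card_mono) auto
    then show ?thesis using dT(2)[of "card {z \<in> B'. (x, z) \<in> E}"] AB(4)[OF xA] False by (simp add: W_def)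
  qed
  have dT': "real s / 16 \<le> real (d True)" by (rule dT(1)[of s]) simp
  have dF': "real m * real s / (16 * real n) \<le> real (d False)"
  proof (rule dF(1))
    show "m * s \<le> 4 * n * (m * s)" using n by simp
  qed
  define vT vF rT rF where "vT = card {i \<in> {..b}. side i}" and "vF = card {i \<in> {..b}. \<not> side i}"
    and "rT = card {i \<in> R. side i}" and "rF = card {i \<in> R. \<not> side i}"
  have v: "vT + vF = b + 1"
  proof -
    have "{..b} = {i \<in> {..b}. side i} \<union> {i \<in> {..b}. \<not> side i}" by auto
    then have "card {..b} = vT + vF" unfolding vT_def vF_def
      by (metis (no_types, lifting) card_Un_disjoint disjoint_iff finite_Collect_conjI finite_atMost mem_Collect_eq finite_Un)
    then show ?thesis by simp
  qed
  have r: "rT + rF + a = b + 1"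
  proof -
    have "R = {i \<in> R. side i} \<union> {i \<in> R. \<not> side i}" by auto
    then have "card R = card ({i \<in> R. side i} \<union> {i \<in> R. \<not> side i})" by simp
    also have "\<dots> = rT + rF" unfolding rT_def rF_def using finite_R by (intro card_Un_disjoint) auto
    finally show ?thesis using card_R by simp
  qed
  have rv: "rT \<le> vT" "rF \<le> vF"
    unfolding rT_def vT_def rF_def vF_def using R_subset by (intro card_mono; auto)+
  have "vF \<ge> 1" unfolding vF_def using side(1) by (auto simp: Suc_le_eq card_gt_0_iff)
  define lo where "lo t = (if t then real s / 16 else real m * real s / (16 * real n))" for t
  \<comment> \<open>Vertex 0 is not reached through an edge, so its side contributes vF - 1 factors
    here; its own choices are counted by the separate factor m / 2.\<close>
  have prodlo: "(\<Prod>i=1..b. lo (side i)) = (real s / 16) ^ vT * (real m * real s / (16 * real n)) ^ (vF - 1)"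
  proof -
    have "(\<Prod>i=1..b. lo (side i)) = (\<Prod>i\<in>{i \<in> {1..b}. side i}. lo (side i)) * (\<Prod>i\<in>{i \<in> {1..b}. \<not> side i}. lo (side i))"
      by (subst prod.union_disjoint[symmetric]) (auto intro!: prod.cong)
    also have "(\<Prod>i\<in>{i \<in> {1..b}. side i}. lo (side i)) = (real s / 16) ^ card {i \<in> {1..b}. side i}"
      by (simp add: lo_def)
    also have "{i \<in> {1..b}. side i} = {i \<in> {..b}. side i}" using side(1) by (auto simp: Suc_le_eq intro!: Suc_leI gr0I)
    also have "(\<Prod>i\<in>{i \<in> {1..b}. \<not> side i}. lo (side i)) = (real m * real s / (16 * real n)) ^ card {i \<in> {1..b}. \<not> side i}"
      by (simp add: lo_def)
    also have "{i \<in> {1..b}. \<not> side i} = {i \<in> {..b}. \<not> side i} - {0}" by (auto simp: Suc_le_eq)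
    also have "card ({i \<in> {..b}. \<not> side i} - {0}) = vF - 1" using side(1) by (simp add: vF_def)
    finally show ?thesis by (simp add: vT_def)
  qed
  have lo_pos: "0 < lo t" for t using s m n by (auto simp: lo_def)
  have lo_d: "lo t \<le> real (d t)" for t using dT' dF' by (cases t) (auto simp: lo_def)
  have "(\<Prod>i=1..b. lo (side i)) \<le> (\<Prod>i=1..b. real (d (side i)))"
    using lo_d lo_pos by (intro prod_mono) (auto intro: less_imp_le)
  then have emb_ge: "real m / 2 * ((real s / 16) ^ vT * (real m * real s / (16 * real n)) ^ (vF - 1))
      \<le> real (card (W False) * (\<Prod>i=1..b. d (side i)))"
    unfolding prodlo of_nat_mult of_nat_prod using A'm
    by (intro mult_mono) (auto simp: W_def intro!: mult_nonneg_nonneg)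
  have key: "real p * (real m ^ rF * real n ^ rT)
      \<le> real m / 2 * ((real s / 16) ^ vT * (real m * real s / (16 * real n)) ^ (vF - 1))"
  proof -
    have "(real s / 16) ^ vT * (real m * real s / (16 * real n)) ^ (vF - 1)
        = real s ^ (vT + (vF - 1)) * real m ^ (vF - 1) / (16 ^ (vT + (vF - 1)) * real n ^ (vF - 1))"
      by (simp add: power_add power_mult_distrib power_divide mult_ac)
    also have "vT + (vF - 1) = b" using v \<open>vF \<ge> 1\<close> by simp
    also have "real s ^ b = u ^ a * real n ^ b" using ua n by (simp add: power_divide)
    also have "real n ^ b = real n ^ vT * real n ^ (vF - 1)"
      using v \<open>vF \<ge> 1\<close> by (simp flip: power_add)
    finally have 1: "(real s / 16) ^ vT * (real m * real s / (16 * real n)) ^ (vF - 1)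
        = u ^ a * real n ^ vT * real m ^ (vF - 1) / 16 ^ b" using n by simp
    have 2: "real m * real m ^ (vF - 1) = real m ^ vF" using \<open>vF \<ge> 1\<close> by (simp flip: power_Suc)
    have a_eq: "a = (vF - rF) + (vT - rT)" using v r rv by simp
    have "?C \<le> ?C ^ a" using C(3) a_pos by (intro self_le_power) auto
    also have "\<dots> = ?C ^ (vF - rF) * ?C ^ (vT - rT)" by (subst a_eq) (rule power_add)
    also have "\<dots> \<le> (real m * u) ^ (vF - rF) * (real n * u) ^ (vT - rT)"
      using mu nu C by (intro mult_mono power_mono) auto
    finally have "?C * (real m ^ rF * real n ^ rT) \<le> (real m * u) ^ (vF - rF) * (real n * u) ^ (vT - rT) * (real m ^ rF * real n ^ rT)"
      by (intro mult_right_mono) auto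
    also have "\<dots> = u ^ ((vF - rF) + (vT - rT)) * (real m ^ ((vF - rF) + rF)) * (real n ^ ((vT - rT) + rT))"
      by (simp only: power_mult_distrib power_add mult_ac)
    also have "\<dots> = u ^ a * real m ^ vF * real n ^ vT" using a_eq rv by simp
    finally have 3: "?C * (real m ^ rF * real n ^ rT) \<le> u ^ a * real m ^ vF * real n ^ vT" .
    have "2 * 16 ^ b * real p * (real m ^ rF * real n ^ rT) \<le> ?C * (real m ^ rF * real n ^ rT)"
      using C(1) by (intro mult_right_mono) auto
    with 3 have "2 * 16 ^ b * real p * (real m ^ rF * real n ^ rT) \<le> u ^ a * real m ^ vF * real n ^ vT" by linarith
    then have "real p * (real m ^ rF * real n ^ rT) \<le> u ^ a * real m ^ vF * real n ^ vT / (2 * 16 ^ b)"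
      by (simp add: field_simps)
    also have "\<dots> = real m / 2 * (u ^ a * real n ^ vT * real m ^ (vF - 1) / 16 ^ b)"
      unfolding 2[symmetric] by simp
    finally show ?thesis unfolding 1 .
  qed
  have roots: "real (\<Prod>v\<in>R. card (W (side v))) \<le> real m ^ rF * real n ^ rT"
  proof -
    have "(\<Prod>v\<in>R. card (W (side v))) \<le> (\<Prod>v\<in>R. if side v then n else m)"
    proof (rule prod_mono)
      fix v
      have "card A' \<le> m" "card B' \<le> n"
        unfolding mA n_def using AB finA finite_verts[OF G] by (auto intro: card_mono)
      then show "0 \<le> card (W (side v)) \<and> card (W (side v)) \<le> (if side v then n else m)"
        by (simp add: W_def)
    qed
    also have "\<dots> = n ^ rT * m ^ rF"
      using finite_R by (simp add: prod.If_cases rT_def rF_def Int_def)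
    finally have "real (\<Prod>v\<in>R. card (W (side v))) \<le> real (n ^ rT * m ^ rF)" by (simp only: of_nat_le_iff)
    then show ?thesis by (simp add: mult.commute)
  qed
  have many: "p * (\<Prod>v\<in>R. card (W (side v))) \<le> card (W False) * (\<Prod>i=1..b. d (side i))"
  proof -
    have "real p * real (\<Prod>v\<in>R. card (W (side v))) \<le> real p * (real m ^ rF * real n ^ rT)"
      using roots by (intro mult_left_mono) auto
    then have "real (p * (\<Prod>v\<in>R. card (W (side v)))) \<le> real (card (W False) * (\<Prod>i=1..b. d (side i)))"
      using key emb_ge by simp
    then show ?thesis by (simp only: of_nat_le_iff)
  qed
  have "0 < real p * (real m ^ rF * real n ^ rT)" using p m n by simp
  then have "0 < real (card (W False) * (\<Prod>i=1..b. d (side i)))" using key emb_ge by linarith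
  then have pos: "0 < card (W False) * (\<Prod>i=1..b. d (side i))" by (simp only: of_nat_0_less_iff)
  have "rich p G"
  proof (rule rich_if_many_embeddings[of side W G d p])
    show "finite (W t)" for t using finAB by (simp add: W_def)
    show "W t \<subseteq> verts G" for t using AB by (auto simp: W_def A_def)
  qed (use side nb pos many in auto)
  then show False using p by simp
qed

text \<open>If k vertices have degree at least that of x, \<open>degree_tail\<close> gives (deg x /
  n)^(b/a) <= C / k with C = \<open>tail_const p\<close>. Raising this to the power \<theta> yields
  (deg x)^t <= n^t C^\<theta> k^(-\<theta>), and these bounds are summed over the ranks.\<close>

lemma sum_deg_le:
  fixes G :: "'v graph" and t :: nat
  assumes G: "simple_graph G" and p: "\<not> rich p G" "1 \<le> p" and t: "1 \<le> t" "t * a < b"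
  defines "n \<equiv> card (verts G)" and "\<theta> \<equiv> real t * real a / real b"
  shows "(\<Sum>v\<in>verts G. real (deg G v) ^ t) \<le> tail_const p powr \<theta> / (1 - \<theta>) * real n powr (real t + 1 - \<theta>)"
proof (cases "n = 0")
  case True
  then have "verts G = {}" using finite_verts[OF G] by (simp add: n_def)
  then show ?thesis by (simp add: n_def)
next
  case False
  have \<theta>: "0 \<le> \<theta>" "\<theta> < 1"
  proof -
    have "real (t * a) < real b" using t by (simp only: of_nat_less_iff)
    then show "\<theta> < 1" using b_pos by (simp add: \<theta>_def pos_divide_less_eq)
  qed (simp add: \<theta>_def)
  define h where "h k = real n ^ t * tail_const p powr \<theta> * real k powr (- \<theta>)" for k
  have Cpos: "0 < tail_const p" using b_pos by (simp add: tail_const_def add_nonneg_pos)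
  have "(\<Sum>v\<in>verts G. real (deg G v) ^ t) \<le> (\<Sum>k=1..card (verts G). h k)"
  proof (rule sum_rank_le)
    fix j k :: nat assume "1 \<le> j" "j \<le> k"
    then show "h k \<le> h j" unfolding h_def using \<theta> Cpos by (intro mult_left_mono powr_mono2') auto
  next
    fix x assume x: "x \<in> verts G"
    define s where "s = deg G x"
    define k where "k = card {y \<in> verts G. s \<le> deg G y}"
    have eq: "{y \<in> verts G. real (deg G x) ^ t \<le> real (deg G y) ^ t} = {y \<in> verts G. s \<le> deg G y}"
      using t by (auto simp: s_def power_mono_iff)
    have k: "1 \<le> k" unfolding k_def using x finite_verts[OF G] by (auto simp: s_def Suc_le_eq card_gt_0_iff)
    have "real s ^ t \<le> h k"
    proof (cases "s = 0")
      case True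
      then show ?thesis using t Cpos by (simp add: h_def power_0_left)
    next
      case s: False
      have "real k * (real s / real n) powr (real b / real a) \<le> tail_const p"
        unfolding k_def n_def using s by (intro degree_tail[OF G p]) simp
      then have "(real s / real n) powr (real b / real a) \<le> tail_const p / real k"
        using k by (simp add: field_simps)
      then have "((real s / real n) powr (real b / real a)) powr \<theta> \<le> (tail_const p / real k) powr \<theta>"
        using \<theta> by (intro powr_mono2) auto
      also have "((real s / real n) powr (real b / real a)) powr \<theta> = (real s / real n) ^ t"
        using s False a_pos b_pos by (simp add: powr_powr \<theta>_def flip: powr_realpow)
      also have "(tail_const p / real k) powr \<theta> = tail_const p powr \<theta> * real k powr (- \<theta>)"
        using k Cpos by (subst powr_divide) (simp_all add: powr_minus divide_inverse)
      finally have "(real s / real n) ^ t \<le> tail_const p powr \<theta> * real k powr (- \<theta>)" .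
      then have "real n ^ t * (real s / real n) ^ t \<le> real n ^ t * (tail_const p powr \<theta> * real k powr (- \<theta>))"
        by (intro mult_left_mono) auto
      then show ?thesis using False by (simp add: h_def power_divide mult.assoc)
    qed
    then show "real (deg G x) ^ t \<le> h (card {y \<in> verts G. real (deg G x) ^ t \<le> real (deg G y) ^ t})"
      unfolding eq by (simp add: s_def[symmetric] k_def)
  qed (rule finite_verts[OF G])
  also have "(\<Sum>k=1..card (verts G). h k) = real n ^ t * tail_const p powr \<theta> * (\<Sum>k=1..n. real k powr (- \<theta>))"
    unfolding h_def n_def by (rule sum_distrib_left[symmetric])
  also have "\<dots> \<le> real n ^ t * tail_const p powr \<theta> * (real n powr (1 - \<theta>) / (1 - \<theta>))"
    by (intro mult_left_mono sum_powr_le \<theta>) auto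
  also have "real n ^ t = real n powr real t" using False by (simp add: powr_realpow)
  also have "real n powr real t * tail_const p powr \<theta> * (real n powr (1 - \<theta>) / (1 - \<theta>))
      = tail_const p powr \<theta> / (1 - \<theta>) * (real n powr real t * real n powr (1 - \<theta>))" by simp
  also have "real n powr real t * real n powr (1 - \<theta>) = real n powr (real t + 1 - \<theta>)"
    by (simp add: powr_add[symmetric] add_diff_eq)
  finally show ?thesis .
qed

end

section \<open>Realizing the exponents between \<open>t\<close> and \<open>t + 1\<close>\<close>

lemma ex_real_le:
  assumes "\<And>G :: nat graph. simple_graph G \<Longrightarrow> card (verts G) = n \<Longrightarrow> free_of \<F> G \<Longrightarrow> real (card (copies H G)) \<le> B"
    and "0 \<le> B"
  shows "real (ex n H \<F>) \<le> B"
proof -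
  have "ex n H \<F> \<le> nat \<lfloor>B\<rfloor>"
    using assms by (intro ex_le) (simp add: le_nat_floor)
  then have "real (ex n H \<F>) \<le> real (nat \<lfloor>B\<rfloor>)" by (simp only: of_nat_le_iff)
  also have "\<dots> \<le> B" using assms(2) by simp
  finally show ?thesis .
qed

lemma choose_le_power: "1 \<le> t \<Longrightarrow> n choose t \<le> n ^ t"
  by (cases "t \<le> n") (simp_all add: binomial_le_pow binomial_eq_0)

lemma choose_ge_power:
  assumes "1 \<le> t" "t \<le> n" shows "(real n / real t) ^ t \<le> real (n choose t)"
  using binomial_ge_n_over_k_pow_k[OF assms(2), where 'a = real] by simp

text \<open>Isolated vertices pad the algebraic graph to any prescribed number of vertices.\<close>

lemma (in rooted_tree) lower_bound_graph:
  fixes F :: "'k::char2_field set"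
  assumes F: "finite F" "0 \<in> F" "1 \<in> F" "\<And>u v. u \<in> F \<Longrightarrow> v \<in> F \<Longrightarrow> u + v \<in> F \<and> u * v \<in> F"
    and c: "\<And>p. c p \<in> F" and not_rich: "\<not> rich p (alg_graph a b J M c F)"
    and n: "2 * card F ^ b \<le> n" and t: "1 \<le> t"
  shows "card F ^ b * ((card F ^ (b - a)) choose t) \<le> ex n (star t) (forbidden p)"
proof -
  let ?A = "alg_graph a b J M c F"
  have sA: "simple_graph ?A" by (rule simple_alg_graph[OF F(1)])
  have "card (verts ?A) \<le> card {..<n}" using n by (simp add: card_verts_alg_graph)
  then obtain h where h: "h ` verts ?A \<subseteq> {..<n}" "inj_on h (verts ?A)"
    using card_le_inj[OF finite_verts[OF sA]] by blast
  define G where "G = ({..<n}, (\<lambda>e. h ` e) ` edges ?A)"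
  have subA: "e \<subseteq> verts ?A" if "e \<in> edges ?A" for e using simple_graph_edge(1)[OF sA that] .
  have sG: "simple_graph G" unfolding simple_graph_def
  proof (intro conjI ballI)
    fix e assume "e \<in> edges G"
    then obtain e' where e': "e' \<in> edges ?A" "e = h ` e'" by (auto simp: G_def)
    show "e \<subseteq> verts G" using e' subA[OF e'(1)] h(1) by (auto simp: G_def)
    show "card e = 2"
      using e' simple_graph_edge(2)[OF sA e'(1)] card_image[OF inj_on_subset[OF h(2) subA[OF e'(1)]]] by simp
  qed (simp add: G_def)
  have "\<not> rich p G"
  proof
    assume "rich p G"
    moreover have "\<Union>(edges G) \<subseteq> h ` verts ?A" using subA by (auto simp: G_def)
    ultimately have "rich p (h ` verts ?A, edges G)" by (rule rich_restrict)
    moreover have "contains (h ` verts ?A, edges G) ?A" unfolding contains_def fst_conv snd_conv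
    proof (intro exI conjI ballI)
      let ?k = "inv_into (verts ?A) h"
      show "inj_on ?k (h ` verts ?A)" by (rule inj_on_inv_into) simp
      show "?k ` h ` verts ?A \<subseteq> verts ?A" by (simp add: inv_into_image_cancel[OF h(2)])
      fix e assume "e \<in> edges G"
      then obtain e' where e': "e' \<in> edges ?A" "e = h ` e'" by (auto simp: G_def)
      then show "?k ` e \<in> edges ?A" using inv_into_image_cancel[OF h(2) subA[OF e'(1)]] by simp
    qed
    ultimately show False using rich_contains not_rich by blast
  qed
  then have free: "free_of (forbidden p) G" using free_of_forbidden[OF sG] by blast
  \<comment> \<open>The image of one side of the bipartite graph is independent, so stars centred in
    it are counted without repetition.\<close>
  define S where "S = (\<lambda>x. h (False, x)) ` points b F"
  have ver: "(s, x) \<in> verts ?A" if "x \<in> points b F" for s x using that by (simp add: alg_graph_def)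
  have hinj: "h u = h v \<longleftrightarrow> u = v" if "u \<in> verts ?A" "v \<in> verts ?A" for u v
    using h(2) that by (auto dest: inj_onD)
  have injS: "inj_on (\<lambda>x. h (False, x)) (points b F)"
    using hinj ver by (auto simp: inj_on_def)
  have sub_nb: "h ` nbrs ?A (False, x) \<subseteq> nbrs G (h (False, x))" for x
  proof
    fix y assume "y \<in> h ` nbrs ?A (False, x)"
    then obtain z where z: "{(False, x), z} \<in> edges ?A" "y = h z" by (auto simp: nbrs_def)
    have "h ` {(False, x), z} \<in> edges G" unfolding G_def snd_conv using z(1) by (rule imageI)
    then show "y \<in> nbrs G (h (False, x))" using z by (simp add: nbrs_def)
  qed
  have disj: "nbrs G v \<inter> S = {}" if vS: "v \<in> S" for v
  proof (rule ccontr)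
    assume "nbrs G v \<inter> S \<noteq> {}"
    then obtain x y where xy: "x \<in> points b F" "y \<in> points b F" "{h (False, x), h (False, y)} \<in> edges G"
      using vS by (auto simp: S_def nbrs_def)
    then obtain e where e: "e \<in> edges ?A" "{h (False, x), h (False, y)} = h ` e" by (auto simp: G_def)
    then obtain u w where uw: "u \<in> points b F" "w \<in> points b F" "e = {(False, u), (True, w)}"
      by (auto simp: alg_graph_def)
    have "h (True, w) \<in> {h (False, x), h (False, y)}" unfolding e uw by simp
    then show False using hinj ver uw xy by auto
  qed
  have SG: "S \<subseteq> verts G" using h(1) ver by (auto simp: S_def G_def)
  have degS: "card F ^ (b - a) \<le> deg G (h (False, x))" if x: "x \<in> points b F" for x
  proof -
    have "card F ^ (b - a) \<le> deg ?A (False, x)"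
      by (rule deg_alg_graph_ge[OF F c x a_le_b]) auto
    also have "\<dots> = card (h ` nbrs ?A (False, x))"
      using nbrs_subset[OF sA] h(2) by (intro card_image[symmetric]) (blast intro: inj_on_subset)
    also have "\<dots> \<le> deg G (h (False, x))" using sub_nb finite_nbrs[OF sG] by (intro card_mono) auto
    finally show ?thesis .
  qed
  have "card F ^ b * ((card F ^ (b - a)) choose t) = (\<Sum>v\<in>S. (card F ^ (b - a)) choose t)"
    by (simp add: S_def card_image[OF injS] card_points)
  also have "\<dots> \<le> (\<Sum>v\<in>S. deg G v choose t)"
    using degS by (intro sum_mono) (auto simp: S_def intro: binomial_right_mono)
  also have "\<dots> \<le> card (copies (star t) G)"
    using disj by (intro card_copies_star_ge[OF sG t SG]) auto
  also have "\<dots> \<le> ex n (star t) (forbidden p)" by (rule ex_ge[OF sG _ free]) (simp add: G_def)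
  finally show ?thesis .
qed

lemma ex_fraction:
  fixes r :: rat and t :: nat
  assumes "of_nat t < r" "r < of_nat t + 1"
  shows "\<exists>a q. 1 \<le> a \<and> a < q \<and> real_of_rat r = real t + 1 - real a / real q"
proof -
  obtain x y where xy: "of_nat t + 1 - r = Rat.Fract x y" "y > 0" "coprime x y"
    using Rat_cases by metis
  have fr: "Rat.Fract x y = of_int x / of_int y" by (simp add: Fract_of_int_quotient)
  have "0 < Rat.Fract x y" "Rat.Fract x y < 1" using assms xy(1)[symmetric] by simp_all
  then have "0 < x" "x < y" using xy(2) by (simp_all add: fr divide_less_eq zero_less_divide_iff)
  moreover have "r = of_nat t + 1 - of_int x / of_int y" using xy(1) fr by simp
  then have "real_of_rat r = real t + 1 - real_of_int x / real_of_int y"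
    by (simp add: of_rat_diff of_rat_add of_rat_divide)
  ultimately show ?thesis using xy(2)
    by (intro exI[of _ "nat x"] exI[of _ "nat y"]) auto
qed

text \<open>The algebraic graphs have 2 q^b vertices with q a power of two. Consecutive sizes differ
  by the fixed ratio 2^b, so padding to an arbitrary n costs only a constant factor.\<close>

lemma realizable_interior:
  fixes r :: rat and t :: nat
  assumes t: "1 \<le> t" and r: "of_nat t < r" "r < of_nat t + 1"
  shows "realizable r (star t)"
proof -
  obtain a w where aw: "1 \<le> a" "a < w" "real_of_rat r = real t + 1 - real a / real w"
    using ex_fraction[OF r] by blast
  \<comment> \<open>With b = t w the quotient t a / b equals a / w, the fraction read off from r,
    and a < w becomes t a < b.\<close>
  define b where "b = t * w"
  have tab: "t * a < b" using aw t by (simp add: b_def)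
  have "a \<le> t * a" using t by simp
  then have ab: "a < b" using tab by linarith
  obtain par where "rooted_tree a b par {a..b}" using rooted_tree_exists[of a b] aw ab by auto
  then interpret rooted_tree a b par "{a..b}" .
  define \<theta> where "\<theta> = real t * real a / real b"
  have \<theta>: "real_of_rat r = real t + 1 - \<theta>" using aw t by (simp add: \<theta>_def b_def)
  have \<theta>1: "\<theta> < 1"
  proof -
    have "real (t * a) < real b" using tab by (simp only: of_nat_less_iff)
    then show ?thesis using ab by (simp add: \<theta>_def pos_divide_less_eq)
  qed
  \<comment> \<open>These constants are fixed before any field: one \<open>p\<close> serves all q,
    so the forbidden family does not depend on n.\<close>
  obtain B p J M where p: "1 \<le> p" and constr: "\<And>F :: bit alg_closure set. finite F \<Longrightarrow> B < card F \<Longrightarrow>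
      \<exists>c. (\<forall>q. c q \<in> F) \<and> \<not> rich p (alg_graph a b J M c F)"
    using alg_graph_not_rich[where 'k = "bit alg_closure"] that by (metis le_add2)
  have upper: "real (ex n (star t) (forbidden p)) \<le>
      tail_const p powr \<theta> / (1 - \<theta>) * real n powr real_of_rat r" for n
  proof (rule ex_real_le)
    fix G :: "nat graph"
    assume G: "simple_graph G" "card (verts G) = n" "free_of (forbidden p) G"
    have nr: "\<not> rich p G" using G free_of_forbidden by blast
    have "card (copies (star t) G) \<le> (\<Sum>v\<in>verts G. deg G v choose t)"
      by (rule card_copies_star_le[OF G(1) t])
    also have "\<dots> \<le> (\<Sum>v\<in>verts G. deg G v ^ t)" using t by (intro sum_mono choose_le_power)
    finally have "real (card (copies (star t) G)) \<le> real (\<Sum>v\<in>verts G. deg G v ^ t)"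
      by (simp only: of_nat_le_iff)
    also have "\<dots> = (\<Sum>v\<in>verts G. real (deg G v) ^ t)" by simp
    also have "\<dots> \<le> tail_const p powr \<theta> / (1 - \<theta>) * real n powr real_of_rat r"
      using sum_deg_le[OF G(1) nr p t tab] unfolding G(2) \<theta> \<theta>_def .
    finally show "real (card (copies (star t) G)) \<le> tail_const p powr \<theta> / (1 - \<theta>) * real n powr real_of_rat r" .
  qed (use \<theta>1 in simp)
  define Q where "Q = (2::nat) ^ b"
  have Q: "2 \<le> Q" using ab power_increasing[of 1 b "2::nat"] by (simp add: Q_def)
  \<comment> \<open>The exponent yields m >= B + t + 1 below, so q = 2^m > m exceeds
    \<open>B\<close>, as \<open>constr\<close> demands, and q^(b-a) >= t.\<close>
  define n0 where "n0 = 2 * Q ^ (B + t + 2)"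
  \<comment> \<open>The factor t^t is lost in the binomial coefficient, (2 Q)^r in the estimate n <
    2 Q q^b.\<close>
  define \<gamma> where "\<gamma> = 1 / (real t ^ t * (2 * real Q) powr real_of_rat r)"
  have lower: "\<gamma> * real n powr real_of_rat r \<le> real (ex n (star t) (forbidden p))" if n: "n0 \<le> n" for n
  proof -
    have "2 * 1 \<le> n0" unfolding n0_def using Q by (intro mult_le_mono2) simp
    then have "1 \<le> n div 2" using n by simp
    then obtain m where m: "Q ^ m \<le> n div 2" "n div 2 < Q ^ (m + 1)"
      using ex_power_ivl1[OF Q] by blast
    have "Q ^ (B + t + 2) \<le> n div 2" using n by (simp add: n0_def)
    then have "Q ^ (B + t + 2) < Q ^ (m + 1)" using m(2) by linarith
    then have mB: "B + t + 1 \<le> m" using Q power_less_imp_less_exp[of Q "B + t + 2" "m + 1"] by simp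
    define q where "q = (2::nat) ^ m"
    have qm: "m < q" unfolding q_def by (rule less_exp)
    have qb: "q ^ b = Q ^ m" by (simp add: q_def Q_def power_mult[symmetric] mult.commute)
    obtain F :: "bit alg_closure set" where F: "finite F" "card F = q" "0 \<in> F" "1 \<in> F"
      "\<And>u v. u \<in> F \<Longrightarrow> v \<in> F \<Longrightarrow> u + v \<in> F \<and> u * v \<in> F"
      using ex_finite_subfield[of m, where 'k = "bit alg_closure"] mB unfolding q_def by auto
    obtain c where c: "\<And>q. c q \<in> F" "\<not> rich p (alg_graph a b J M c F)"
      using constr[OF F(1)] F(2) mB qm by auto
    have "2 * card F ^ b \<le> n" using m(1) by (simp add: F(2) qb)
    from lower_bound_graph[OF F(1,3,4,5) c this t]
    have ge: "q ^ b * ((q ^ (b - a)) choose t) \<le> ex n (star t) (forbidden p)" by (simp add: F(2))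
    have "q ^ 1 \<le> q ^ (b - a)" using qm ab by (intro power_increasing) auto
    then have tq: "t \<le> q ^ (b - a)" using mB qm by simp
    have q0: "0 < real q" using qm by simp
    have "n < 2 * Q ^ (m + 1)" using m(2) by linarith
    then have "real n \<le> real (2 * Q * q ^ b)" unfolding qb by (simp only: of_nat_le_iff) simp
    then have "real n powr real_of_rat r \<le> (2 * real Q * real q ^ b) powr real_of_rat r"
      using \<theta> \<theta>1 by (intro powr_mono2) auto
    also have "\<dots> = (2 * real Q) powr real_of_rat r * (real q ^ b) powr real_of_rat r"
      by (rule powr_mult)
    also have "(real q ^ b) powr real_of_rat r = real q ^ (b + (b - a) * t)"
    proof -
      have "real b * real_of_rat r = real (b + (b - a) * t)"
        using ab by (simp add: \<theta> \<theta>_def of_nat_diff field_simps)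
      then show ?thesis using q0 by (simp add: powr_powr powr_realpow flip: powr_realpow)
    qed
    finally have 1: "real n powr real_of_rat r \<le> (2 * real Q) powr real_of_rat r * real q ^ (b + (b - a) * t)" .
    have "\<gamma> * real n powr real_of_rat r \<le> \<gamma> * ((2 * real Q) powr real_of_rat r * real q ^ (b + (b - a) * t))"
      using 1 by (intro mult_left_mono) (simp_all add: \<gamma>_def)
    also have "\<dots> = real q ^ b * (real (q ^ (b - a)) / real t) ^ t"
    proof -
      have "(2 * real Q) powr real_of_rat r \<noteq> 0" using Q by simp
      then show ?thesis by (simp add: \<gamma>_def power_divide power_add power_mult)
    qed
    also have "\<dots> \<le> real q ^ b * real ((q ^ (b - a)) choose t)"
      using choose_ge_power[OF t tq] by (intro mult_left_mono) auto
    also have "\<dots> = real (q ^ b * ((q ^ (b - a)) choose t))" by simp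
    also have "\<dots> \<le> real (ex n (star t) (forbidden p))" using ge by (simp only: of_nat_le_iff)
    finally show ?thesis .
  qed
  have "0 < \<gamma>" using t Q by (simp add: \<gamma>_def)
  then show ?thesis
    using finite_forbidden lower upper
    by (intro realizableI[of "forbidden p" \<gamma> n0 r "star t" "tail_const p powr \<theta> / (1 - \<theta>)"])
      (auto simp: forbidden_def)
qed

section \<open>Exponents outside the open interval\<close>

text \<open>Otherwise n powr (\<alpha> - \<beta>) would exceed every constant. The inequality is
  asked for only along an unbounded set of n, which is what the case distinctions on freeness
  provide.\<close>

lemma powr_exponent_le:
  fixes \<alpha> \<beta> c C :: real
  assumes c: "0 < c" and le: "\<And>N. \<exists>n\<ge>N. c * real n powr \<alpha> \<le> C * real n powr \<beta>"
  shows "\<alpha> \<le> \<beta>"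
proof (rule ccontr)
  assume "\<not> \<alpha> \<le> \<beta>"
  then have d: "0 < \<alpha> - \<beta>" by simp
  define K where "K = (\<bar>C\<bar> + 1) / c"
  have K: "0 < K" using c by (simp add: K_def)
  obtain n where n: "nat \<lceil>K powr (1 / (\<alpha> - \<beta>))\<rceil> + 1 \<le> n" "c * real n powr \<alpha> \<le> C * real n powr \<beta>"
    using le by blast
  then have n0: "0 < real n" by simp
  have "K powr (1 / (\<alpha> - \<beta>)) \<le> real n" using n(1) by linarith
  then have "(K powr (1 / (\<alpha> - \<beta>))) powr (\<alpha> - \<beta>) \<le> real n powr (\<alpha> - \<beta>)"
    using d by (intro powr_mono2) auto
  then have "K \<le> real n powr (\<alpha> - \<beta>)" using d K by (simp add: powr_powr)
  then have "\<bar>C\<bar> + 1 \<le> c * real n powr (\<alpha> - \<beta>)" using c by (simp add: K_def field_simps)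
  then have "(\<bar>C\<bar> + 1) * real n powr \<beta> \<le> c * real n powr (\<alpha> - \<beta>) * real n powr \<beta>"
    by (intro mult_right_mono) auto
  also have "\<dots> = c * real n powr \<alpha>" by (simp add: powr_add[symmetric])
  also have "\<dots> \<le> C * real n powr \<beta>" by (rule n)
  finally have "\<bar>C\<bar> + 1 \<le> C" using n0 by simp
  then show False by linarith
qed

section \<open>Stars, star forests and bounded degrees\<close>

lemma verts_star: "verts (star d) = {0..d}"
  by (simp add: star_def)

lemma edges_star: "edges (star d) = (\<lambda>i. {0, i}) ` {1..d}"
  by (auto simp: star_def)

lemma copies_star_of_star:
  assumes "1 \<le> t" shows "d choose t \<le> card (copies (star t) (star d))"
proof -
  have nb: "nbrs (star d) 0 = {1..d}" by (auto simp: nbrs_def edges_star doubleton_eq_iff)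
  have "(\<Sum>v\<in>{0}. deg (star d) v choose t) \<le> card (copies (star t) (star d))"
    using nb by (intro card_copies_star_ge[OF simple_graph_star assms]) (auto simp: verts_star)
  then show ?thesis by (simp add: nb)
qed

lemma deg_less_if_no_star:
  assumes G: "simple_graph G" and d: "1 \<le> d" and no: "\<not> contains (star d) G"
  shows "deg G v < d"
proof (rule ccontr)
  assume "\<not> deg G v < d"
  then obtain S where S: "S \<subseteq> nbrs G v" "card S = d" using obtain_subset_with_card_n[of d "nbrs G v"] by auto
  then obtain s where "s \<in> S" using d by fastforce
  then have "{v, s} \<in> edges G" using S by (auto simp: nbrs_def)
  then have "v \<in> verts G" using simple_graph_edge(1)[OF G] by blast
  then have "star_at v S \<in> copies (star d) G" using copies_star_iff[OF G d] S by blast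
  then show False using no copies_nonempty_iff[OF simple_graph_star, of d G] by blast
qed

lemma copies_star_bounded_degree:
  assumes G: "simple_graph G" and t: "1 \<le> t" and deg: "\<And>v. deg G v < d"
  shows "card (copies (star t) G) \<le> card {v \<in> verts G. t \<le> deg G v} * 2 ^ d"
proof -
  have "card (copies (star t) G) \<le> (\<Sum>v\<in>verts G. deg G v choose t)" by (rule card_copies_star_le[OF G t])
  also have "\<dots> = (\<Sum>v\<in>{v \<in> verts G. t \<le> deg G v}. deg G v choose t)"
    using finite_verts[OF G] by (intro sum.mono_neutral_right) (auto simp: binomial_eq_0)
  also have "\<dots> \<le> (\<Sum>v\<in>{v \<in> verts G. t \<le> deg G v}. 2 ^ d)"
  proof (rule sum_mono)
    fix v
    have "deg G v choose t \<le> 2 ^ deg G v" by (rule binomial_le_pow2)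
    also have "\<dots> \<le> 2 ^ d" using deg[of v] by (intro power_increasing) auto
    finally show "deg G v choose t \<le> 2 ^ d" .
  qed
  finally show ?thesis by simp
qed

text \<open>The centres of the stars are the multiples of \<open>t + 1\<close>; the last \<open>n mod (t + 1)\<close> vertices are isolated.\<close>

definition star_forest :: "nat \<Rightarrow> nat \<Rightarrow> nat graph" where
  "star_forest t n = ({..<n}, {{i * (t + 1), i * (t + 1) + j} | i j. i < n div (t + 1) \<and> j \<in> {1..t}})"

lemma star_forest_index:
  fixes i n t :: nat
  assumes "i < n div (t + 1)" "j \<le> t"
  shows "i * (t + 1) + j < n div (t + 1) * (t + 1)"
proof -
  have "i * (t + 1) + j < (i + 1) * (t + 1)" using assms by simp
  also have "\<dots> \<le> n div (t + 1) * (t + 1)" using assms by (intro mult_le_mono1) simp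
  finally show ?thesis .
qed

lemma star_forest_index':
  fixes i n t :: nat
  assumes "i < n div (t + 1)" "j \<le> t"
  shows "i * (t + 1) + j < n"
  using star_forest_index[OF assms] div_times_less_eq_dividend[of n "t + 1"] by linarith

lemma simple_star_forest: "simple_graph (star_forest t n)"
  unfolding simple_graph_def
proof (intro conjI ballI)
  fix e assume "e \<in> edges (star_forest t n)"
  then obtain i j where e: "e = {i * (t + 1), i * (t + 1) + j}" "i < n div (t + 1)" "1 \<le> j" "j \<le> t"
    by (auto simp: star_forest_def)
  show "e \<subseteq> verts (star_forest t n)"
    using star_forest_index'[of i n t 0] star_forest_index'[of i n t j] e by (auto simp: star_forest_def)
  show "card e = 2" using e by (simp add: card_insert_if)
qed (simp add: star_forest_def)

lemma star_forest_same_index: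
  fixes i k j l t :: nat
  assumes "i * (t + 1) + j = k * (t + 1) + l" "j \<le> t" "l \<le> t"
  shows "i = k" "j = l"
proof -
  have "(i * (t + 1) + j) div (t + 1) = i" "(k * (t + 1) + l) div (t + 1) = k"
    using assms(2,3) by (subst div_mult_self3; simp)+
  then show "i = k" using assms(1) by metis
  then show "j = l" using assms(1) by simp
qed

lemma nbrs_star_forest:
  assumes "i < n div (t + 1)"
  shows "nbrs (star_forest t n) (i * (t + 1)) = (\<lambda>j. i * (t + 1) + j) ` {1..t}"
proof
  show "nbrs (star_forest t n) (i * (t + 1)) \<subseteq> (\<lambda>j. i * (t + 1) + j) ` {1..t}"
  proof
    fix u assume "u \<in> nbrs (star_forest t n) (i * (t + 1))"
    then obtain k l where kl: "{i * (t + 1), u} = {k * (t + 1), k * (t + 1) + l}" "l \<in> {1..t}"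
      by (auto simp: nbrs_def star_forest_def)
    then consider "i * (t + 1) = k * (t + 1)" "u = k * (t + 1) + l" | "i * (t + 1) = k * (t + 1) + l"
      by (auto simp: doubleton_eq_iff)
    then show "u \<in> (\<lambda>j. i * (t + 1) + j) ` {1..t}"
    proof cases
      case 1
      then show ?thesis using kl(2) by auto
    next
      case 2
      then show ?thesis using star_forest_same_index[of i t 0 k l] kl(2) by simp
    qed
  qed
  show "(\<lambda>j. i * (t + 1) + j) ` {1..t} \<subseteq> nbrs (star_forest t n) (i * (t + 1))"
    using assms unfolding nbrs_def star_forest_def snd_conv by blast
qed

lemma copies_star_of_star_forest:
  assumes t: "1 \<le> t" shows "n div (t + 1) \<le> card (copies (star t) (star_forest t n))"
proof -
  let ?A = "(\<lambda>i. i * (t + 1)) ` {..<n div (t + 1)}"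
  have "(\<Sum>v\<in>?A. deg (star_forest t n) v choose t) \<le> card (copies (star t) (star_forest t n))"
  proof (rule card_copies_star_ge[OF simple_star_forest t])
    show "?A \<subseteq> verts (star_forest t n)"
      using star_forest_index'[of _ n t 0] by (auto simp: star_forest_def)
    fix v assume "v \<in> ?A"
    then obtain i where i: "i < n div (t + 1)" "v = i * (t + 1)" by auto
    show "nbrs (star_forest t n) v \<inter> ?A = {}"
      unfolding i(2) nbrs_star_forest[OF i(1)]
    proof (rule ccontr)
      assume "(\<lambda>j. i * (t + 1) + j) ` {1..t} \<inter> ?A \<noteq> {}"
      then obtain j k where "j \<in> {1..t}" "i * (t + 1) + j = k * (t + 1)" by blast
      then show False using star_forest_same_index(2)[of i t j k 0] by simp
    qed
  qed
  moreover have "(\<Sum>v\<in>?A. deg (star_forest t n) v choose t) = (\<Sum>v\<in>?A. 1)"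
  proof (rule sum.cong)
    fix v assume "v \<in> ?A"
    then obtain i where i: "i < n div (t + 1)" "v = i * (t + 1)" by auto
    have "deg (star_forest t n) v = t"
      unfolding i(2) nbrs_star_forest[OF i(1)] by (subst card_image) (auto simp: inj_on_def)
    then show "deg (star_forest t n) v choose t = 1" by simp
  qed simp
  moreover have "card ?A = n div (t + 1)"
  proof (subst card_image)
    show "inj_on (\<lambda>i. i * (t + 1)) {..<n div (t + 1)}"
    proof (rule inj_onI)
      fix i k assume "i * (t + 1) = k * (t + 1)"
      then show "i = k" using star_forest_same_index(1)[of i t 0 k 0] by simp
    qed
  qed simp
  ultimately show ?thesis by simp
qed

text \<open>Centres have degree t and all other vertices degree at most 1. For t = 0 the bound
  \<open>max t 1\<close> is too weak, but then the forest has no edges.\<close>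

lemma star_forest_no_star:
  assumes "t < d" "1 \<le> d" shows "\<not> contains (star d) (star_forest t n)"
proof
  assume "contains (star d) (star_forest t n)"
  then have "copies (star d) (star_forest t n) \<noteq> {}" using copies_nonempty_iff[OF simple_graph_star] by blast
  then obtain v S where S: "S \<subseteq> nbrs (star_forest t n) v" "card S = d"
    using copies_star_iff[OF simple_star_forest assms(2)] by blast
  have "deg (star_forest t n) v \<le> max t 1"
  proof (cases "\<exists>i < n div (t + 1). v = i * (t + 1)")
    case True
    then obtain i where i: "i < n div (t + 1)" "v = i * (t + 1)" by blast
    have "card ((\<lambda>j. i * (t + 1) + j) ` {1..t}) \<le> t" using card_image_le[of "{1..t}" "\<lambda>j. i * (t + 1) + j"] by simp
    then show ?thesis unfolding i(2) nbrs_star_forest[OF i(1)] by simp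
  next
    case False
    have "nbrs (star_forest t n) v \<subseteq> {v div (t + 1) * (t + 1)}"
    proof
      fix u assume "u \<in> nbrs (star_forest t n) v"
      then obtain k l where kl: "{v, u} = {k * (t + 1), k * (t + 1) + l}" "l \<in> {1..t}" "k < n div (t + 1)"
        by (auto simp: nbrs_def star_forest_def)
      then have "v \<noteq> k * (t + 1)" using False by blast
      then have vu: "v = k * (t + 1) + l" "u = k * (t + 1)" using kl(1) by (auto simp: doubleton_eq_iff)
      have "v div (t + 1) = k" unfolding vu(1) using kl(2) by (subst div_mult_self3) auto
      then show "u \<in> {v div (t + 1) * (t + 1)}" using vu by simp
    qed
    then have "deg (star_forest t n) v \<le> card {v div (t + 1) * (t + 1)}" by (intro card_mono) auto
    then show ?thesis by simp
  qed
  moreover have "d \<le> deg (star_forest t n) v"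
    using S card_mono[OF finite_nbrs[OF simple_star_forest] S(1)] by simp
  ultimately show False using assms by (cases "t = 0") (auto simp: nbrs_def star_forest_def)
qed

lemma real_div_ge:
  assumes "t + 1 \<le> n" shows "1 / (2 * (real t + 1)) * real n \<le> real (n div (t + 1))"
proof -
  define m where "m = n div (t + 1) * (t + 1)"
  have "1 \<le> n div (t + 1)" using assms by (simp add: Suc_le_eq div_greater_zero_iff)
  then have "1 * (t + 1) \<le> m" unfolding m_def by (rule mult_le_mono1)
  moreover have "n < m + (t + 1)"
    unfolding m_def using mod_less_divisor[of "t + 1" n] div_mult_mod_eq[of n "t + 1"] by linarith
  ultimately have "n \<le> 2 * m" by simp
  then have "real n \<le> real (2 * (n div (t + 1) * (t + 1)))" unfolding m_def by (simp only: of_nat_le_iff)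
  then show ?thesis by (simp add: field_simps)
qed

text \<open>With bounded degrees, many vertices of degree at least \<open>t\<close> allow a greedy choice of disjoint
  stars.\<close>

lemma few_centres:
  fixes G :: "'v graph"
  assumes G: "simple_graph G" and deg: "\<And>v. deg G v < d" and n: "n \<le> card (verts G)"
    and no: "\<not> contains (star_forest t n) G"
  shows "card {v \<in> verts G. t \<le> deg G v} \<le> n * (d + 1)"
proof (rule ccontr)
  assume many: "\<not> ?thesis"
  have greedy: "\<exists>f. inj_on f {..<k * (t + 1)} \<and> f ` {..<k * (t + 1)} \<subseteq> verts G \<and>
          (\<forall>i<k. \<forall>j\<in>{1..t}. {f (i * (t + 1)), f (i * (t + 1) + j)} \<in> edges G)" if "k \<le> n div (t + 1)" for k
    using that
  proof (induction k)
    case 0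
    then show ?case by simp
  next
    case (Suc k)
    then obtain f where f: "inj_on f {..<k * (t + 1)}" "f ` {..<k * (t + 1)} \<subseteq> verts G"
      "\<And>i j. i < k \<Longrightarrow> j \<in> {1..t} \<Longrightarrow> {f (i * (t + 1)), f (i * (t + 1) + j)} \<in> edges G" by auto
    define U where "U = f ` {..<k * (t + 1)}"
    have "k * (t + 1) \<le> n div (t + 1) * (t + 1)" using Suc.prems by (intro mult_le_mono1) simp
    also have "\<dots> \<le> n" by (rule div_times_less_eq_dividend)
    finally have cardU: "card U \<le> n" using card_image_le[of "{..<k * (t + 1)}" f] by (simp add: U_def)
    have finU: "finite U" by (simp add: U_def)
    \<comment> \<open>The occupied vertices and their neighbours number at most n (d + 1), so some
      vertex of degree at least t lies outside. None of its neighbours is occupied, so any t of them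
      complete a new star.\<close>
    have "card (U \<union> (\<Union>u\<in>U. nbrs G u)) \<le> card U + card (\<Union>u\<in>U. nbrs G u)" by (rule card_Un_le)
    also have "card (\<Union>u\<in>U. nbrs G u) \<le> (\<Sum>u\<in>U. deg G u)" by (rule card_UN_le[OF finU])
    also have "\<dots> \<le> (\<Sum>u\<in>U. d)" using deg by (intro sum_mono less_imp_le)
    finally have "card (U \<union> (\<Union>u\<in>U. nbrs G u)) \<le> card U * (d + 1)" by simp
    also have "\<dots> \<le> n * (d + 1)" using cardU by (rule mult_le_mono1)
    also have "\<dots> < card {v \<in> verts G. t \<le> deg G v}" using many by simp
    finally have "\<not> {v \<in> verts G. t \<le> deg G v} \<subseteq> U \<union> (\<Union>u\<in>U. nbrs G u)"
      using finU finite_nbrs[OF G] card_mono[of "U \<union> (\<Union>u\<in>U. nbrs G u)"] by (meson finite_UN finite_Un leD)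
    then obtain v where v: "v \<in> verts G" "t \<le> deg G v" "v \<notin> U" "\<And>u. u \<in> U \<Longrightarrow> v \<notin> nbrs G u" by blast
    obtain S where S: "S \<subseteq> nbrs G v" "card S = t" "finite S"
      using obtain_subset_with_card_n[OF v(2)] by metis
    have SU: "S \<inter> U = {}" using S(1) v(4) nbrs_sym[of _ G v] by blast
    have vS: "v \<notin> S" using S nbrs_irrefl[OF G] by blast
    obtain h where h: "bij_betw h {0..<t} S" using ex_bij_betw_nat_finite[OF S(3)] S(2) by auto
    define g where "g x = (if x < k * (t + 1) then f x else if x = k * (t + 1) then v else h (x - (k * (t + 1) + 1)))" for x
    have gU: "g x = f x" if "x < k * (t + 1)" for x using that by (simp add: g_def)
    have gj: "g (k * (t + 1) + j) = h (j - 1)" if "j \<in> {1..t}" for j using that by (simp add: g_def)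
    have g0: "g (k * (t + 1)) = v" by (simp add: g_def)
    have hS: "h j \<in> S" if "j < t" for j using h that by (auto simp: bij_betw_def)
    have "{..<Suc k * (t + 1)} = {..<k * (t + 1)} \<union> ({k * (t + 1)} \<union> (\<lambda>j. k * (t + 1) + j) ` {1..t})"
    proof
      show "{..<Suc k * (t + 1)} \<subseteq> {..<k * (t + 1)} \<union> ({k * (t + 1)} \<union> (\<lambda>j. k * (t + 1) + j) ` {1..t})"
      proof
        fix x assume x: "x \<in> {..<Suc k * (t + 1)}"
        show "x \<in> {..<k * (t + 1)} \<union> ({k * (t + 1)} \<union> (\<lambda>j. k * (t + 1) + j) ` {1..t})"
        proof (cases "k * (t + 1) < x")
          case True
          then have "x = k * (t + 1) + (x - k * (t + 1))" "x - k * (t + 1) \<in> {1..t}" using x by auto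
          then show ?thesis by blast
        qed auto
      qed
    qed auto
    note split = this
    have img: "g ` {..<k * (t + 1)} = U" by (auto simp: U_def gU intro!: image_cong)
    have img2: "g ` ((\<lambda>j. k * (t + 1) + j) ` {1..t}) \<subseteq> S"
      unfolding image_image
    proof (rule image_subsetI)
      fix j assume j: "j \<in> {1..t}"
      show "g (k * (t + 1) + j) \<in> S" unfolding gj[OF j] using j by (intro hS) auto
    qed
    have "inj_on g {..<Suc k * (t + 1)}" unfolding split
    proof (subst inj_on_Un, intro conjI)
      show "inj_on g {..<k * (t + 1)}" using f(1) by (simp add: inj_on_def gU)
      have "inj_on g ((\<lambda>j. k * (t + 1) + j) ` {1..t})"
      proof (rule inj_onI)
        fix x y assume xy: "x \<in> (\<lambda>j. k * (t + 1) + j) ` {1..t}" "y \<in> (\<lambda>j. k * (t + 1) + j) ` {1..t}" and eq: "g x = g y"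
        obtain i j where ij: "x = k * (t + 1) + i" "i \<in> {1..t}" "y = k * (t + 1) + j" "j \<in> {1..t}"
          using xy by blast
        then have "h (i - 1) = h (j - 1)" using eq gj by simp
        moreover have "i - 1 \<in> {0..<t}" "j - 1 \<in> {0..<t}" using ij by auto
        ultimately have "i - 1 = j - 1" using h by (auto simp: bij_betw_def dest: inj_onD)
        then show "x = y" using ij by auto
      qed
      then have "inj_on g (insert (k * (t + 1)) ((\<lambda>j. k * (t + 1) + j) ` {1..t}))"
        unfolding inj_on_insert g0 using img2 vS by blast
      then show "inj_on g ({k * (t + 1)} \<union> (\<lambda>j. k * (t + 1) + j) ` {1..t})"
        by (subst (asm) insert_is_Un)
      show "g ` ({..<k * (t + 1)} - ({k * (t + 1)} \<union> (\<lambda>j. k * (t + 1) + j) ` {1..t})) \<inter>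
          g ` (({k * (t + 1)} \<union> (\<lambda>j. k * (t + 1) + j) ` {1..t}) - {..<k * (t + 1)}) = {}"
      proof -
        have "g ` ({..<k * (t + 1)} - ({k * (t + 1)} \<union> (\<lambda>j. k * (t + 1) + j) ` {1..t})) \<subseteq> U" using img by blast
        moreover have "g ` (({k * (t + 1)} \<union> (\<lambda>j. k * (t + 1) + j) ` {1..t}) - {..<k * (t + 1)}) \<subseteq> insert v S"
          using img2 g0 by blast
        ultimately show ?thesis using SU v(3) by blast
      qed
    qed
    moreover have "g ` {..<Suc k * (t + 1)} \<subseteq> verts G"
    proof -
      have "g ` {..<Suc k * (t + 1)} \<subseteq> U \<union> insert v S" unfolding split image_Un using img img2 g0 by auto
      then show ?thesis using f(2) v(1) S(1) nbrs_subset[OF G, of v] unfolding U_def by blast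
    qed
    moreover have "{g (i * (t + 1)), g (i * (t + 1) + j)} \<in> edges G" if i: "i < Suc k" and j: "j \<in> {1..t}" for i j
    proof (cases "i = k")
      case True
      have "h (j - 1) \<in> S" using j by (intro hS) auto
      then show ?thesis using S(1) unfolding True g0 gj[OF j] by (auto simp: nbrs_def)
    next
      case False
      then have ik: "i < k" using i by simp
      have "i * (t + 1) + j < (i + 1) * (t + 1)" using j by simp
      also have "\<dots> \<le> k * (t + 1)" using ik by (intro mult_le_mono1) simp
      finally have "i * (t + 1) + j < k * (t + 1)" .
      then show ?thesis using f(3)[OF ik j] by (simp add: gU)
    qed
    ultimately show ?case by blast
  qed
  obtain f where f: "inj_on f {..<n div (t + 1) * (t + 1)}" "f ` {..<n div (t + 1) * (t + 1)} \<subseteq> verts G"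
      "\<And>i j. i < n div (t + 1) \<Longrightarrow> j \<in> {1..t} \<Longrightarrow> {f (i * (t + 1)), f (i * (t + 1) + j)} \<in> edges G"
    using greedy[OF order.refl] by blast
  define l where "l = n div (t + 1) * (t + 1)"
  have ln: "l \<le> n" unfolding l_def by (rule div_times_less_eq_dividend)
  have "card {l..<n} \<le> card (verts G - f ` {..<l})"
  proof -
    have "card (verts G - f ` {..<l}) = card (verts G) - card (f ` {..<l})"
      using f(2) by (intro card_Diff_subset) (auto simp: l_def)
    moreover have "card (f ` {..<l}) = l" using f(1) by (simp add: card_image l_def)
    ultimately show ?thesis using n by simp
  qed
  then obtain e where e: "e ` {l..<n} \<subseteq> verts G - f ` {..<l}" "inj_on e {l..<n}"
    using card_le_inj[of "{l..<n}" "verts G - f ` {..<l}"] finite_verts[OF G] by auto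
  define g where "g x = (if x < l then f x else e x)" for x
  have "contains (star_forest t n) G" unfolding contains_def
  proof (intro exI conjI ballI)
    have split: "{..<n} = {..<l} \<union> {l..<n}" using ln by auto
    have im: "g ` {..<l} = f ` {..<l}" "g ` {l..<n} = e ` {l..<n}" by (auto simp: g_def)
    show "inj_on g (verts (star_forest t n))"
      unfolding star_forest_def fst_conv split
    proof (subst inj_on_Un, intro conjI)
      show "inj_on g {..<l}" using f(1) by (simp add: inj_on_def g_def l_def)
      show "inj_on g {l..<n}" using e(2) by (simp add: inj_on_def g_def)
      have "g ` ({..<l} - {l..<n}) \<subseteq> f ` {..<l}" "g ` ({l..<n} - {..<l}) \<subseteq> e ` {l..<n}" using im by blast+
      then show "g ` ({..<l} - {l..<n}) \<inter> g ` ({l..<n} - {..<l}) = {}" using e(1) by blast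
    qed
    show "g ` verts (star_forest t n) \<subseteq> verts G"
      unfolding star_forest_def fst_conv split image_Un im using f(2) e(1) by (auto simp: l_def)
    fix c assume "c \<in> edges (star_forest t n)"
    then obtain i j where ij: "c = {i * (t + 1), i * (t + 1) + j}" "i < n div (t + 1)" "j \<in> {1..t}"
      by (auto simp: star_forest_def)
    have "i * (t + 1) + j < l" unfolding l_def using ij by (intro star_forest_index) auto
    then have "g ` c = {f (i * (t + 1)), f (i * (t + 1) + j)}" by (simp add: ij g_def)
    then show "g ` c \<in> edges G" using f(3) ij by simp
  qed
  then show False using no by blast
qed

text \<open>No two edges of the host are disjoint, whereas n >= 2 (t + 1) gives the forest two
  disjoint stars, represented here by one edge each.\<close>

lemma star_no_two_stars:
  assumes "1 \<le> t" "2 * (t + 1) \<le> n" and common: "\<And>e. e \<in> edges G \<Longrightarrow> z \<in> e"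
  shows "\<not> contains (star_forest t n) G"
proof
  assume "contains (star_forest t n) G"
  then obtain f where f: "inj_on f {..<n}" "\<And>e. e \<in> edges (star_forest t n) \<Longrightarrow> f ` e \<in> edges G"
    by (auto simp: contains_def star_forest_def)
  have n2: "2 \<le> n div (t + 1)" using assms(2) by (metis div_le_mono div_mult_self_is_m zero_less_Suc Suc_eq_plus1)
  have E: "{i * (t + 1), i * (t + 1) + 1} \<in> edges (star_forest t n)" if "i < 2" for i
    unfolding star_forest_def snd_conv using that n2 assms(1)
    by (intro CollectI exI[of _ i] exI[of _ 1]) auto
  have "z \<in> f ` {0, 1}" "z \<in> f ` {t + 1, t + 2}"
    using common[OF f(2)[OF E[of 0]]] common[OF f(2)[OF E[of 1]]] by simp_all
  then obtain x y where "x \<in> {0, 1}" "y \<in> {t + 1, t + 2}" "f x = f y" by auto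
  moreover have "x \<in> {..<n}" "y \<in> {..<n}" using calculation assms by auto
  ultimately have "x = y" using f(1) by (auto dest: inj_onD)
  then show False using \<open>x \<in> {0, 1}\<close> \<open>y \<in> {t + 1, t + 2}\<close> assms(1) by auto
qed

lemma copies_star_le_power:
  assumes G: "simple_graph G" and t: "1 \<le> t"
  shows "card (copies (star t) G) \<le> card (verts G) ^ (t + 1)"
proof -
  have "card (copies (star t) G) \<le> (\<Sum>v\<in>verts G. deg G v choose t)" by (rule card_copies_star_le[OF G t])
  also have "\<dots> \<le> (\<Sum>v\<in>verts G. card (verts G) ^ t)"
  proof (rule sum_mono)
    fix v
    have "deg G v choose t \<le> deg G v ^ t" by (rule choose_le_power[OF t])
    also have "\<dots> \<le> card (verts G) ^ t" by (intro power_mono deg_le G) simp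
    finally show "deg G v choose t \<le> card (verts G) ^ t" .
  qed
  finally show ?thesis by simp
qed

section \<open>Which exponents occur\<close>

lemma ex_ge_star:
  assumes t: "1 \<le> t" and n: "t + 2 \<le> n" and free: "free_of \<F> (star (n - 1))"
  shows "1 / (2 * real t) ^ t * real n ^ t \<le> real (ex n (star t) \<F>)"
proof -
  have "(n - 1) choose t \<le> ex n (star t) \<F>"
    using copies_star_of_star[OF t, of "n - 1"] ex_ge[OF simple_graph_star _ free, of n "star t"] n
    by (simp add: verts_star)
  then have "real ((n - 1) choose t) \<le> real (ex n (star t) \<F>)" by (simp only: of_nat_le_iff)
  moreover have "(real (n - 1) / real t) ^ t \<le> real ((n - 1) choose t)"
    using n t by (intro choose_ge_power) auto
  moreover have "(real n / (2 * real t)) ^ t \<le> (real (n - 1) / real t) ^ t"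
    using n t by (intro power_mono) (auto simp: field_simps)
  ultimately show ?thesis by (simp add: power_divide)
qed

lemma ex_ge_star_forest:
  assumes t: "1 \<le> t" and n: "t + 1 \<le> n" and free: "free_of \<F> (star_forest t n)"
  shows "1 / (2 * (real t + 1)) * real n \<le> real (ex n (star t) \<F>)"
proof -
  have "n div (t + 1) \<le> ex n (star t) \<F>"
    using copies_star_of_star_forest[OF t, of n] ex_ge[OF simple_star_forest _ free, of n "star t"]
    by (simp add: star_forest_def)
  then have "real (n div (t + 1)) \<le> real (ex n (star t) \<F>)" by (simp only: of_nat_le_iff)
  then show ?thesis using real_div_ge[OF n] by linarith
qed

lemma ex_le_bounded_degree:
  assumes t: "1 \<le> t"
    and deg: "\<And>(G :: nat graph) v. simple_graph G \<Longrightarrow> free_of \<F> G \<Longrightarrow> deg G v < d"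
    and centres: "\<And>G :: nat graph. simple_graph G \<Longrightarrow> free_of \<F> G \<Longrightarrow> card (verts G) = n \<Longrightarrow>
      card {v \<in> verts G. t \<le> deg G v} \<le> k"
  shows "real (ex n (star t) \<F>) \<le> 2 ^ d * real k"
proof -
  have "ex n (star t) \<F> \<le> k * 2 ^ d"
  proof (rule ex_le)
    fix G :: "nat graph" assume G: "simple_graph G" "card (verts G) = n" "free_of \<F> G"
    have "card (copies (star t) G) \<le> card {v \<in> verts G. t \<le> deg G v} * 2 ^ d"
      by (rule copies_star_bounded_degree[OF G(1) t deg[OF G(1,3)]])
    also have "\<dots> \<le> k * 2 ^ d" using centres[OF G(1,3,2)] by (rule mult_le_mono1)
    finally show "card (copies (star t) G) \<le> k * 2 ^ d" .
  qed
  then have "real (ex n (star t) \<F>) \<le> real (k * 2 ^ d)" by (simp only: of_nat_le_iff)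
  then show ?thesis by (simp add: mult.commute)
qed

lemma card_centres_le:
  "simple_graph G \<Longrightarrow> card (verts G) = n \<Longrightarrow> card {v \<in> verts G. t \<le> deg G v} \<le> n"
  by (metis (no_types, lifting) card_mono finite_verts mem_Collect_eq subsetI)

text \<open>If one star or star forest is not free, it contains some forbidden graph, and by
  transitivity of containment no free graph contains that star or forest. This turns the failure for
  a single host into a bound valid for all hosts.\<close>

lemma realizable_star_only_if:
  fixes r :: rat and t :: nat
  assumes t: "1 \<le> t" and real: "realizable r (star t)"
  shows "r \<in> {0, 1} \<or> r \<in> {of_nat t .. of_nat t + 1}"
proof -
  obtain \<F> c C n0 where F: "finite \<F>" "\<And>F. F \<in> \<F> \<Longrightarrow> simple_graph F" and c: "c > 0" "C > 0"
    and low: "\<And>n. n \<ge> n0 \<Longrightarrow> c * real n powr of_rat r \<le> real (ex n (star t) \<F>)"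
    and up: "\<And>n. n \<ge> n0 \<Longrightarrow> real (ex n (star t) \<F>) \<le> C * real n powr of_rat r"
    using realizableE[OF real] by blast
  let ?r = "real_of_rat r"
  have le_up: "?r \<le> \<beta>" if "\<And>n. n \<ge> N \<Longrightarrow> real (ex n (star t) \<F>) \<le> K * real n powr \<beta>" for \<beta> K N
  proof (rule powr_exponent_le[OF c(1)])
    fix M
    show "\<exists>n\<ge>M. c * real n powr ?r \<le> K * real n powr \<beta>"
    proof (intro exI conjI)
      let ?n = "max M (max N n0)"
      have "n0 \<le> ?n" "N \<le> ?n" by auto
      then show "c * real ?n powr ?r \<le> K * real ?n powr \<beta>" using low that by (meson order.trans)
    qed simp
  qed
  have ge_low: "\<alpha> \<le> ?r" if k: "0 < k" and lowk: "\<And>N. \<exists>n\<ge>N. k * real n powr \<alpha> \<le> real (ex n (star t) \<F>)" for \<alpha> k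
  proof (rule powr_exponent_le[OF k])
    fix M
    obtain n where "n \<ge> max M n0" "k * real n powr \<alpha> \<le> real (ex n (star t) \<F>)" using lowk by blast
    then show "\<exists>n\<ge>M. k * real n powr \<alpha> \<le> C * real n powr ?r" using up[of n] by (intro exI[of _ n]) auto
  qed
  \<comment> \<open>The lower bound is positive and \<open>ex\<close> is an integer, so it is at
    least 1 for all large n; this excludes negative exponents.\<close>
  have r0: "0 \<le> ?r"
  proof (rule ge_low[of 1])
    fix N
    let ?n = "max N (max n0 1)"
    have "0 < c * real ?n powr ?r" using c by simp
    then have "0 < real (ex ?n (star t) \<F>)" using low[of ?n] by linarith
    then show "\<exists>n\<ge>N. 1 * real n powr 0 \<le> real (ex n (star t) \<F>)" by (intro exI[of _ ?n]) auto
  qed simp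
  have rt1: "?r \<le> real t + 1"
  proof (rule le_up[of 1 1])
    fix n :: nat assume n: "1 \<le> n"
    have "ex n (star t) \<F> \<le> n ^ (t + 1)" using copies_star_le_power[OF _ t] by (intro ex_le) auto
    then have "real (ex n (star t) \<F>) \<le> real (n ^ (t + 1))" by (simp only: of_nat_le_iff)
    also have "\<dots> = real n powr (real t + 1)" using n powr_realpow[of "real n" "t + 1"] by (simp add: add.commute)
    finally show "real (ex n (star t) \<F>) \<le> 1 * real n powr (real t + 1)" by simp
  qed
  have low_cases: "real t \<le> ?r \<or> ?r = 1 \<or> ?r \<le> 0"
  proof (cases "\<forall>N. \<exists>n\<ge>N. free_of \<F> (star (n - 1))")
    case True
    have "real t \<le> ?r"
    proof (rule ge_low[of "1 / (2 * real t) ^ t"])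
      fix N
      obtain n where n: "n \<ge> max N (t + 2)" "free_of \<F> (star (n - 1))" using True by blast
      then show "\<exists>n\<ge>N. 1 / (2 * real t) ^ t * real n powr real t \<le> real (ex n (star t) \<F>)"
        using ex_ge_star[OF t _ n(2)] by (intro exI[of _ n]) (auto simp: powr_realpow)
    qed (use t in simp)
    then show ?thesis by simp
  next
    case False
    then obtain N where N: "\<And>n. n \<ge> N \<Longrightarrow> \<not> free_of \<F> (star (n - 1))" by blast
    define d where "d = N + 1"
    have d: "1 \<le> d" "\<not> free_of \<F> (star d)" using N[of "N + 2"] by (auto simp: d_def)
    obtain F1 where F1: "F1 \<in> \<F>" "contains F1 (star d)" using d(2) free_of_iff[OF F(2)] by blast
    have deg: "deg G v < d" if "simple_graph G" "free_of \<F> G" for G :: "nat graph" and v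
    proof (rule deg_less_if_no_star[OF that(1) d(1)])
      show "\<not> contains (star d) G"
        using that(2) free_of_iff[OF F(2)] F1 contains_trans[OF F(2)[OF F1(1)] F1(2)] by blast
    qed
    have r1: "?r \<le> 1"
    proof (rule le_up[of 1 "2 ^ d"])
      fix n :: nat assume n: "1 \<le> n"
      have "real (ex n (star t) \<F>) \<le> 2 ^ d * real n"
        by (rule ex_le_bounded_degree[OF t deg card_centres_le])
      then show "real (ex n (star t) \<F>) \<le> 2 ^ d * real n powr 1" using n by simp
    qed
    show ?thesis
    proof (cases "\<forall>N. \<exists>n\<ge>N. free_of \<F> (star_forest t n)")
      case True
      have "1 \<le> ?r"
      proof (rule ge_low[of "1 / (2 * (real t + 1))"])
        fix N
        obtain n where n: "n \<ge> max N (t + 1)" "free_of \<F> (star_forest t n)" using True by blast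
        then show "\<exists>n\<ge>N. 1 / (2 * (real t + 1)) * real n powr 1 \<le> real (ex n (star t) \<F>)"
          using ex_ge_star_forest[OF t _ n(2)] by (intro exI[of _ n]) auto
      qed simp
      then show ?thesis using r1 by simp
    next
      case False
      then obtain n2 where "\<not> free_of \<F> (star_forest t n2)" by blast
      then obtain F2 where F2: "F2 \<in> \<F>" "contains F2 (star_forest t n2)" using free_of_iff[OF F(2)] by blast
      have centres: "card {v \<in> verts G. t \<le> deg G v} \<le> n2 * (d + 1)"
        if "n2 \<le> n" "simple_graph G" "free_of \<F> G" "card (verts G) = n" for G :: "nat graph" and n
      proof -
        have "\<not> contains (star_forest t n2) G"
          using that free_of_iff[OF F(2)] F2 contains_trans[OF F(2)[OF F2(1)] F2(2)] by blast
        then show ?thesis using that by (intro few_centres deg) auto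
      qed
      have "?r \<le> 0"
      proof (rule le_up[of "max n2 1"])
        fix n assume n: "max n2 1 \<le> n"
        then have "n2 \<le> n" by simp
        then have "real (ex n (star t) \<F>) \<le> 2 ^ d * real (n2 * (d + 1))"
          by (intro ex_le_bounded_degree[OF t deg centres])
        then show "real (ex n (star t) \<F>) \<le> 2 ^ d * real (n2 * (d + 1)) * real n powr 0" using n by simp
      qed
      then show ?thesis by simp
    qed
  qed
  have eq: "real_of_rat (of_nat t) = real t" "real_of_rat (of_nat t + 1) = real t + 1"
    by (simp_all add: of_rat_add)
  show ?thesis
  proof (cases "real t \<le> ?r")
    case True
    then have "of_nat t \<le> r" "r \<le> of_nat t + 1"
      using rt1 eq by (metis of_rat_less_eq)+
    then show ?thesis by simp
  next
    case False
    then have "?r = 1 \<or> ?r = 0" using low_cases r0 by auto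
    then show ?thesis by (auto simp: of_rat_eq_1_iff)
  qed
qed

text \<open>Excluding \<open>star (t + 1)\<close> bounds the degrees, and excluding two disjoint
  t-stars, the forest on 2 (t + 1) vertices, bounds the number of centres. One t-star with isolated
  vertices is free and keeps the count positive.\<close>

lemma realizable_0:
  assumes t: "1 \<le> t" shows "realizable 0 (star t)"
proof -
  let ?n = "2 * (t + 1)"
  let ?F = "{star (t + 1), star_forest t ?n}"
  have simp: "simple_graph F" if "F \<in> ?F" for F using that simple_graph_star simple_star_forest by auto
  show ?thesis
  proof (rule realizableI[of ?F 1 ?n])
    fix n assume n: "?n \<le> n"
    define G where "G = ({..<n}, edges (star t))"
    have sG: "simple_graph G" using simple_graph_star[of t] n
      by (auto simp: simple_graph_def G_def edges_star)
    have centre: "0 \<in> e" if "e \<in> edges G" for e using that by (auto simp: G_def edges_star)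
    have nb: "nbrs G v = {1..t}" if "v = 0" for v using that by (auto simp: nbrs_def G_def edges_star doubleton_eq_iff)
    have "\<not> contains (star (t + 1)) G"
    proof
      assume "contains (star (t + 1)) G"
      then obtain f where f: "inj_on f {0..t+1}" "\<And>e. e \<in> edges (star (t + 1)) \<Longrightarrow> f ` e \<in> edges G"
        by (auto simp: contains_def verts_star)
      have "inj_on ((`) f) (edges (star (t + 1)))"
      proof (rule inj_on_subset[OF inj_on_image_Pow[OF f(1)]])
        show "edges (star (t + 1)) \<subseteq> Pow {0..t+1}" by (auto simp: edges_star)
      qed
      then have "card (edges (star (t + 1))) \<le> card (edges G)"
        using f(2) by (intro card_inj_on_le[of "(`) f"]) (auto simp: G_def edges_star)
      moreover have "card (edges (star d)) = d" for d
        unfolding edges_star by (subst card_image) (auto simp: inj_on_def doubleton_eq_iff)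
      ultimately show False by (simp add: G_def)
    qed
    moreover have "\<not> contains (star_forest t ?n) G" by (rule star_no_two_stars[OF t order.refl centre])
    ultimately have free: "free_of ?F G" using free_of_iff[OF simp] by blast
    have "(\<Sum>v\<in>{0}. deg G v choose t) \<le> card (copies (star t) G)"
      using nb n by (intro card_copies_star_ge[OF sG t]) (auto simp: G_def)
    then have "1 \<le> card (copies (star t) G)" by (simp add: nb)
    also have "\<dots> \<le> ex n (star t) ?F" by (rule ex_ge[OF sG _ free]) (simp add: G_def)
    finally show "1 * real n powr real_of_rat 0 \<le> real (ex n (star t) ?F)" using n by simp
    have iff: "free_of ?F H \<longleftrightarrow> (\<forall>F\<in>?F. \<not> contains F H)" for H :: "nat graph"
      by (rule free_of_iff[OF simp])
    have deg: "deg H v < t + 1" if "simple_graph H" "free_of ?F H" for H :: "nat graph" and v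
      using that iff by (intro deg_less_if_no_star) auto
    have centres: "card {v \<in> verts H. t \<le> deg H v} \<le> ?n * (t + 1 + 1)"
      if "simple_graph H" "free_of ?F H" "card (verts H) = n" for H :: "nat graph"
      using that n iff by (intro few_centres deg) auto
    have "real (ex n (star t) ?F) \<le> 2 ^ (t + 1) * real (?n * (t + 1 + 1))"
      by (rule ex_le_bounded_degree[OF t deg centres])
    then show "real (ex n (star t) ?F) \<le> 2 ^ (t + 1) * real (?n * (t + 1 + 1)) * real n powr real_of_rat 0"
      using n by simp
  qed (use simp in auto)
qed

lemma realizable_1:
  assumes t: "1 \<le> t" shows "realizable 1 (star t)"
proof -
  let ?F = "{star (t + 1)}"
  have simp: "simple_graph F" if "F \<in> ?F" for F using that simple_graph_star by auto
  show ?thesis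
  proof (rule realizableI[of ?F "1 / (2 * (real t + 1))" "t + 1"])
    fix n assume n: "t + 1 \<le> n"
    have free: "free_of ?F (star_forest t n)"
      using star_forest_no_star[of t "t + 1" n] simp by (subst free_of_iff) auto
    show "1 / (2 * (real t + 1)) * real n powr real_of_rat 1 \<le> real (ex n (star t) ?F)"
      using ex_ge_star_forest[OF t n free] n by simp
    have iff: "free_of ?F H \<longleftrightarrow> (\<forall>F\<in>?F. \<not> contains F H)" for H :: "nat graph"
      by (rule free_of_iff[OF simp])
    have deg: "deg H v < t + 1" if "simple_graph H" "free_of ?F H" for H :: "nat graph" and v
      using that iff by (intro deg_less_if_no_star) auto
    have "real (ex n (star t) ?F) \<le> 2 ^ (t + 1) * real n"
      by (rule ex_le_bounded_degree[OF t deg card_centres_le])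
    then show "real (ex n (star t) ?F) \<le> 2 ^ (t + 1) * real n powr real_of_rat 1" using n by simp
  qed (use simp in auto)
qed

text \<open>\<open>star_forest 1 4\<close> is a pair of disjoint edges. Without it every edge meets
  a fixed edge {u, v}, so only u and v can have degree above 2; the spanning star attains the order
  n^t.\<close>

lemma realizable_t:
  assumes t: "1 \<le> t" shows "realizable (of_nat t) (star t)"
proof -
  let ?F = "{star_forest 1 4}"
  have simp: "simple_graph F" if "F \<in> ?F" for F using that simple_star_forest by auto
  show ?thesis
  proof (rule realizableI[of ?F "1 / (2 * real t) ^ t" "t + 4"])
    fix n assume n: "t + 4 \<le> n"
    have "\<not> contains (star_forest 1 4) (star (n - 1))"
      by (rule star_no_two_stars[of _ _ _ 0]) (auto simp: edges_star)
    then have free: "free_of ?F (star (n - 1))" using simp by (subst free_of_iff) auto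
    show "1 / (2 * real t) ^ t * real n powr real_of_rat (of_nat t) \<le> real (ex n (star t) ?F)"
      using ex_ge_star[OF t _ free] n by (simp add: powr_realpow)
    \<comment> \<open>The 6 is 2 + 4: n^t for each of u and v, and at most 2^2 stars at every other
      vertex, with n <= n^t.\<close>
    have "ex n (star t) ?F \<le> 6 * n ^ t"
    proof (rule ex_le)
      fix H :: "nat graph" assume H: "simple_graph H" "card (verts H) = n" "free_of ?F H"
      have no: "\<not> contains (star_forest 1 4) H" using H(3) free_of_iff[OF simp] by blast
      show "card (copies (star t) H) \<le> 6 * n ^ t"
      proof (cases "edges H = {}")
        case True
        then have "copies (star t) H = {}" using copies_star_iff[OF H(1) t] t by (auto simp: nbrs_def)
        then show ?thesis by simp
      next
        case False
        then obtain e where e: "e \<in> edges H" by blast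
        then obtain u v where uv: "e = {u, v}" "u \<noteq> v" using simple_graph_edge(2)[OF H(1)] by (metis card_2_iff)
        have meet: "e' \<inter> {u, v} \<noteq> {}" if e': "e' \<in> edges H" for e'
        proof
          assume disj: "e' \<inter> {u, v} = {}"
          obtain x y where xy: "e' = {x, y}" "x \<noteq> y" using simple_graph_edge(2)[OF H(1) e'] by (metis card_2_iff)
          have vs: "{u, v, x, y} \<subseteq> verts H" using simple_graph_edge(1)[OF H(1)] e e' uv xy by auto
          define f where "f = (\<lambda>i::nat. if i = 0 then u else if i = 1 then v else if i = 2 then x else y)"
          have four: "{..<4::nat} = {0, 1, 2, 3}" by auto
          have "contains (star_forest 1 4) H" unfolding contains_def
          proof (intro exI conjI ballI)
            show "inj_on f (verts (star_forest 1 4))"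
              unfolding star_forest_def fst_conv four using disj xy uv by (auto simp: f_def inj_on_def)
            show "f ` verts (star_forest 1 4) \<subseteq> verts H"
              unfolding star_forest_def fst_conv four using vs by (auto simp: f_def)
            fix c assume "c \<in> edges (star_forest 1 4)"
            then obtain i j :: nat where ij: "c = {i * (1 + 1), i * (1 + 1) + j}" "i < 4 div (1 + 1)" "j \<in> {1..1}"
              unfolding star_forest_def by auto
            have "(4::nat) div (1 + 1) = 2" unfolding one_add_one by simp
            then have "i < 2" using ij(2) by linarith
            then have "i = 0 \<or> i = 1" by linarith
            moreover have "j = 1" using ij(3) by simp
            ultimately consider "c = {0, 1}" | "c = {2, 3}" using ij(1) by fastforce
            then show "f ` c \<in> edges H"
            proof cases
              case 1
              then have "f ` c = e" by (auto simp: f_def uv(1))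
              then show ?thesis using e by simp
            next
              case 2
              then have "f ` c = e'" by (auto simp: f_def xy(1))
              then show ?thesis using e' by simp
            qed
          qed
          then show False using no by blast
        qed
        have small: "deg H w choose t \<le> 4" if w: "w \<notin> {u, v}" for w
        proof -
          have "nbrs H w \<subseteq> {u, v}" using meet w by (force simp: nbrs_def)
          then have "deg H w \<le> card {u, v}" by (intro card_mono) auto
          then have "deg H w \<le> 2" using uv by simp
          then have "(2::nat) ^ deg H w \<le> 2 ^ 2" by (intro power_increasing) auto
          then show ?thesis using binomial_le_pow2[of "deg H w" t] by simp
        qed
        have uvH: "{u, v} \<subseteq> verts H" using simple_graph_edge(1)[OF H(1) e] uv by simp
        have "card (copies (star t) H) \<le> (\<Sum>w\<in>verts H. deg H w choose t)" by (rule card_copies_star_le[OF H(1) t])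
        also have "\<dots> = (\<Sum>w\<in>{u, v}. deg H w choose t) + (\<Sum>w\<in>verts H - {u, v}. deg H w choose t)"
          using uvH finite_verts[OF H(1)] by (subst sum.subset_diff[of "{u, v}"]) auto
        also have "\<dots> \<le> (\<Sum>w\<in>{u, v}. n ^ t) + (\<Sum>w\<in>verts H - {u, v}. 4)"
        proof (intro add_mono sum_mono)
          fix w
          have "deg H w choose t \<le> deg H w ^ t" by (rule choose_le_power[OF t])
          also have "\<dots> \<le> n ^ t" unfolding H(2)[symmetric] by (intro power_mono deg_le H) simp
          finally show "deg H w choose t \<le> n ^ t" .
        qed (use small in auto)
        also have "\<dots> \<le> 2 * n ^ t + 4 * n"
        proof -
          have "card (verts H - {u, v}) \<le> n" unfolding H(2)[symmetric] using finite_verts[OF H(1)] by (intro card_mono) auto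
          then show ?thesis using uv by simp
        qed
        finally have "card (copies (star t) H) \<le> 2 * n ^ t + 4 * n" .
        moreover have "n \<le> n ^ t" using t n by (intro self_le_power) auto
        ultimately show ?thesis by linarith
      qed
    qed
    then have "real (ex n (star t) ?F) \<le> real (6 * n ^ t)" by (simp only: of_nat_le_iff)
    then show "real (ex n (star t) ?F) \<le> 6 * real n powr real_of_rat (of_nat t)"
      using n by (simp add: powr_realpow)
  qed (use t simp in auto)
qed

text \<open>Nothing is forbidden. The lower bound uses a balanced complete bipartite graph rather
  than a complete one because \<open>card_copies_star_ge\<close> asks for an independent set of
  centres; this costs only a constant factor.\<close>

lemma realizable_t_plus_1:
  assumes t: "1 \<le> t" shows "realizable (of_nat t + 1) (star t)"
proof (rule realizableI[of "{}" "1 / (4 * (2 * real t) ^ t)" "2 * t + 2"])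
  fix n assume n: "2 * t + 2 \<le> n"
  have e: "real_of_rat (of_nat t + 1) = real t + 1" by (simp add: of_rat_add)
  have pw: "real n powr real_of_rat (of_nat t + 1) = real n ^ (t + 1)"
    unfolding e using n powr_realpow[of "real n" "t + 1"] by (simp add: add.commute)
  have "ex n (star t) {} \<le> n ^ (t + 1)" using copies_star_le_power[OF _ t] by (intro ex_le) auto
  then have "real (ex n (star t) {}) \<le> real (n ^ (t + 1))" by (simp only: of_nat_le_iff)
  then show "real (ex n (star t) {}) \<le> 1 * real n powr real_of_rat (of_nat t + 1)" unfolding pw by simp
  define m where "m = n div 2"
  define G where "G = ({..<n}, {{x, y} |x y. x < m \<and> m \<le> y \<and> y < n})"
  have mn: "m \<le> n" by (simp add: m_def)
  have sG: "simple_graph G" using mn by (auto simp: simple_graph_def G_def card_insert_if)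
  have nb: "nbrs G x = {m..<n}" if x: "x < m" for x
  proof
    show "nbrs G x \<subseteq> {m..<n}" using x by (auto simp: nbrs_def G_def doubleton_eq_iff)
    show "{m..<n} \<subseteq> nbrs G x" using x unfolding nbrs_def G_def snd_conv atLeastLessThan_def by blast
  qed
  have "(\<Sum>x\<in>{..<m}. deg G x choose t) \<le> card (copies (star t) G)"
    using nb mn by (intro card_copies_star_ge[OF sG t]) (auto simp: G_def)
  also have "\<dots> \<le> ex n (star t) {}" by (rule ex_ge[OF sG]) (auto simp: G_def free_of_def)
  finally have "m * ((n - m) choose t) \<le> ex n (star t) {}" by (simp add: nb)
  then have 1: "real m * real ((n - m) choose t) \<le> real (ex n (star t) {})"
    by (metis of_nat_le_iff of_nat_mult)
  have 2: "real n / 4 \<le> real m"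
  proof -
    have "n \<le> 4 * m" using n unfolding m_def by presburger
    then have "real n \<le> real (4 * m)" by (simp only: of_nat_le_iff)
    then show ?thesis by simp
  qed
  have nm: "n \<le> 2 * (n - m)" by (simp add: m_def)
  have "(real n / (2 * real t)) ^ t \<le> (real (n - m) / real t) ^ t"
  proof (rule power_mono)
    have "real n \<le> real (2 * (n - m))" using nm by (simp only: of_nat_le_iff)
    then show "real n / (2 * real t) \<le> real (n - m) / real t" using t by (simp add: field_simps)
  qed simp
  also have "\<dots> \<le> real ((n - m) choose t)" using n nm by (intro choose_ge_power t) auto
  finally have "real n / 4 * (real n / (2 * real t)) ^ t \<le> real m * real ((n - m) choose t)"
    using 2 by (intro mult_mono) auto
  then have "real n / 4 * (real n / (2 * real t)) ^ t \<le> real (ex n (star t) {})" using 1 by linarith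
  then show "1 / (4 * (2 * real t) ^ t) * real n powr real_of_rat (of_nat t + 1) \<le> real (ex n (star t) {})"
    unfolding pw by (simp add: power_divide)
qed (use t in auto)

theorem theorem1p3:
  fixes t :: nat and r :: rat
  assumes "t \<ge> 1"
  shows "realizable r (star t) \<longleftrightarrow> r \<in> {0, 1} \<or> r \<in> {of_nat t .. of_nat t + 1}"
proof
  assume "r \<in> {0, 1} \<or> r \<in> {of_nat t .. of_nat t + 1}"
  then consider "r = 0" | "r = 1" | "r = of_nat t" | "r = of_nat t + 1" | "of_nat t < r" "r < of_nat t + 1"
    by fastforce
  then show "realizable r (star t)"
    using realizable_0 realizable_1 realizable_t realizable_t_plus_1 realizable_interior assms by cases auto
qed (rule realizable_star_only_if[OF assms])

end
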